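(* Let $(X_N)$ be a sequence where $X_N$ is the $N$-point set in $\mathbb{S}^2$ given by the zeros of the random elliptic polynomial of degree $N$ mapped to the sphere by the stereographic projection. Then $(X_N)$ is a sequence of QMC designs on average for $\mathbb{H}^s(\mathbb{S}^2)$ for every $1<s<3$, and for every $s\in(3,4)$ there exists a constant $C>0$ such that $$N^3\,\mathbb{E}\left[\mathrm{wce}(X_N,\mathbb{H}^s(\mathbb{S}^2))^2\right]\ge C ,$$ i.e. the average QMC strength of $(X_N)$ is $s^*=3$.
   Context: $\mathbb{S}^2=\{x\in\mathbb{R}^{3}: |x|=1\}$ carries the normalized Lebesgue (surface) measure $\sigma$, $\sigma(\mathbb{S}^2)=1$. For $\ell\ge 0$, $\mathcal{H}_\ell$ is the space of real spherical harmonics of degree $\ell$ on $\mathbb{S}^2$ (eigenfunctions of $-\Delta$, with $\Delta$ the Laplace–Beltrami operator, with eigenvalue $\lambda_\ell=\ell(\ell+1)$), $h_\ell=\dim\mathcal{H}_\ell=2\ell+1$, and $\{Y_{\ell,k}\}_{k=1}^{h_\ell}$ is an orthonormal basis of $\mathcal{H}_\ell$ in $L^2(\mathbb{S}^2,\sigma)$. Sobolev spaces: for real $f\in L^2(\mathbb{S}^2)$ put $f_{\ell,k}=\int_{\mathbb{S}^2} fY_{\ell,k}\,d\sigma$. For $s\ge0$, $\mathbb{H}^s(\mathbb{S}^2)$ is the set of $f\in L^2(\mathbb{S}^2)$ with $\sum_{\ell\ge0}\sum_{k=1}^{h_\ell}(1+\lambda_\ell)^s|f_{\ell,k}|^2<\infty$,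 with norm $\|f\|_{\mathbb{H}^s(\mathbb{S}^2)}=\big(\sum_{\ell\ge0}\sum_{k=1}^{h_\ell}\frac{1}{a_\ell^{(s)}}|f_{\ell,k}|^2\big)^{1/2}$, where $(a_\ell^{(s)})_{\ell\ge 0}$ is a fixed sequence of positive numbers with $a_\ell^{(s)}\sim(1+\ell^2)^{-s}$, i.e. the ratio is bounded above and below by positive constants depending only on $s$. For $s>1$, $\mathbb{H}^s(\mathbb{S}^2)$ embeds continuously in the continuous functions (so point evaluations make sense). Worst-case error: for an $N$-point set $X_N\subset\mathbb{S}^2$ and $s>1$, $$\mathrm{wce}(X_N,\mathbb{H}^s(\mathbb{S}^2))=\sup_{\|f\|_{\mathbb{H}^s(\mathbb{S}^2)}\le1}\left|\frac1N\sum_{x\in X_N}f(x)-\int_{\mathbb{S}^2}f\,d\sigma\right|.$$ QMC designs on average: a sequence $(X_N)$ of random $N$-point configurations on $\mathbb{S}^2$ is a sequence of QMC designs on average for $\mathbb{H}^s(\mathbb{S}^2)$, $s>1$, if there is $C_{s}>0$ such that $\sqrt{\mathbb{E}[\mathrm{wce}(X_N,\mathbb{H}^s(\mathbb{S}^2))^2]}\le C_{s}N^{-s/2}$ for all $N$. The average QMC strength of $(X_N)$ is the maximal $s^*>1$ such that $(X_N)$ is a sequence of QMC designs on average for $\mathbb{H}^s(\mathbb{S}^2)$ for all $1<s<s^*$. Elliptic polynomials (also called Kostlan–Shub–Smale or $SU(2)$ polynomials): the random polynomials $\sum_{n=0}^N a_n\sqrt{\binom Nn}\,z^n$, where $a_0,\dots,a_N$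 are i.i.d. standard complex Gaussian random variables. Almost surely such a polynomial has $N$ distinct zeros in $\mathbb{C}$, and $X_N=\{x_1,\dots,x_N\}\subset\mathbb{S}^2$ is the set of points with $g(x_i)$ equal to these zeros, where $g(x)=\frac{x^{(1)}+i x^{(2)}}{1-x^{(3)}}$ is the stereographic projection from the north pole of $x=(x^{(1)},x^{(2)},x^{(3)})\in\mathbb{S}^2$ onto the equatorial plane identified with $\mathbb{C}$. *)

theory Defs
  imports "HOL-Probability.Probability" "HOL-Computational_Algebra.Polynomial"
begin

abbreviation S2 :: "(real^3) set" where
  "S2 \<equiv> sphere 0 1"

text \<open>Normalized surface measure: the measure of \<open>A\<close> is the volume of the cone over \<open>A\<close>, divided
  by the volume of the unit ball. The underlying space is the sphere itself, so values of functions
  off the sphere play no role.\<close>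

definition sphere_measure :: "(real^3) measure" where
  "sphere_measure =
     restrict_space (distr (uniform_measure lborel (ball 0 1)) borel (\<lambda>x. x /\<^sub>R norm x)) S2"

text \<open>Differential calculus on the sphere is expressed through the extension of a function that is
  constant on rays: the Laplace-Beltrami operator is the Euclidean Laplacian of this extension,
  evaluated on the sphere.\<close>

definition ray_ext :: "(real^3 \<Rightarrow> real) \<Rightarrow> real^3 \<Rightarrow> real" where
  "ray_ext f y = f (y /\<^sub>R norm y)"

definition C2_on :: "('a::euclidean_space) set \<Rightarrow> ('a \<Rightarrow> real) \<Rightarrow> bool" where
  "C2_on U F \<longleftrightarrow>
     (\<exists>(F' :: 'a \<Rightarrow> 'a \<Rightarrow>\<^sub>L real) (F'' :: 'a \<Rightarrow> 'a \<Rightarrow>\<^sub>L 'a \<Rightarrow>\<^sub>L real).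
        (\<forall>x\<in>U. (F has_derivative blinfun_apply (F' x)) (at x)) \<and>
        (\<forall>x\<in>U. (F' has_derivative blinfun_apply (F'' x)) (at x)) \<and>
        continuous_on U F'')"

definition laplacian :: "(('a::euclidean_space) \<Rightarrow> real) \<Rightarrow> 'a \<Rightarrow> real" where
  "laplacian F x = (\<Sum>b\<in>Basis. (deriv ^^ 2) (\<lambda>t::real. F (x + t *\<^sub>R b)) 0)"

definition laplace_beltrami :: "(real^3 \<Rightarrow> real) \<Rightarrow> real^3 \<Rightarrow> real" where
  "laplace_beltrami f = laplacian (ray_ext f)"

definition eigval :: "nat \<Rightarrow> real" where
  "eigval l = real l * (real l + 1)"

definition spherical_harmonics :: "nat \<Rightarrow> (real^3 \<Rightarrow> real) set" where
  "spherical_harmonics l =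
     {f. C2_on (- {0}) (ray_ext f) \<and> (\<forall>x\<in>S2. - laplace_beltrami f x = eigval l * f x)}"

text \<open>Functions are identified when they agree on the sphere.\<close>

definition harmonic_onb :: "nat \<Rightarrow> (nat \<Rightarrow> real^3 \<Rightarrow> real) \<Rightarrow> bool" where
  "harmonic_onb l Y \<longleftrightarrow>
     (\<forall>k\<in>{1..2*l+1}. Y k \<in> spherical_harmonics l) \<and>
     (\<forall>j\<in>{1..2*l+1}. \<forall>k\<in>{1..2*l+1}.
        (LINT x|sphere_measure. Y j x * Y k x) = (if j = k then 1 else 0)) \<and>
     (\<forall>f\<in>spherical_harmonics l. \<exists>c. \<forall>x\<in>S2. f x = (\<Sum>k=1..2*l+1. c k * Y k x))"

definition L2_sphere :: "(real^3 \<Rightarrow> real) set" where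
  "L2_sphere =
     {f. f \<in> borel_measurable sphere_measure \<and> integrable sphere_measure (\<lambda>x. (f x)\<^sup>2)}"

definition fcoeff :: "(nat \<Rightarrow> nat \<Rightarrow> real^3 \<Rightarrow> real) \<Rightarrow> (real^3 \<Rightarrow> real) \<Rightarrow> nat \<Rightarrow> nat \<Rightarrow> real" where
  "fcoeff Y f l k = (LINT x|sphere_measure. f x * Y l k x)"

definition sobolev :: "(nat \<Rightarrow> nat \<Rightarrow> real^3 \<Rightarrow> real) \<Rightarrow> real \<Rightarrow> (real^3 \<Rightarrow> real) set" where
  "sobolev Y s =
     {f \<in> L2_sphere. summable (\<lambda>l. \<Sum>k=1..2*l+1. (1 + eigval l) powr s * \<bar>fcoeff Y f l k\<bar>\<^sup>2)}"

definition sobolev_weights :: "real \<Rightarrow> (nat \<Rightarrow> real) \<Rightarrow> bool" where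
  "sobolev_weights s a \<longleftrightarrow>
     (\<forall>l. a l > 0) \<and>
     (\<exists>c1>0. \<exists>c2>0. \<forall>l. c1 * (1 + (real l)\<^sup>2) powr (- s) \<le> a l \<and>
                       a l \<le> c2 * (1 + (real l)\<^sup>2) powr (- s))"

definition sobolev_norm ::
    "(nat \<Rightarrow> nat \<Rightarrow> real^3 \<Rightarrow> real) \<Rightarrow> (nat \<Rightarrow> real) \<Rightarrow> (real^3 \<Rightarrow> real) \<Rightarrow> real" where
  "sobolev_norm Y a f = sqrt (\<Sum>l. \<Sum>k=1..2*l+1. 1 / a l * \<bar>fcoeff Y f l k\<bar>\<^sup>2)"

text \<open>For \<open>s > 1\<close> point evaluation of a Sobolev class refers to its unique continuous
  representative, so the supremum runs over the continuous functions in the unit ball. It is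
  taken in \<open>ennreal\<close>, so that it needs no boundedness side condition.\<close>

definition wce ::
    "(nat \<Rightarrow> nat \<Rightarrow> real^3 \<Rightarrow> real) \<Rightarrow> (real \<Rightarrow> nat \<Rightarrow> real) \<Rightarrow> real \<Rightarrow> (real^3) set \<Rightarrow> ennreal" where
  "wce Y a s X =
     (SUP f \<in> {f \<in> sobolev Y s. continuous_on S2 f \<and> sobolev_norm Y (a s) f \<le> 1}.
        ennreal \<bar>(\<Sum>x\<in>X. f x) / real (card X) - (LINT x|sphere_measure. f x)\<bar>)"

definition expected_sq_wce ::
    "'w measure \<Rightarrow> (nat \<Rightarrow> nat \<Rightarrow> real^3 \<Rightarrow> real) \<Rightarrow> (real \<Rightarrow> nat \<Rightarrow> real) \<Rightarrow> real \<Rightarrow>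
       ('w \<Rightarrow> (real^3) set) \<Rightarrow> ennreal" where
  "expected_sq_wce M Y a s X = (\<integral>\<^sup>+\<omega>. (wce Y a s (X \<omega>))\<^sup>2 \<partial>M)"

text \<open>A random \<open>N\<close>-point configuration need only be one almost surely. Measurability means that all
  linear statistics of continuous functions are random variables, up to null sets.\<close>

definition random_configuration :: "'w measure \<Rightarrow> nat \<Rightarrow> ('w \<Rightarrow> (real^3) set) \<Rightarrow> bool" where
  "random_configuration M N X \<longleftrightarrow>
     (AE \<omega> in M. X \<omega> \<subseteq> S2 \<and> finite (X \<omega>) \<and> card (X \<omega>) = N) \<and>
     (\<forall>f. continuous_on S2 f \<longrightarrow>
        (\<lambda>\<omega>. \<Sum>x\<in>X \<omega>. (f x :: real)) \<in> borel_measurable (completion M))"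

definition qmc_on_average ::
    "'w measure \<Rightarrow> (nat \<Rightarrow> nat \<Rightarrow> real^3 \<Rightarrow> real) \<Rightarrow> (real \<Rightarrow> nat \<Rightarrow> real) \<Rightarrow> real \<Rightarrow>
       (nat \<Rightarrow> 'w \<Rightarrow> (real^3) set) \<Rightarrow> bool" where
  "qmc_on_average M Y a s X \<longleftrightarrow>
     (\<forall>N\<ge>1. random_configuration M N (X N)) \<and>
     (\<exists>C>0. \<forall>N\<ge>1. expected_sq_wce M Y a s (X N) < \<infinity> \<and>
        sqrt (enn2real (expected_sq_wce M Y a s (X N))) \<le> C * real N powr (- s / 2))"

definition average_qmc_strength ::
    "'w measure \<Rightarrow> (nat \<Rightarrow> nat \<Rightarrow> real^3 \<Rightarrow> real) \<Rightarrow> (real \<Rightarrow> nat \<Rightarrow> real) \<Rightarrow>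
       (nat \<Rightarrow> 'w \<Rightarrow> (real^3) set) \<Rightarrow> real \<Rightarrow> bool" where
  "average_qmc_strength M Y a X s' \<longleftrightarrow>
     s' > 1 \<and> (\<forall>s. 1 < s \<and> s < s' \<longrightarrow> qmc_on_average M Y a s X) \<and>
     (\<forall>t>1. (\<forall>s. 1 < s \<and> s < t \<longrightarrow> qmc_on_average M Y a s X) \<longrightarrow> t \<le> s')"

definition std_complex_gaussian :: "'w measure \<Rightarrow> ('w \<Rightarrow> complex) \<Rightarrow> bool" where
  "std_complex_gaussian M Z \<longleftrightarrow>
     distributed M lborel Z (\<lambda>z. ennreal (exp (- (cmod z)\<^sup>2) / pi))"

definition elliptic_poly :: "nat \<Rightarrow> (nat \<Rightarrow> complex) \<Rightarrow> complex poly" where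
  "elliptic_poly N c = (\<Sum>n\<le>N. monom (c n * of_real (sqrt (real (N choose n)))) n)"

definition stereo :: "real^3 \<Rightarrow> complex" where
  "stereo x = Complex (x$1) (x$2) / of_real (1 - x$3)"

text \<open>The pole, where \<open>stereo\<close> is undefined, is excluded explicitly.\<close>

definition elliptic_points :: "nat \<Rightarrow> (nat \<Rightarrow> complex) \<Rightarrow> (real^3) set" where
  "elliptic_points N c = {x \<in> S2. x$3 \<noteq> 1 \<and> poly (elliptic_poly N c) (stereo x) = 0}"

end

theory Submission
  imports Defs "HOL-Analysis.Cross3" "HOL-Real_Asymp.Real_Asymp" "HOL-Computational_Algebra.Fundamental_Theorem_Algebra"
begin

text \<open>The zeros of an elliptic polynomial repel each other rigidly, and the size of their fluctuations
  can be computed exactly. For a spherical harmonic \<open>Y\<close> of degree \<open>l \<ge> 1\<close> and \<open>L2\<close> norm one, the sum of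
  \<open>Y\<close> over the zeros has second moment
  \<open>\<lambda>\<^sub>l\<^sup>2 * (\<Sum>m\<ge>1. funk_hecke (N * m) l / m\<^sup>2)\<close> with \<open>\<lambda>\<^sub>l = l * (l + 1)\<close>
  (\<open>Y_statistic_second_moment\<close>). The theorem is read off from this formula.

  The formula arises as follows. The logarithm of the modulus of the polynomial, divided by its
  Fubini-Study weight, is a constant plus a sum of logarithms of chordal distances to the zeros
  (\<open>elliptic_value_product\<close>). Integration against \<open>Y\<close> reproduces the sum of \<open>Y\<close> over the zeros up to
  the factor \<open>- \<lambda>\<^sub>l\<close>, because the logarithmic kernel has the eigenvalue \<open>- 1 / \<lambda>\<^sub>l\<close> on harmonics of
  degree \<open>l\<close> (\<open>sum_over_zeros\<close>, \<open>log_kernel\<close>). The variance thus becomes a double integral of the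
  covariance of the logarithms of two correlated standard complex Gaussians, and that covariance is
  the dilogarithm of the squared modulus of their correlation (\<open>expectation_ln_ln\<close>). For an elliptic polynomial
  this squared modulus is \<open>w ^ N\<close> with \<open>w = (1 + x \<bullet> y) / 2\<close>, so the covariance is a power series in \<open>w\<close> with
  nonnegative coefficients, and the power \<open>w ^ n\<close> acts on harmonics of degree \<open>l\<close> as the scalar
  \<open>funk_hecke n l\<close> (\<open>funk_hecke_power\<close>).

  All facts about spherical harmonics rest on one symmetry. The surface measure is rotation
  invariant, so the Laplace-Beltrami operator, a sum of squares of infinitesimal rotations, is
  self-adjoint (\<open>harmonic_zonal_adjoint\<close>). Applied to powers of \<open>w\<close> this gives a two-term recurrence
  for the moments of a harmonic, and thereby the Funk-Hecke formula; orthogonality, the addition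
  theorem and completeness follow from it.

  For the upper bound, the squared worst-case error is at most a weighted sum of the squared
  means of the harmonics over the points (\<open>wce_sq_le\<close>). The scalar \<open>funk_hecke n l\<close> is at most
  \<open>exp (- l\<^sup>2 / (2 * n)) / n\<close>, so degrees up to about \<open>sqrt N\<close> matter, and for \<open>1 < s < 3\<close> the weighted sum of the
  variances is of order \<open>N powr (- s)\<close> (\<open>weighted_variance_sum\<close>). For the lower bound, a single
  harmonic of degree one already produces an expected squared error of order \<open>N powr (- 3)\<close> for every \<open>s\<close>
  (\<open>expected_sq_wce_lower\<close>). This excludes any rate better than \<open>N powr (- 3 / 2)\<close>, so the strength is
  exactly 3.\<close>

section \<open>The surface measure and its rotations\<close>

text \<open>Rodrigues' formula: for a unit vector \<open>e\<close> this is the rotation by the angle \<open>t\<close> about \<open>e\<close>.\<close>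

definition rot :: "real^3 \<Rightarrow> real \<Rightarrow> real^3 \<Rightarrow> real^3" where
  "rot e t x = cos t *\<^sub>R x + sin t *\<^sub>R cross3 e x + ((1 - cos t) * (e \<bullet> x)) *\<^sub>R e"

lemma rot_0 [simp]: "rot e 0 x = x"
  by (simp add: rot_def)

lemma linear_rot: "linear (rot e t)"
  by (rule linearI)
     (simp_all add: rot_def cross_add_right cross_mult_right inner_simps algebra_simps)

lemma inner_rot:
  assumes "norm e = 1"
  shows "rot e t x \<bullet> rot e t y = x \<bullet> y"
proof -
  have e: "e \<bullet> e = 1" using assms by (simp add: dot_square_norm)
  have cc: "cross3 e x \<bullet> cross3 e y = x \<bullet> y - (e \<bullet> x) * (e \<bullet> y)"
  proof -
    have "cross3 e x \<bullet> cross3 e y = (e \<bullet> e) * (x \<bullet> y) - (e \<bullet> x) * (e \<bullet> y)"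
      by (simp add: cross3_simps)
    with e show ?thesis by simp
  qed
  have c1: "cross3 e x \<bullet> e = 0" "e \<bullet> cross3 e x = 0" "cross3 e y \<bullet> e = 0" "e \<bullet> cross3 e y = 0"
    by (simp_all add: dot_cross_self)
  have c2: "y \<bullet> cross3 e x = - (x \<bullet> cross3 e y)"
    by (simp add: cross3_simps)
  have t: "sin t * (sin t * z) = z - cos t * (cos t * z)" for z
  proof -
    have "sin t * sin t = 1 - cos t * cos t"
      using sin_cos_squared_add[of t] by (simp add: power2_eq_square)
    then have "(sin t * sin t) * z = (1 - cos t * cos t) * z" by simp
    then show ?thesis by (simp add: algebra_simps)
  qed
  show ?thesis
    unfolding rot_def
    by (simp add: inner_simps cc c1 e algebra_simps)
       (simp add: inner_commute c2 algebra_simps t)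
qed

lemma continuous_on_rot: "continuous_on S (rot e t)"
  using linear_rot[of e t] linear_continuous_on linear_conv_bounded_linear by blast

lemma orthogonal_rot: "norm e = 1 \<Longrightarrow> orthogonal_transformation (rot e t)"
  by (simp add: orthogonal_transformation_def linear_rot inner_rot)

lemma rot_in_S2: "norm e = 1 \<Longrightarrow> x \<in> S2 \<Longrightarrow> rot e t x \<in> S2"
  using inner_rot[of e t x x] by (simp add: norm_eq_sqrt_inner)

lemma cross_cross_unit:
  assumes "norm e = 1" shows "cross3 e (cross3 e x) = (e \<bullet> x) *\<^sub>R e - x"
proof -
  have "cross3 e (cross3 e x) = (e \<bullet> x) *\<^sub>R e - (e \<bullet> e) *\<^sub>R x"
    by (simp add: cross3_simps forall_3)
  with assms show ?thesis by (simp add: dot_square_norm)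
qed

lemma rot_minus_rot:
  assumes "norm e = 1"
  shows "rot e (-t) (rot e t x) = x"
proof -
  have e: "e \<bullet> e = 1" using assms by (simp add: dot_square_norm)
  note ec = cross_cross_unit[OF assms, of x]
  have t: "sin t * sin t = 1 - cos t * cos t"
    using sin_cos_squared_add[of t] by (simp add: power2_eq_square)
  have x: "e \<bullet> rot e t x = e \<bullet> x"
    by (simp add: rot_def inner_simps dot_cross_self e algebra_simps)
  have c: "cross3 e (rot e t x) = cos t *\<^sub>R cross3 e x + sin t *\<^sub>R ((e \<bullet> x) *\<^sub>R e - x)"
    by (simp add: rot_def cross_add_right cross_mult_right ec)
  have "rot e (-t) (rot e t x) = (cos t * cos t + sin t * sin t) *\<^sub>R x
     + (cos t * sin t - sin t * cos t) *\<^sub>R cross3 e x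
     + ((e \<bullet> x) * (cos t * (1 - cos t) - sin t * sin t + (1 - cos t))) *\<^sub>R e"
    unfolding rot_def[of e "-t" "rot e t x"] x c
    by (simp add: rot_def algebra_simps scaleR_add_left scaleR_diff_left
      del: sin_cos_squared_add sin_cos_squared_add2 sin_cos_squared_add3)
  also have "\<dots> = x"
  proof -
    have "cos t * cos t + sin t * sin t = 1" "cos t * sin t - sin t * cos t = 0"
      "cos t * (1 - cos t) - sin t * sin t + (1 - cos t) = 0"
      by (simp_all add: t algebra_simps)
    then show ?thesis by simp
  qed
  finally show ?thesis .
qed

lemma lborel_distr_orthogonal:
  fixes T :: "real^'n::{finite,wellorder} \<Rightarrow> real^'n::_"
  assumes T: "orthogonal_transformation T"
  shows "distr lborel borel T = lborel"
proof (rule lborel_eqI[symmetric])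
  have [measurable]: "T \<in> borel_measurable borel"
    using T by (intro borel_measurable_continuous_onI linear_continuous_on)
       (simp add: orthogonal_transformation_linear linear_conv_bounded_linear[symmetric])
  fix l u :: "real^'n::_" assume lu: "\<And>b. b \<in> Basis \<Longrightarrow> l \<bullet> b \<le> u \<bullet> b"
  have inv: "orthogonal_transformation (inv T)" and surj: "surj T" and bij: "bij T"
    using T orthogonal_transformation_inv orthogonal_transformation_surj orthogonal_transformation_bij
    by blast+
  have eq: "T -` box l u = inv T ` box l u"
    using bij by (simp add: bij_vimage_eq_inv_image)
  have lm: "T -` box l u \<in> lmeasurable"
    unfolding eq using measurable_orthogonal_image[OF inv, of "box l u"] by simp
  have "emeasure (distr lborel borel T) (box l u) = emeasure lborel (T -` box l u)"
    by (subst emeasure_distr) auto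
  also have "\<dots> = emeasure lebesgue (T -` box l u)"
  proof -
    have "T -` box l u \<in> sets borel" by (rule measurable_sets_borel[where M=borel]) auto
    then show ?thesis by simp
  qed
  also have "\<dots> = ennreal (measure lebesgue (T -` box l u))"
    using lm by (simp add: emeasure_eq_measure2)
  also have "measure lebesgue (T -` box l u) = measure lebesgue (box l u)"
    unfolding eq using measure_orthogonal_image[OF inv, of "box l u"] by simp
  also have "\<dots> = (\<Prod>b\<in>Basis. (u - l) \<bullet> b)"
    using lu by (simp add: measure_completion)
  finally show "emeasure (distr lborel borel T) (box l u) = (\<Prod>b\<in>Basis. (u - l) \<bullet> b)" .
qed simp

lemma sphere_measure_space [simp]: "space sphere_measure = S2"
  by (simp add: sphere_measure_def space_restrict_space)

lemma sphere_measure_sets: "sets sphere_measure = sets (restrict_space borel S2)"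
  by (simp add: sphere_measure_def sets_restrict_space)

lemma S2_sets_borel [measurable]: "S2 \<in> sets borel"
  by simp

lemma emeasure_sphere_measure:
  assumes "A \<in> sets borel" "A \<subseteq> S2"
  shows "emeasure sphere_measure A =
    emeasure (uniform_measure lborel (ball (0::real^3) 1)) ((\<lambda>x. x /\<^sub>R norm x) -` A)"
  unfolding sphere_measure_def using assms
  by (subst emeasure_restrict_space) (auto simp: emeasure_distr)

interpretation sphere: prob_space sphere_measure
proof
  let ?U = "uniform_measure lborel (ball (0::real^3) 1)"
  have b: "emeasure lborel (ball (0::real^3) 1) \<noteq> 0" "emeasure lborel (ball (0::real^3) 1) \<noteq> \<infinity>"
    using emeasure_lborel_ball_finite[of "0::real^3" 1]
    by (auto simp: emeasure_lborel_ball_finite less_top content_ball_pos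
        measure_def dest!: arg_cong[of _ 0 enn2real] intro: less_irrefl)
       (metis content_ball_pos enn2real_0 less_irrefl measure_def zero_less_one)
  interpret U: prob_space ?U by (rule prob_space_uniform_measure[OF b])
  have "AE x in lborel. (x::real^3) \<noteq> 0" by (rule AE_lborel_singleton)
  then have "AE x in ?U. x \<noteq> 0"
    using b by (intro AE_uniform_measureI) auto
  moreover have nm: "(\<lambda>x::real^3. x /\<^sub>R norm x) -` S2 \<in> sets borel"
    by (rule measurable_sets_borel[where M=borel]) auto
  moreover have "{x \<in> space ?U. x \<in> (\<lambda>x. x /\<^sub>R norm x) -` S2} \<in> sets ?U"
    by measurable
  ultimately have "emeasure ?U ((\<lambda>x. x /\<^sub>R norm x) -` S2) = 1"
    by (intro U.emeasure_eq_1_AE) (auto simp: nm)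
  then show "emeasure sphere_measure (space sphere_measure) = 1"
    by (simp add: emeasure_sphere_measure)
qed

lemma continuous_on_S2_measurable:
  "continuous_on S2 f \<Longrightarrow> f \<in> borel_measurable sphere_measure"
  using borel_measurable_continuous_on_restrict measurable_cong_sets[OF sphere_measure_sets refl] by blast

lemma continuous_on_S2_bounded:
  fixes f :: "real^3 \<Rightarrow> real"
  assumes "continuous_on S2 f" obtains B where "B > 0" "\<And>x. x \<in> S2 \<Longrightarrow> \<bar>f x\<bar> \<le> B"
proof -
  have "bounded (f ` S2)"
    by (intro compact_imp_bounded compact_continuous_image assms) simp
  then show ?thesis using that unfolding bounded_pos by (auto simp: image_iff)
qed

lemma continuous_on_S2_integrable:
  fixes f :: "real^3 \<Rightarrow> real"
  assumes "continuous_on S2 f" shows "integrable sphere_measure f"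
proof -
  obtain B where "B > 0" "\<And>x. x \<in> S2 \<Longrightarrow> \<bar>f x\<bar> \<le> B" using continuous_on_S2_bounded[OF assms] by blast
  then show ?thesis
    by (intro sphere.integrable_const_bound[of _ B]) (auto simp: continuous_on_S2_measurable assms)
qed

lemma rot_measurable: "norm e = 1 \<Longrightarrow> rot e t \<in> sphere_measure \<rightarrow>\<^sub>M sphere_measure"
proof -
  assume e: "norm e = 1"
  have "rot e t \<in> sphere_measure \<rightarrow>\<^sub>M borel"
    by (rule continuous_on_S2_measurable[OF continuous_on_rot])
  then have "rot e t \<in> sphere_measure \<rightarrow>\<^sub>M restrict_space borel S2"
    using rot_in_S2[OF e] by (intro measurable_restrict_space2) auto
  then show ?thesis by (simp add: measurable_cong_sets[OF refl sphere_measure_sets])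
qed

text \<open>Lebesgue measure on the ball is invariant under the rotation, and the radial projection onto the
  sphere commutes with it.\<close>

lemma distr_rot:
  assumes e: "norm e = 1"
  shows "distr sphere_measure sphere_measure (rot e t) = sphere_measure"
proof (rule measure_eqI)
  let ?U = "uniform_measure lborel (ball (0::real^3) 1)" and ?n = "\<lambda>x::real^3. x /\<^sub>R norm x"
  let ?T = "rot e t"
  have [measurable]: "?T \<in> borel_measurable borel"
    by (rule borel_measurable_continuous_onI[OF continuous_on_rot])
  have nT: "norm (?T x) = norm x" for x
    using inner_rot[OF e, of t x x] by (simp add: norm_eq_sqrt_inner)
  have lT: "?T (c *\<^sub>R x) = c *\<^sub>R ?T x" for c x using linear_rot[of e t] by (simp add: linear_scale)
  fix A assume "A \<in> sets (distr sphere_measure sphere_measure ?T)"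
  then have A: "A \<in> sets borel" "A \<subseteq> S2"
    by (auto simp: sphere_measure_sets sets_restrict_space)
  have As: "A \<in> sets sphere_measure" using A by (auto simp: sphere_measure_sets sets_restrict_space)
  have TA: "?T -` A \<subseteq> S2" "?T -` A \<in> sets borel"
    using A nT by (fastforce simp: subset_iff, auto intro!: measurable_sets_borel)
  have "emeasure (distr sphere_measure sphere_measure ?T) A = emeasure sphere_measure (?T -` A)"
    using TA As e by (subst emeasure_distr) (auto simp: rot_measurable Int_absorb2)
  also have "\<dots> = emeasure ?U (?n -` (?T -` A))" using TA by (simp add: emeasure_sphere_measure)
  also have "?n -` (?T -` A) = ?T -` (?n -` A)" using nT lT by auto
  also have "emeasure ?U (?T -` (?n -` A)) = emeasure ?U (?n -` A)"
  proof -
    have nA[measurable]: "?n -` A \<in> sets borel" using A(1) by (intro measurable_sets_borel) auto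
    have "emeasure lborel (ball 0 1 \<inter> ?T -` (?n -` A)) = emeasure lborel (?T -` (ball 0 1 \<inter> ?n -` A))"
      using nT by (intro arg_cong[where f="emeasure lborel"]) auto
    also have "\<dots> = emeasure (distr lborel borel ?T) (ball 0 1 \<inter> ?n -` A)"
      by (subst emeasure_distr) (auto simp: nA)
    also have "\<dots> = emeasure lborel (ball 0 1 \<inter> ?n -` A)"
      using lborel_distr_orthogonal[OF orthogonal_rot[OF e]] by simp
    moreover have "?T -` (?n -` A) \<in> sets borel"
      by (rule measurable_sets_borel[where M=borel]) (auto simp: nA)
    ultimately show ?thesis by (simp add: nA)
  qed
  also have "\<dots> = emeasure sphere_measure A" using A by (simp add: emeasure_sphere_measure)
  finally show "emeasure (distr sphere_measure sphere_measure ?T) A = emeasure sphere_measure A" .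
qed simp

lemma integral_rot:
  fixes h :: "real^3 \<Rightarrow> real"
  assumes e: "norm e = 1" and h: "h \<in> borel_measurable sphere_measure"
  shows "(LINT x|sphere_measure. h (rot e t x)) = (LINT x|sphere_measure. h x)"
  by (subst (2) distr_rot[OF e, symmetric, of t])
     (rule integral_distr[symmetric, OF rot_measurable[OF e] h])

section \<open>Self-adjointness of the Laplace-Beltrami operator\<close>

lemma bounded_linear_cross: "bounded_linear (cross3 e)"
  by (rule bounded_linearI'[of "cross3 e"]) (simp_all add: cross_add_right cross_mult_right)

lemma rot_has_vector_derivative:
  assumes "norm e = 1"
  shows "((\<lambda>t. rot e t x) has_vector_derivative cross3 e (rot e t x)) (at t)"
proof -
  note ec = cross_cross_unit[OF assms, of x]
  have "((\<lambda>t. rot e t x) has_vector_derivative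
      (- sin t) *\<^sub>R x + cos t *\<^sub>R cross3 e x + (sin t * (e \<bullet> x)) *\<^sub>R e) (at t)"
    unfolding rot_def
    by (auto intro!: derivative_eq_intros simp: has_real_derivative_iff_has_vector_derivative[symmetric])
  moreover have "cross3 e (rot e t x) = (- sin t) *\<^sub>R x + cos t *\<^sub>R cross3 e x + (sin t * (e \<bullet> x)) *\<^sub>R e"
    by (simp add: rot_def cross_add_right cross_mult_right Cross3.right_diff_distrib ec algebra_simps)
  ultimately show ?thesis by simp
qed

text \<open>Here \<open>B\<close> is the second derivative of \<open>f\<close> in the direction of the rotations about \<open>e\<close>. It is
  expressed along the orbits, which stay on the sphere. The relation replaces the square of a Killing field on the sphere.\<close>

definition second_rot_deriv :: "real^3 \<Rightarrow> (real^3 \<Rightarrow> real) \<Rightarrow> (real^3 \<Rightarrow> real) \<Rightarrow> bool" where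
  "second_rot_deriv e f B \<longleftrightarrow> continuous_on S2 f \<and> continuous_on S2 B \<and>
     (\<exists>D. \<forall>x\<in>S2. \<forall>t. ((\<lambda>t. f (rot e t x)) has_real_derivative D (rot e t x)) (at t) \<and>
                     ((\<lambda>t. D (rot e t x)) has_real_derivative B (rot e t x)) (at t))"

text \<open>Taylor's formula for the even part in the angle, whose first derivative at zero vanishes.\<close>

lemma second_difference_eq:
  assumes "second_rot_deriv e f B" "x \<in> S2" "h > 0"
  shows "\<exists>t. 0 < t \<and> t \<le> h \<and>
    (f (rot e h x) + f (rot e (-h) x) - 2 * f x) / h\<^sup>2 = (B (rot e t x) + B (rot e (-t) x)) / 2"
proof -
  obtain D where D: "\<And>t. ((\<lambda>t. f (rot e t x)) has_real_derivative D (rot e t x)) (at t)"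
    "\<And>t. ((\<lambda>t. D (rot e t x)) has_real_derivative B (rot e t x)) (at t)"
    using assms(1,2) unfolding second_rot_deriv_def by blast
  define d where "d m s = (if m = 0 then f (rot e s x) + f (rot e (-s) x)
     else if m = 1 then D (rot e s x) - D (rot e (-s) x)
     else B (rot e s x) + B (rot e (-s) x))" for m :: nat and s
  have D': "((\<lambda>t. f (rot e (-t) x)) has_real_derivative - D (rot e (-t) x)) (at t)"
    "((\<lambda>t. D (rot e (-t) x)) has_real_derivative - B (rot e (-t) x)) (at t)" for t
  proof -
    have um: "(uminus has_real_derivative -1) (at t)" by (auto intro!: derivative_eq_intros)
    show "((\<lambda>t. f (rot e (-t) x)) has_real_derivative - D (rot e (-t) x)) (at t)"
      using DERIV_chain2[where f="\<lambda>t. f (rot e t x)" and g=uminus and Db="-1" and x=t and s=UNIV, OF D(1) um] by simp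
    show "((\<lambda>t. D (rot e (-t) x)) has_real_derivative - B (rot e (-t) x)) (at t)"
      using DERIV_chain2[where f="\<lambda>t. D (rot e t x)" and g=uminus and Db="-1" and x=t and s=UNIV, OF D(2) um] by simp
  qed
  have "\<forall>m t. m < 2 \<and> 0 \<le> t \<and> t \<le> h \<longrightarrow> (d m has_real_derivative d (Suc m) t) (at t)"
  proof (intro allI impI)
    fix m :: nat and t assume "m < 2 \<and> 0 \<le> t \<and> t \<le> h"
    then consider "m = 0" | "m = 1" by linarith
    then show "(d m has_real_derivative d (Suc m) t) (at t)"
      using DERIV_add[OF D(1)[of t] D'(1)[of t]] DERIV_diff[OF D(2)[of t] D'(2)[of t]]
      by cases (simp_all add: d_def[abs_def])
  qed
  from Maclaurin2[OF assms(3) refl this]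
  obtain t where t: "0 < t" "t \<le> h" "d 0 h = (\<Sum>m<2. d m 0 / fact m * h ^ m) + d 2 t / fact 2 * h\<^sup>2"
    by blast
  have "f (rot e h x) + f (rot e (-h) x) - 2 * f x = (B (rot e t x) + B (rot e (-t) x)) / 2 * h\<^sup>2"
    using t(3) by (simp add: d_def numeral_2_eq_2)
  with t assms(3) show ?thesis by (intro exI[of _ t]) (simp add: field_simps)
qed

definition second_diff :: "real^3 \<Rightarrow> (real^3 \<Rightarrow> real) \<Rightarrow> real \<Rightarrow> real^3 \<Rightarrow> real" where
  "second_diff e f h x = (f (rot e h x) + f (rot e (-h) x) - 2 * f x) / h\<^sup>2"

lemma continuous_on_rot_compose:
  assumes e: "norm e = 1" and f: "continuous_on S2 (f :: real^3 \<Rightarrow> real)"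
  shows "continuous_on S2 (\<lambda>x. f (rot e t x))"
proof (rule continuous_on_compose2[OF f continuous_on_rot])
  show "rot e t ` S2 \<subseteq> S2" using rot_in_S2[OF e] by blast
qed

text \<open>Rotation invariance of the measure moves a rotation from one factor to its inverse on the other,
  and the symmetric second difference contains both.\<close>

lemma second_diff_adjoint:
  assumes e: "norm e = 1" and f: "continuous_on S2 f" and g: "continuous_on S2 g"
  shows "(LINT x|sphere_measure. second_diff e f h x * g x) =
         (LINT x|sphere_measure. f x * second_diff e g h x)"
proof -
  have shift: "(LINT x|sphere_measure. f (rot e t x) * g x) = (LINT x|sphere_measure. f x * g (rot e (-t) x))" for t
  proof -
    have "(LINT x|sphere_measure. f (rot e t x) * g x) =
        (LINT x|sphere_measure. f (rot e t (rot e (-t) x)) * g (rot e (-t) x))"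
      by (rule integral_rot[OF e, symmetric])
        (intro continuous_on_S2_measurable continuous_intros continuous_on_rot_compose e f g)
    also have "(\<lambda>x. f (rot e t (rot e (-t) x))) = f"
      using rot_minus_rot[OF e, of "-t"] by simp
    finally show ?thesis by simp
  qed
  have i: "integrable sphere_measure (\<lambda>x. f (rot e t x) * g x)" "integrable sphere_measure (\<lambda>x. f x * g (rot e t x))"
    "integrable sphere_measure (\<lambda>x. f x * g x)" for t
    by (intro continuous_on_S2_integrable continuous_intros continuous_on_rot_compose e f g)+
  have "(LINT x|sphere_measure. second_diff e f h x * g x) =
     (LINT x|sphere_measure. (f (rot e h x) * g x + f (rot e (-h) x) * g x - 2 * (f x * g x)) / h\<^sup>2)"
    by (simp add: second_diff_def algebra_simps)
  also have "\<dots> = ((LINT x|sphere_measure. f (rot e h x) * g x) + (LINT x|sphere_measure. f (rot e (-h) x) * g x)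
       - 2 * (LINT x|sphere_measure. f x * g x)) / h\<^sup>2"
    using i by simp
  also have "\<dots> = ((LINT x|sphere_measure. f x * g (rot e h x)) + (LINT x|sphere_measure. f x * g (rot e (-h) x))
       - 2 * (LINT x|sphere_measure. f x * g x)) / h\<^sup>2"
    using shift[of h] shift[of "-h"] by simp
  also have "\<dots> = (LINT x|sphere_measure. (f x * g (rot e h x) + f x * g (rot e (-h) x) - 2 * (f x * g x)) / h\<^sup>2)"
    using i by simp
  also have "\<dots> = (LINT x|sphere_measure. f x * second_diff e g h x)"
    by (simp add: second_diff_def algebra_simps)
  finally show ?thesis .
qed

text \<open>By Taylor's formula the second differences are bounded by the supremum of the second derivative,
  so the limit may be taken under the integral.\<close>

lemma second_diff_tendsto:
  assumes e: "norm e = 1" and f: "second_rot_deriv e f B" and g: "continuous_on S2 g"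
  shows "(\<lambda>n. LINT x|sphere_measure. second_diff e f (1 / real (Suc n)) x * g x)
     \<longlonglongrightarrow> (LINT x|sphere_measure. B x * g x)"
proof -
  have cf: "continuous_on S2 f" and cB: "continuous_on S2 B" using f by (auto simp: second_rot_deriv_def)
  obtain b where b: "b > 0" "\<And>x. x \<in> S2 \<Longrightarrow> \<bar>B x\<bar> \<le> b"
    by (rule continuous_on_S2_bounded[OF cB]) blast
  obtain c where c: "c > 0" "\<And>x. x \<in> S2 \<Longrightarrow> \<bar>g x\<bar> \<le> c"
    by (rule continuous_on_S2_bounded[OF g]) blast
  let ?h = "\<lambda>n. 1 / real (Suc n)"
  have ex: "\<exists>t. 0 < t \<and> t \<le> ?h n \<and> second_diff e f (?h n) x = (B (rot e t x) + B (rot e (-t) x)) / 2"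
    if "x \<in> S2" for n x
    unfolding second_diff_def by (rule second_difference_eq[OF f that]) simp
  show ?thesis
  proof (rule integral_dominated_convergence[where w="\<lambda>_. b * c"])
    show "(\<lambda>x. B x * g x) \<in> borel_measurable sphere_measure"
      by (intro continuous_on_S2_measurable continuous_intros cB g)
    show "(\<lambda>x. second_diff e f (?h n) x * g x) \<in> borel_measurable sphere_measure" for n
      unfolding second_diff_def
      by (intro continuous_on_S2_measurable continuous_intros continuous_on_rot_compose e cf g) auto
    show "integrable sphere_measure (\<lambda>_. b * c)" by simp
    show "AE x in sphere_measure. norm (second_diff e f (?h n) x * g x) \<le> b * c" for n
    proof (rule AE_I2)
      fix x assume "x \<in> space sphere_measure"
      then have x: "x \<in> S2" by simp
      obtain t where t: "second_diff e f (?h n) x = (B (rot e t x) + B (rot e (-t) x)) / 2"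
        using ex[OF x] by blast
      have "\<bar>second_diff e f (?h n) x\<bar> \<le> b"
        unfolding t using b(2)[OF rot_in_S2[OF e x, of t]] b(2)[OF rot_in_S2[OF e x, of "-t"]] by (simp add: abs_le_iff)
      then show "norm (second_diff e f (?h n) x * g x) \<le> b * c"
        using c(2)[OF x] by (simp add: abs_mult mult_mono)
    qed
    show "AE x in sphere_measure. (\<lambda>n. second_diff e f (?h n) x * g x) \<longlonglongrightarrow> B x * g x"
    proof (rule AE_I2)
      fix x assume "x \<in> space sphere_measure"
      then have x: "x \<in> S2" by simp
      obtain t where t: "\<And>n. 0 < t n \<and> t n \<le> ?h n \<and> second_diff e f (?h n) x = (B (rot e (t n) x) + B (rot e (-t n) x)) / 2"
        using ex[OF x] by metis
      have t0: "t \<longlonglongrightarrow> 0"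
        by (rule tendsto_sandwich[OF _ _ tendsto_const LIMSEQ_Suc[OF lim_1_over_n]])
           (use t in \<open>auto intro!: always_eventually less_imp_le simp del: of_nat_Suc\<close>)
      have cr: "continuous_on UNIV (\<lambda>s. B (rot e s x))"
      proof (rule continuous_on_compose2[OF cB])
        show "continuous_on UNIV (\<lambda>s. rot e s x)"
          using has_vector_derivative_continuous[OF rot_has_vector_derivative[OF e]]
          by (intro continuous_at_imp_continuous_on ballI) simp
      qed (use rot_in_S2[OF e x] in auto)
      have "(\<lambda>n. B (rot e (t n) x)) \<longlonglongrightarrow> B x" "(\<lambda>n. B (rot e (- t n) x)) \<longlonglongrightarrow> B x"
        using continuous_on_tendsto_compose[OF cr t0] continuous_on_tendsto_compose[OF cr tendsto_minus[OF t0]]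
        by simp_all
      then have "(\<lambda>n. (B (rot e (t n) x) + B (rot e (-t n) x)) / 2) \<longlonglongrightarrow> (B x + B x) / 2"
        by (intro tendsto_intros) auto
      then show "(\<lambda>n. second_diff e f (?h n) x * g x) \<longlonglongrightarrow> B x * g x"
        by (intro tendsto_mult tendsto_const) (simp add: t[THEN conjunct2, THEN conjunct2] del: of_nat_Suc)
    qed
  qed
qed

lemma second_rot_deriv_adjoint:
  assumes e: "norm e = 1" and f: "second_rot_deriv e f Bf" and g: "second_rot_deriv e g Bg"
  shows "(LINT x|sphere_measure. Bf x * g x) = (LINT x|sphere_measure. f x * Bg x)"
proof -
  have c: "continuous_on S2 f" "continuous_on S2 g" using f g by (auto simp: second_rot_deriv_def)
  have "(\<lambda>n. LINT x|sphere_measure. second_diff e f (1 / real (Suc n)) x * g x)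
     \<longlonglongrightarrow> (LINT x|sphere_measure. Bg x * f x)"
  proof -
    have "(LINT x|sphere_measure. second_diff e f h x * g x) = (LINT x|sphere_measure. second_diff e g h x * f x)" for h
      using second_diff_adjoint[OF e c, of h] by (simp add: mult.commute)
    then show ?thesis using second_diff_tendsto[OF e g c(1)] by simp
  qed
  then show ?thesis
    using LIMSEQ_unique[OF second_diff_tendsto[OF e f c(2)]] by (simp add: mult.commute)
qed

lemma Basis_real3: "(Basis :: (real^3) set) = {axis 1 1, axis 2 1, axis 3 1}"
  by (auto simp: Basis_vec_def exhaust_3) (metis exhaust_3)

lemma sum_Basis_real3: "(\<Sum>e\<in>(Basis :: (real^3) set). g e) = g (axis 1 1) + g (axis 2 1) + g (axis 3 1)"
  by (simp add: Basis_real3 axis_eq_axis add.assoc)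

lemma sum_double_cross: "(\<Sum>e\<in>Basis. cross3 e (cross3 e x)) = - 2 *\<^sub>R x"
  unfolding sum_Basis_real3 by (simp add: cross3_simps axis_def forall_3)

text \<open>On the unit sphere this says that the fields \<open>cross3 e x\<close> for the three coordinate axes measure
  exactly the tangential part of a bilinear form: its trace minus its radial part.\<close>

lemma sum_cross_bilinear:
  fixes B :: "real^3 \<Rightarrow> real^3 \<Rightarrow> real"
  assumes B: "bilinear B"
  shows "(\<Sum>e\<in>Basis. B (cross3 e x) (cross3 e x)) = (x \<bullet> x) * (\<Sum>e\<in>Basis. B e e) - B x x"
proof -
  let ?e1 = "axis 1 1 :: real^3" and ?e2 = "axis 2 1 :: real^3" and ?e3 = "axis 3 1 :: real^3"
  have x: "x = x$1 *\<^sub>R ?e1 + x$2 *\<^sub>R ?e2 + x$3 *\<^sub>R ?e3"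
    by (simp add: vec_eq_iff forall_3 axis_def)
  have c: "cross3 ?e1 x = x$2 *\<^sub>R ?e3 - x$3 *\<^sub>R ?e2" "cross3 ?e2 x = x$3 *\<^sub>R ?e1 - x$1 *\<^sub>R ?e3"
    "cross3 ?e3 x = x$1 *\<^sub>R ?e2 - x$2 *\<^sub>R ?e1"
    by (simp_all add: cross3_simps axis_def forall_3)
  have xx: "x \<bullet> x = x$1 * x$1 + x$2 * x$2 + x$3 * x$3"
    by (simp add: inner_vec_def sum_3)
  note bl = bilinear_ladd[OF B] bilinear_radd[OF B] bilinear_lsub[OF B] bilinear_rsub[OF B]
     bilinear_lmul[OF B] bilinear_rmul[OF B]
  have Bx: "B x x = B (x$1 *\<^sub>R ?e1 + x$2 *\<^sub>R ?e2 + x$3 *\<^sub>R ?e3) (x$1 *\<^sub>R ?e1 + x$2 *\<^sub>R ?e2 + x$3 *\<^sub>R ?e3)"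
    using x by simp
  show ?thesis
    unfolding sum_Basis_real3 c xx Bx by (simp add: bl algebra_simps)
qed

lemma ray_ext_on_S2: "x \<in> S2 \<Longrightarrow> ray_ext f x = f x"
  by (simp add: ray_ext_def)

lemma ray_ext_scale: "c > 0 \<Longrightarrow> ray_ext f (c *\<^sub>R x) = ray_ext f x"
proof -
  assume "c > 0"
  then have "norm (c *\<^sub>R x) = c * norm x" "inverse (c * norm x) * c = inverse (norm x)"
    by (simp_all add: field_simps)
  then show ?thesis by (simp only: ray_ext_def scaleR_scaleR)
qed

text \<open>Along a rotation the chain rule gives a second-order term, and a first-order term in the direction
  of the double cross product. Summed over the axes, the former is the Euclidean Laplacian minus the
  radial second derivative, and the latter is a multiple of the radial derivative. The extension is
  constant along rays, so both radial derivatives vanish.\<close>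

lemma rot_derivatives_of_C2:
  assumes C2: "C2_on (- {0}) (ray_ext f)"
  obtains B where "\<And>e. norm e = 1 \<Longrightarrow> second_rot_deriv e f (B e)"
    "\<And>x. x \<in> S2 \<Longrightarrow> (\<Sum>e\<in>Basis. B e x) = laplace_beltrami f x"
proof -
  let ?F = "ray_ext f"
  obtain F' :: "real^3 \<Rightarrow> (real^3) \<Rightarrow>\<^sub>L real" and F'' :: "real^3 \<Rightarrow> (real^3) \<Rightarrow>\<^sub>L (real^3) \<Rightarrow>\<^sub>L real"
    where F1: "\<And>x. x \<noteq> 0 \<Longrightarrow> (?F has_derivative blinfun_apply (F' x)) (at x)"
      and F2: "\<And>x. x \<noteq> 0 \<Longrightarrow> (F' has_derivative blinfun_apply (F'' x)) (at x)"
      and F3: "continuous_on (- {0}) F''"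
    using C2 unfolding C2_on_def by auto
  define B where "B e x = F'' x (cross3 e x) (cross3 e x) + F' x (cross3 e (cross3 e x))" for e x
  have F'c: "continuous_on (- {0}) F'"
    by (rule continuous_at_imp_continuous_on) (use F2 has_derivative_continuous in blast)
  have Fc: "continuous_on (- {0}) ?F"
    by (rule continuous_at_imp_continuous_on) (use F1 has_derivative_continuous in blast)
  have sub: "S2 \<subseteq> - {0}" by auto
  have cc: "continuous_on S2 (cross3 e)" for e
    by (rule linear_continuous_on[OF bounded_linear_cross])
  have cc2: "continuous_on S2 (\<lambda>x. cross3 e (cross3 e x))" for e
    using bounded_linear_cross bounded_linear_compose by (intro linear_continuous_on) blast
  have "second_rot_deriv e f (B e)" if e: "norm e = 1" for e
    unfolding second_rot_deriv_def
  proof (intro conjI exI[of _ "\<lambda>x. F' x (cross3 e x)"] ballI allI)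
    show "continuous_on S2 f"
      using continuous_on_subset[OF Fc sub] by (rule continuous_on_eq) (simp add: ray_ext_on_S2)
    show "continuous_on S2 (B e)"
      unfolding B_def
      by (intro continuous_intros cc cc2 continuous_on_subset[OF F3 sub] continuous_on_subset[OF F'c sub])
    fix x :: "real^3" and t assume x: "x \<in> S2"
    let ?c = "\<lambda>t. rot e t x"
    have S: "?c t \<in> S2" for t by (rule rot_in_S2[OF e x])
    then have nz: "?c t \<noteq> 0" for t using sub by blast
    have d: "(?c has_derivative (\<lambda>s. s *\<^sub>R cross3 e (?c t))) (at t)"
      using rot_has_vector_derivative[OF e] by (simp add: has_vector_derivative_def)
    have "((\<lambda>t. ?F (?c t)) has_derivative (\<lambda>s. F' (?c t) (s *\<^sub>R cross3 e (?c t)))) (at t)"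
      by (rule has_derivative_compose[OF d F1[OF nz]])
    then show "((\<lambda>t. f (rot e t x)) has_real_derivative F' (rot e t x) (cross3 e (rot e t x))) (at t)"
      using ray_ext_on_S2[OF S] by (simp add: has_field_derivative_def blinfun.scaleR_right mult_commute_abs)
    have d1: "((\<lambda>t. F' (?c t)) has_derivative (\<lambda>s. F'' (?c t) (s *\<^sub>R cross3 e (?c t)))) (at t)"
      by (rule has_derivative_compose[OF d F2[OF nz]])
    have d2: "((\<lambda>t. cross3 e (?c t)) has_derivative (\<lambda>s. cross3 e (s *\<^sub>R cross3 e (?c t)))) (at t)"
      by (rule bounded_linear.has_derivative[OF bounded_linear_cross d])
    show "((\<lambda>t. F' (rot e t x) (cross3 e (rot e t x))) has_real_derivative B e (rot e t x)) (at t)"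
      unfolding has_field_derivative_def
      by (rule has_derivative_eq_rhs[OF bounded_bilinear.FDERIV[OF bounded_bilinear_blinfun_apply d1 d2]])
         (simp add: fun_eq_iff B_def blinfun.bilinear_simps cross_mult_right algebra_simps)
  qed
  moreover have "(\<Sum>e\<in>Basis. B e x) = laplace_beltrami f x" if x: "x \<in> S2" for x
  proof -
    have x0: "x \<noteq> 0" using sub x by blast
    have lap: "laplace_beltrami f x = (\<Sum>b\<in>Basis. F'' x b b)"
      unfolding laplace_beltrami_def laplacian_def
    proof (rule sum.cong[OF refl])
      fix b :: "real^3"
      let ?l = "\<lambda>t. x + t *\<^sub>R b"
      have l: "(?l has_derivative (\<lambda>s. s *\<^sub>R b)) (at t)" for t
        by (auto intro!: derivative_eq_intros)
      have "((\<lambda>t. ?F (?l t)) has_real_derivative F' (?l t) b) (at t)" if "?l t \<noteq> 0" for t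
        using has_derivative_compose[OF l F1[OF that]]
        by (simp add: has_field_derivative_def blinfun.scaleR_right mult_commute_abs)
      then have dF: "deriv (\<lambda>t. ?F (?l t)) t = F' (?l t) b" if "?l t \<noteq> 0" for t
        using that by (blast intro: DERIV_imp_deriv)
      have "open {t. ?l t \<noteq> 0}"
        by (intro open_Collect_neq continuous_intros)
      then have "\<forall>\<^sub>F t in nhds 0. ?l t \<noteq> 0"
        using x0 by (auto simp: eventually_nhds intro!: exI[of _ "{t. ?l t \<noteq> 0}"])
      then have ev: "\<forall>\<^sub>F t in nhds 0. deriv (\<lambda>t. ?F (?l t)) t = F' (?l t) b"
        by eventually_elim (rule dF)
      have l0: "?l 0 \<noteq> 0" using x0 by simp
      have "((\<lambda>t. F' (?l t)) has_derivative (\<lambda>s. F'' (?l 0) (s *\<^sub>R b))) (at 0)"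
        by (rule has_derivative_compose[OF l F2[OF l0]])
      then have "((\<lambda>t. F' (?l t) b) has_derivative (\<lambda>s. F'' (?l 0) (s *\<^sub>R b) b)) (at 0)"
        by (rule bounded_linear.has_derivative[OF blinfun.bounded_linear_left])
      then have "((\<lambda>t. F' (?l t) b) has_real_derivative F'' x b b) (at 0)"
        by (simp add: has_field_derivative_def blinfun.scaleR_right blinfun.scaleR_left mult_commute_abs)
      then have "deriv (\<lambda>t. F' (?l t) b) 0 = F'' x b b" by (rule DERIV_imp_deriv)
      then show "(deriv ^^ 2) (\<lambda>t. ?F (?l t)) 0 = F'' x b b"
        using deriv_cong_ev[OF ev refl] by (simp add: numeral_2_eq_2)
    qed
    have l: "((\<lambda>t. (1 + t) *\<^sub>R y) has_derivative (\<lambda>s. s *\<^sub>R y)) (at t)" for t and y :: "real^3"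
      by (auto intro!: derivative_eq_intros)
    \<comment> \<open>Constancy along rays, differentiated once and then once more along the ray.\<close>
    have radial: "F' y y = 0" if y: "y \<noteq> 0" for y
    proof -
      have y1: "(1 + 0) *\<^sub>R y \<noteq> 0" using y by simp
      have "((\<lambda>t. ?F ((1 + t) *\<^sub>R y)) has_derivative (\<lambda>s. F' ((1 + 0) *\<^sub>R y) (s *\<^sub>R y))) (at 0)"
        by (rule has_derivative_compose[OF l F1[OF y1]])
      then have 1: "((\<lambda>t. ?F ((1 + t) *\<^sub>R y)) has_real_derivative F' y y) (at 0)"
        by (simp add: has_field_derivative_def blinfun.scaleR_right mult_commute_abs)
      have "\<forall>\<^sub>F t in nhds (0::real). t > -1" by (rule order_tendstoD(1)[OF filterlim_ident]) simp
      then have "\<forall>\<^sub>F t in nhds (0::real). ?F ((1 + t) *\<^sub>R y) = ?F y"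
        by eventually_elim (simp add: ray_ext_scale)
      then have "((\<lambda>t. ?F ((1 + t) *\<^sub>R y)) has_real_derivative 0) (at 0)"
        by (subst DERIV_cong_ev[OF refl _ refl]) auto
      with 1 show ?thesis by (rule DERIV_unique)
    qed
    have radial2: "F'' x x x = 0"
    proof -
      have x1: "(1 + 0) *\<^sub>R x \<noteq> 0" using x0 by simp
      have "((\<lambda>t. F' ((1 + t) *\<^sub>R x)) has_derivative (\<lambda>s. F'' ((1 + 0) *\<^sub>R x) (s *\<^sub>R x))) (at 0)"
        by (rule has_derivative_compose[OF l F2[OF x1]])
      then have "((\<lambda>t. F' ((1 + t) *\<^sub>R x) x) has_derivative (\<lambda>s. F'' ((1 + 0) *\<^sub>R x) (s *\<^sub>R x) x)) (at 0)"
        by (rule bounded_linear.has_derivative[OF blinfun.bounded_linear_left])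
      then have 1: "((\<lambda>t. F' ((1 + t) *\<^sub>R x) x) has_real_derivative F'' x x x) (at 0)"
        by (simp add: has_field_derivative_def blinfun.scaleR_right blinfun.scaleR_left mult_commute_abs)
      have "\<forall>\<^sub>F t in nhds (0::real). t > -1" by (rule order_tendstoD(1)[OF filterlim_ident]) simp
      then have "\<forall>\<^sub>F t in nhds (0::real). F' ((1 + t) *\<^sub>R x) x = 0"
      proof eventually_elim
        fix t :: real assume "t > -1"
        then show "F' ((1 + t) *\<^sub>R x) x = 0"
          using radial[of "(1 + t) *\<^sub>R x"] x0 by (simp add: blinfun.scaleR_right)
      qed
      then have "((\<lambda>t. F' ((1 + t) *\<^sub>R x) x) has_real_derivative 0) (at 0)"
        by (subst DERIV_cong_ev[OF refl _ refl]) auto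
      with 1 show ?thesis by (rule DERIV_unique)
    qed
    have bil: "bilinear (\<lambda>u v. F'' x u v)"
      unfolding bilinear_def by (intro conjI allI linearI) (simp_all add: blinfun.bilinear_simps)
    have "(\<Sum>e\<in>Basis. B e x) = (\<Sum>e\<in>Basis. F'' x (cross3 e x) (cross3 e x)) + F' x (\<Sum>e\<in>Basis. cross3 e (cross3 e x))"
      by (simp add: B_def sum.distrib blinfun.sum_right)
    also have "\<dots> = (\<Sum>b\<in>Basis. F'' x b b)"
      using x radial[OF x0] radial2
      by (simp add: sum_cross_bilinear[OF bil] sum_double_cross blinfun.bilinear_simps dot_square_norm)
    finally show ?thesis using lap by simp
  qed
  ultimately show ?thesis using that by blast
qed

section \<open>Zonal polynomials\<close>

text \<open>With \<open>t\<close> the cosine of the angle between the points, this is \<open>(1 + t) / 2\<close>. In this variable the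
  Laplace-Beltrami operator maps a power to a combination of two consecutive powers.\<close>

definition zonal_arg :: "real^3 \<Rightarrow> real^3 \<Rightarrow> real" where
  "zonal_arg x y = (1 + x \<bullet> y) / 2"

text \<open>Legendre's operator \<open>P \<mapsto> (w (1 - w) P')'\<close> on the interval from 0 to 1.\<close>

definition legendre_op :: "real poly \<Rightarrow> real poly" where
  "legendre_op P = [:0, 1, -1:] * pderiv (pderiv P) + [:1, -2:] * pderiv P"

lemma rot_derivatives_zonal:
  assumes e: "norm e = 1"
  shows "second_rot_deriv e (\<lambda>x. poly P (zonal_arg x y))
    (\<lambda>x. poly (pderiv (pderiv P)) (zonal_arg x y) * ((cross3 e x \<bullet> y) / 2)\<^sup>2
       + poly (pderiv P) (zonal_arg x y) * ((cross3 e (cross3 e x) \<bullet> y) / 2))"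
  unfolding second_rot_deriv_def
proof (intro conjI exI[of _ "\<lambda>x. poly (pderiv P) (zonal_arg x y) * ((cross3 e x \<bullet> y) / 2)"] ballI allI)
  have cc: "continuous_on S2 (cross3 e)" for e
    by (rule linear_continuous_on[OF bounded_linear_cross])
  have cc2: "continuous_on S2 (\<lambda>x. cross3 e (cross3 e x))" for e
    using bounded_linear_cross bounded_linear_compose by (intro linear_continuous_on) blast
  show "continuous_on S2 (\<lambda>x. poly P (zonal_arg x y))"
    unfolding zonal_arg_def by (intro continuous_intros) auto
  show "continuous_on S2 (\<lambda>x. poly (pderiv (pderiv P)) (zonal_arg x y) * ((cross3 e x \<bullet> y) / 2)\<^sup>2
       + poly (pderiv P) (zonal_arg x y) * ((cross3 e (cross3 e x) \<bullet> y) / 2))"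
    unfolding zonal_arg_def by (intro continuous_intros cc cc2) auto
  fix x :: "real^3" and t
  let ?c = "\<lambda>t. rot e t x"
  have d: "(?c has_vector_derivative cross3 e (?c t)) (at t)"
    by (rule rot_has_vector_derivative[OF e])
  have d2: "((\<lambda>t. cross3 e (?c t)) has_vector_derivative cross3 e (cross3 e (?c t))) (at t)"
    by (rule bounded_linear.has_vector_derivative[OF bounded_linear_cross d])
  have iy: "((\<lambda>t. g t \<bullet> y) has_real_derivative g' \<bullet> y) (at t)"
    if "(g has_vector_derivative g') (at t)" for g g'
    using bounded_linear.has_vector_derivative[OF bounded_linear_inner_left that]
    by (simp add: has_real_derivative_iff_has_vector_derivative)
  have z: "((\<lambda>t. zonal_arg (?c t) y) has_real_derivative (cross3 e (?c t) \<bullet> y) / 2) (at t)"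
    unfolding zonal_arg_def using iy[OF d] by (auto intro!: derivative_eq_intros)
  have p: "((\<lambda>t. poly Q (zonal_arg (?c t) y)) has_real_derivative
     poly (pderiv Q) (zonal_arg (?c t) y) * ((cross3 e (?c t) \<bullet> y) / 2)) (at t)" for Q
    by (rule DERIV_chain2[OF poly_DERIV z])
  show "((\<lambda>t. poly P (zonal_arg (rot e t x) y)) has_real_derivative
     poly (pderiv P) (zonal_arg (rot e t x) y) * ((cross3 e (rot e t x) \<bullet> y) / 2)) (at t)"
    by (rule p)
  have c2: "((\<lambda>t. (cross3 e (?c t) \<bullet> y) / 2) has_real_derivative (cross3 e (cross3 e (?c t)) \<bullet> y) / 2) (at t)"
    using DERIV_cdivide[OF iy[OF d2], of 2] .
  show "((\<lambda>t. poly (pderiv P) (zonal_arg (rot e t x) y) * ((cross3 e (rot e t x) \<bullet> y) / 2)) has_real_derivative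
     poly (pderiv (pderiv P)) (zonal_arg (rot e t x) y) * ((cross3 e (rot e t x) \<bullet> y) / 2)\<^sup>2
       + poly (pderiv P) (zonal_arg (rot e t x) y) * ((cross3 e (cross3 e (rot e t x)) \<bullet> y) / 2)) (at t)"
    using DERIV_mult[OF p[of "pderiv P"] c2] by (simp add: power2_eq_square algebra_simps)
qed

lemma sum_rot_derivatives_zonal:
  assumes x: "x \<in> S2" and y: "y \<in> S2"
  shows "(\<Sum>e\<in>Basis. poly (pderiv (pderiv P)) (zonal_arg x y) * ((cross3 e x \<bullet> y) / 2)\<^sup>2
       + poly (pderiv P) (zonal_arg x y) * ((cross3 e (cross3 e x) \<bullet> y) / 2))
   = poly (legendre_op P) (zonal_arg x y)"
proof -
  have yy: "(\<Sum>b\<in>Basis. (b \<bullet> y)\<^sup>2) = 1" "x \<bullet> x = 1"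
    using x y euclidean_inner[of y y] by (simp_all add: dot_square_norm power2_eq_square inner_commute)
  have bil: "bilinear (\<lambda>u v. (u \<bullet> y) * (v \<bullet> y))"
    unfolding bilinear_def by (intro conjI allI linearI) (simp_all add: inner_simps algebra_simps)
  have "(\<Sum>e\<in>Basis. (cross3 e x \<bullet> y)\<^sup>2) = 1 - (x \<bullet> y)\<^sup>2"
    using sum_cross_bilinear[OF bil, of x] yy by (simp add: power2_eq_square)
  moreover have "(\<Sum>e\<in>Basis. cross3 e (cross3 e x) \<bullet> y) = - 2 * (x \<bullet> y)"
    using sum_double_cross[of x] by (simp add: inner_sum_left[symmetric])
  ultimately show ?thesis
    by (simp add: sum.distrib sum_distrib_left[symmetric] sum_divide_distrib[symmetric] power_divide)
       (simp add: legendre_op_def zonal_arg_def field_simps power2_eq_square)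
qed

text \<open>Green's second identity for a spherical harmonic and a zonal polynomial. All later information on
  spherical harmonics is extracted from it.\<close>

lemma harmonic_zonal_adjoint:
  assumes f: "f \<in> spherical_harmonics l" and y: "y \<in> S2"
  shows "- eigval l * (LINT x|sphere_measure. f x * poly P (zonal_arg x y)) =
    (LINT x|sphere_measure. f x * poly (legendre_op P) (zonal_arg x y))"
proof -
  have C2: "C2_on (- {0}) (ray_ext f)" and ev: "\<And>x. x \<in> S2 \<Longrightarrow> laplace_beltrami f x = - eigval l * f x"
    using f unfolding spherical_harmonics_def by force+
  obtain B where B: "\<And>e. norm e = 1 \<Longrightarrow> second_rot_deriv e f (B e)"
    "\<And>x. x \<in> S2 \<Longrightarrow> (\<Sum>e\<in>Basis. B e x) = laplace_beltrami f x"
    by (rule rot_derivatives_of_C2[OF C2]) blast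
  let ?g = "\<lambda>x. poly P (zonal_arg x y)"
  let ?G = "\<lambda>e x. poly (pderiv (pderiv P)) (zonal_arg x y) * ((cross3 e x \<bullet> y) / 2)\<^sup>2
       + poly (pderiv P) (zonal_arg x y) * ((cross3 e (cross3 e x) \<bullet> y) / 2)"
  have G: "second_rot_deriv e ?g (?G e)" if "norm e = 1" for e
    by (rule rot_derivatives_zonal[OF that])
  have cf: "continuous_on S2 f" "continuous_on S2 ?g"
    using B(1)[of "axis 1 1"] G[of "axis 1 1"] by (auto simp: second_rot_deriv_def)
  have ib: "integrable sphere_measure (\<lambda>x. B e x * ?g x)" "integrable sphere_measure (\<lambda>x. f x * ?G e x)"
    if "e \<in> Basis" for e
    using B(1)[of e] G[of e] that cf
    by (auto simp: second_rot_deriv_def intro!: continuous_on_S2_integrable continuous_on_mult)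
  have "- eigval l * (LINT x|sphere_measure. f x * ?g x) = (LINT x|sphere_measure. (\<Sum>e\<in>Basis. B e x) * ?g x)"
    by (subst integral_mult_right_zero[symmetric], rule Bochner_Integration.integral_cong)
       (simp_all add: B(2) ev)
  also have "\<dots> = (\<Sum>e\<in>Basis. LINT x|sphere_measure. B e x * ?g x)"
    unfolding sum_distrib_right by (rule Bochner_Integration.integral_sum) (rule ib(1))
  also have "\<dots> = (\<Sum>e\<in>Basis. LINT x|sphere_measure. f x * ?G e x)"
  proof (rule sum.cong[OF refl])
    fix e :: "real^3" assume "e \<in> Basis"
    then have "norm e = 1" by simp
    then show "(LINT x|sphere_measure. B e x * ?g x) = (LINT x|sphere_measure. f x * ?G e x)"
      using second_rot_deriv_adjoint B G by blast
  qed
  also have "\<dots> = (LINT x|sphere_measure. f x * (\<Sum>e\<in>Basis. ?G e x))"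
    unfolding sum_distrib_left by (rule Bochner_Integration.integral_sum[symmetric]) (rule ib(2))
  also have "\<dots> = (LINT x|sphere_measure. f x * poly (legendre_op P) (zonal_arg x y))"
    by (rule Bochner_Integration.integral_cong)
      (simp_all only: sphere_measure_space sum_rot_derivatives_zonal[OF _ y])
  finally show ?thesis .
qed

section \<open>Funk-Hecke formula for powers of the zonal argument\<close>

text \<open>For \<open>l \<le> n\<close> this is \<open>(n!)\<^sup>2 / ((n - l)! (n + l + 1)!)\<close>, the integral over the unit interval of
  the shifted Legendre polynomial of degree \<open>l\<close> against the power \<open>u ^ n\<close>. In particular it is
  nonnegative, which makes the variances below sums of nonnegative terms.\<close>

definition funk_hecke :: "nat \<Rightarrow> nat \<Rightarrow> real" where
  "funk_hecke n l = (\<Prod>j<l. real n - real j) / (\<Prod>j\<le>l. real n + 1 + real j)"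

lemma funk_hecke_denominator_pos: "(\<Prod>j\<le>l. real n + 1 + real j) > 0"
  by (intro prod_pos) auto

lemma funk_hecke_eq_0: "n < l \<Longrightarrow> funk_hecke n l = 0"
  by (auto simp: funk_hecke_def)

lemma funk_hecke_pos: "l \<le> n \<Longrightarrow> funk_hecke n l > 0"
  unfolding funk_hecke_def by (intro divide_pos_pos funk_hecke_denominator_pos prod_pos) auto

lemma funk_hecke_nonneg: "funk_hecke n l \<ge> 0"
  using funk_hecke_eq_0[of n l] funk_hecke_pos[of l n] by (cases "n < l") auto

text \<open>The same recurrence holds for the moments of a spherical harmonic of degree \<open>l\<close>, by
  \<open>zonal_moment_recurrence\<close>.\<close>

lemma funk_hecke_recurrence:
  "(real (Suc n) * (real (Suc n) + 1) - eigval l) * funk_hecke (Suc n) l = (real (Suc n))\<^sup>2 * funk_hecke n l"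
proof -
  let ?m = "real (Suc n)"
  let ?A = "\<lambda>n. \<Prod>j<l. real n - real j" and ?B = "\<lambda>n. \<Prod>j\<le>l. real n + 1 + real j"
  have A: "(?m - real l) * ?A (Suc n) = ?m * ?A n"
  proof -
    have "(?m - real l) * ?A (Suc n) = (\<Prod>j<Suc l. ?m - real j)" by simp
    also have "\<dots> = ?m * ?A n"
      by (subst prod.lessThan_Suc_shift) simp
    finally show ?thesis .
  qed
  have B: "(?m + real l + 1) * ?B n = ?m * ?B (Suc n)"
  proof -
    have "(?m + real l + 1) * ?B n = (\<Prod>j\<le>Suc l. real n + 1 + real j)" by (simp add: algebra_simps)
    also have "\<dots> = ?m * ?B (Suc n)"
      by (subst prod.atMost_Suc_shift) (simp add: algebra_simps)
    finally show ?thesis .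
  qed
  have e: "?m * (?m + 1) - eigval l = (?m - real l) * (?m + real l + 1)"
    by (simp add: eigval_def algebra_simps)
  have pos: "?B n > 0" "?B (Suc n) > 0" by (rule funk_hecke_denominator_pos)+
  have "(?m - real l) * (?m + real l + 1) * ?A (Suc n) * ?B n = ?m * ?A n * ((?m + real l + 1) * ?B n)"
    by (simp only: A[symmetric] mult_ac)
  also have "\<dots> = ?m\<^sup>2 * ?A n * ?B (Suc n)"
    by (simp only: B power2_eq_square mult_ac)
  finally show ?thesis
    unfolding e funk_hecke_def using pos by (simp add: field_simps)
qed

lemma funk_hecke_asymptotics: "(\<lambda>n. (real n + 1) * funk_hecke n l) \<longlonglongrightarrow> 1"
proof -
  have "(real n + 1) * funk_hecke n l = (\<Prod>j<l. (real n - real j) / (real n + 2 + real j))" for n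
  proof -
    have "(\<Prod>j\<le>l. real n + 1 + real j) = (real n + 1) * (\<Prod>j<l. real n + 2 + real j)"
      unfolding lessThan_Suc_atMost[symmetric] prod.lessThan_Suc_shift by (simp add: algebra_simps)
    then show ?thesis by (simp add: funk_hecke_def prod_dividef)
  qed
  moreover have "(\<lambda>n. \<Prod>j<l. (real n - real j) / (real n + 2 + real j)) \<longlonglongrightarrow> (\<Prod>j<l. 1)"
    by (intro tendsto_prod) real_asymp
  ultimately show ?thesis by simp
qed

lemma zonal_arg_commute: "zonal_arg x y = zonal_arg y x"
  by (simp add: zonal_arg_def inner_commute)

lemma zonal_arg_dist: "x \<in> S2 \<Longrightarrow> y \<in> S2 \<Longrightarrow> zonal_arg x y = 1 - (dist x y)\<^sup>2 / 4"
proof -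
  assume "x \<in> S2" "y \<in> S2"
  then have "x \<bullet> x = 1" "y \<bullet> y = 1" by (simp_all add: dot_square_norm)
  then have "(dist x y)\<^sup>2 = 2 - 2 * (x \<bullet> y)"
    by (simp add: dist_norm power2_norm_eq_inner inner_diff_left inner_diff_right inner_commute)
  then show ?thesis by (simp add: zonal_arg_def field_simps)
qed

lemma zonal_arg_bounds:
  assumes "x \<in> S2" "y \<in> S2" shows "0 \<le> zonal_arg x y" "zonal_arg x y \<le> 1"
proof -
  have "\<bar>x \<bullet> y\<bar> \<le> 1" using Cauchy_Schwarz_ineq2[of x y] assms by simp
  then show "0 \<le> zonal_arg x y" "zonal_arg x y \<le> 1" by (auto simp: zonal_arg_def abs_le_iff)
qed

lemma zonal_arg_eq_1: "x \<in> S2 \<Longrightarrow> y \<in> S2 \<Longrightarrow> zonal_arg x y = 1 \<longleftrightarrow> x = y"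
  by (simp add: zonal_arg_dist)

lemma continuous_on_zonal_arg [continuous_intros]:
  "continuous_on S f \<Longrightarrow> continuous_on S g \<Longrightarrow> continuous_on S (\<lambda>x. zonal_arg (f x) (g x))"
  unfolding zonal_arg_def by (intro continuous_intros) auto

lemma spherical_harmonic_continuous: "f \<in> spherical_harmonics l \<Longrightarrow> continuous_on S2 f"
proof -
  assume "f \<in> spherical_harmonics l"
  then have C2: "C2_on (- {0}) (ray_ext f)" by (simp add: spherical_harmonics_def)
  obtain B where "\<And>e. norm e = 1 \<Longrightarrow> second_rot_deriv e f (B e)"
    by (rule rot_derivatives_of_C2[OF C2]) blast
  then have "second_rot_deriv (axis 1 1) f (B (axis 1 1))" by simp
  then show ?thesis by (simp add: second_rot_deriv_def)
qed

lemma poly_legendre_op_monom: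
  "poly (legendre_op (monom 1 (Suc n))) w = (real (Suc n))\<^sup>2 * w ^ n - real (Suc n) * (real (Suc n) + 1) * w ^ Suc n"
  by (cases n) (simp_all add: legendre_op_def pderiv_monom poly_monom power2_eq_square algebra_simps)

text \<open>Green's identity with a power as zonal polynomial. For a constant polynomial it says that a
  harmonic with nonzero eigenvalue has mean zero.\<close>

lemma zonal_moment_recurrence:
  assumes f: "f \<in> spherical_harmonics l" and y: "y \<in> S2"
  shows "(real (Suc n) * (real (Suc n) + 1) - eigval l) * (LINT x|sphere_measure. f x * zonal_arg x y ^ Suc n)
     = (real (Suc n))\<^sup>2 * (LINT x|sphere_measure. f x * zonal_arg x y ^ n)"
    and "eigval l * (LINT x|sphere_measure. f x) = 0"
proof -
  have i: "integrable sphere_measure (\<lambda>x. f x * zonal_arg x y ^ k)" for k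
    by (intro continuous_on_S2_integrable continuous_intros spherical_harmonic_continuous[OF f])
  have "(LINT x|sphere_measure. f x * poly (legendre_op (monom 1 (Suc n))) (zonal_arg x y)) =
     (LINT x|sphere_measure. (real (Suc n))\<^sup>2 * (f x * zonal_arg x y ^ n)
        - real (Suc n) * (real (Suc n) + 1) * (f x * zonal_arg x y ^ Suc n))"
    unfolding poly_legendre_op_monom by (simp add: algebra_simps)
  also have "\<dots> = (real (Suc n))\<^sup>2 * (LINT x|sphere_measure. f x * zonal_arg x y ^ n)
        - real (Suc n) * (real (Suc n) + 1) * (LINT x|sphere_measure. f x * zonal_arg x y ^ Suc n)"
    using i[of n] i[of "Suc n"]
    by (subst Bochner_Integration.integral_diff) (simp_all only: integrable_mult_right integral_mult_right_zero)
  finally show "(real (Suc n) * (real (Suc n) + 1) - eigval l) * (LINT x|sphere_measure. f x * zonal_arg x y ^ Suc n)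
     = (real (Suc n))\<^sup>2 * (LINT x|sphere_measure. f x * zonal_arg x y ^ n)"
    using harmonic_zonal_adjoint[OF f y, of "monom 1 (Suc n)"] unfolding poly_monom
    by (simp only: mult_1 left_diff_distrib)
  show "eigval l * (LINT x|sphere_measure. f x) = 0"
    using harmonic_zonal_adjoint[OF f y, of 1] by (simp add: legendre_op_def)
qed

lemma one_spherical_harmonic: "(\<lambda>_. 1) \<in> spherical_harmonics 0"
proof -
  have "C2_on (- {0}) (\<lambda>_::real^3. 1)"
    unfolding C2_on_def by (intro exI[of _ "\<lambda>_. 0"]) (auto simp: zero_blinfun.rep_eq intro!: derivative_eq_intros)
  then show ?thesis
    by (simp add: spherical_harmonics_def ray_ext_def[abs_def] laplace_beltrami_def laplacian_def numeral_2_eq_2 eigval_def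
      del: One_nat_def)
qed

text \<open>The moment recurrence for the constant harmonic, started at the power zero.\<close>

lemma zonal_power_integral:
  assumes y: "y \<in> S2" shows "(LINT x|sphere_measure. zonal_arg x y ^ n) = 1 / (real n + 1)"
proof (induction n)
  case 0 then show ?case using sphere.prob_space by simp
next
  case (Suc n)
  let ?I = "LINT x|sphere_measure. zonal_arg x y ^ Suc n"
  have "real (Suc n) * ((real (Suc n) + 1) * ?I) = (real (Suc n))\<^sup>2 * (1 / (real n + 1))"
    using zonal_moment_recurrence(1)[OF one_spherical_harmonic y, of n] unfolding mult_1 Suc
    by (simp only: eigval_def mult.assoc) simp
  also have "\<dots> = real (Suc n) * 1" by (simp add: power2_eq_square add.commute)
  finally have "(real (Suc n) + 1) * ?I = 1" by (simp only: mult_cancel_left) simp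
  then show ?case by (simp only: eq_divide_eq) (simp add: mult.commute)
qed

text \<open>The normalized power has mean one, and away from \<open>y\<close> its base stays below a constant less than
  one, so that it concentrates at \<open>y\<close>.\<close>

lemma zonal_approximate_identity:
  assumes f: "continuous_on S2 f" and eps: "eps > 0"
  shows "\<exists>n0. \<forall>n\<ge>n0. \<forall>y\<in>S2. \<bar>(real n + 1) * (LINT x|sphere_measure. f x * zonal_arg x y ^ n) - f y\<bar> < eps"
proof -
  obtain B where B: "B > 0" "\<And>x. x \<in> S2 \<Longrightarrow> \<bar>f x\<bar> \<le> B"
    by (rule continuous_on_S2_bounded[OF f]) blast
  have "uniformly_continuous_on S2 f" by (rule compact_uniformly_continuous[OF f]) simp
  then obtain d0 where d0: "d0 > 0" "\<And>x y. x \<in> S2 \<Longrightarrow> y \<in> S2 \<Longrightarrow> dist x y < d0 \<Longrightarrow> dist (f x) (f y) < eps / 2"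
    unfolding uniformly_continuous_on_def using eps by (metis half_gt_zero)
  define d where "d = min d0 1"
  have d: "d > 0" "d \<le> 1" "\<And>x y. x \<in> S2 \<Longrightarrow> y \<in> S2 \<Longrightarrow> dist x y < d \<Longrightarrow> \<bar>f x - f y\<bar> < eps / 2"
    using d0 by (auto simp: d_def dist_real_def)
  define r where "r = 1 - d\<^sup>2 / 4"
  have "d\<^sup>2 \<le> 1" using d by (simp add: power_le_one)
  then have r: "0 < r" "r < 1" using d by (auto simp: r_def)
  have "(\<lambda>n. real n * r ^ n + r ^ n) \<longlonglongrightarrow> 0 + 0"
    using r by (intro tendsto_add powser_times_n_limit_0 LIMSEQ_power_zero) auto
  then have "(\<lambda>n. 2 * B * (real n * r ^ n + r ^ n)) \<longlonglongrightarrow> 2 * B * (0 + 0)"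
    by (intro tendsto_mult tendsto_const)
  then have "\<forall>\<^sub>F n in sequentially. 2 * B * (real n * r ^ n + r ^ n) < eps / 2"
    by (rule order_tendstoD) (use eps in auto)
  then obtain n0 where n0: "\<And>n. n \<ge> n0 \<Longrightarrow> 2 * B * (real n * r ^ n + r ^ n) < eps / 2"
    by (auto simp: eventually_sequentially)
  show ?thesis
  proof (intro exI[of _ n0] allI impI ballI)
    fix n y assume n: "n \<ge> n0" and y: "y \<in> S2"
    let ?w = "\<lambda>x. zonal_arg x y ^ n"
    have i: "integrable sphere_measure (\<lambda>x. f x * ?w x)" "integrable sphere_measure ?w"
      by (intro continuous_on_S2_integrable continuous_intros f)+
    have "(real n + 1) * (LINT x|sphere_measure. f x * ?w x) - f y =
       (real n + 1) * ((LINT x|sphere_measure. f x * ?w x) - f y * (LINT x|sphere_measure. ?w x))"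
      by (simp add: zonal_power_integral[OF y] field_simps)
    also have "\<dots> = (real n + 1) * (LINT x|sphere_measure. (f x - f y) * ?w x)"
      using i by (simp add: left_diff_distrib)
    finally have eq: "\<bar>(real n + 1) * (LINT x|sphere_measure. f x * ?w x) - f y\<bar> =
        (real n + 1) * \<bar>LINT x|sphere_measure. (f x - f y) * ?w x\<bar>"
      by (simp add: abs_mult)
    have "\<bar>LINT x|sphere_measure. (f x - f y) * ?w x\<bar> \<le> (LINT x|sphere_measure. \<bar>(f x - f y) * ?w x\<bar>)"
      by (rule integral_abs_bound)
    also have "\<dots> \<le> (LINT x|sphere_measure. eps / 2 * ?w x + 2 * B * r ^ n)"
    proof (rule integral_mono)
      show "integrable sphere_measure (\<lambda>x. \<bar>(f x - f y) * ?w x\<bar>)"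
        by (intro continuous_on_S2_integrable continuous_intros f)
      show "integrable sphere_measure (\<lambda>x. eps / 2 * ?w x + 2 * B * r ^ n)"
        by (intro continuous_on_S2_integrable continuous_intros)
      fix x assume "x \<in> space sphere_measure"
      then have x: "x \<in> S2" by simp
      have w0: "0 \<le> ?w x" using zonal_arg_bounds[OF x y] by simp
      show "\<bar>(f x - f y) * ?w x\<bar> \<le> eps / 2 * ?w x + 2 * B * r ^ n"
      proof (cases "dist x y < d")
        case True
        then have "\<bar>f x - f y\<bar> * ?w x \<le> eps / 2 * ?w x"
          using d(3)[OF x y] w0 by (intro mult_right_mono) auto
        moreover have "0 \<le> 2 * B * r ^ n" using B r by simp
        ultimately show ?thesis using w0 by (simp add: abs_mult)
      next
        case False
        then have "d\<^sup>2 \<le> (dist x y)\<^sup>2" using d by (intro power_mono) auto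
        then have "zonal_arg x y \<le> r" by (simp add: zonal_arg_dist[OF x y] r_def)
        then have "?w x \<le> r ^ n" using zonal_arg_bounds[OF x y] by (intro power_mono) auto
        moreover have "\<bar>f x - f y\<bar> \<le> 2 * B" using B(2)[OF x] B(2)[OF y] by linarith
        ultimately have "\<bar>f x - f y\<bar> * ?w x \<le> 2 * B * r ^ n"
          using w0 B by (intro mult_mono) auto
        moreover have "0 \<le> eps / 2 * ?w x" using eps w0 by simp
        ultimately show ?thesis using w0 by (simp add: abs_mult)
      qed
    qed
    also have "\<dots> = eps / 2 / (real n + 1) + 2 * B * r ^ n"
      using i(2) sphere.prob_space zonal_power_integral[OF y] by simp
    finally have "(real n + 1) * \<bar>LINT x|sphere_measure. (f x - f y) * ?w x\<bar> \<le>
       (real n + 1) * (eps / 2 / (real n + 1) + 2 * B * r ^ n)"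
      by (intro mult_left_mono) auto
    also have "\<dots> = eps / 2 + 2 * B * (real n * r ^ n + r ^ n)"
      by (simp add: field_simps)
    also have "\<dots> < eps" using n0[OF n] by simp
    finally show "\<bar>(real n + 1) * (LINT x|sphere_measure. f x * ?w x) - f y\<bar> < eps" unfolding eq .
  qed
qed

lemma eigval_strict_mono: "m < n \<Longrightarrow> eigval m < eigval n"
  unfolding eigval_def by (intro mult_strict_mono) auto

text \<open>The moments satisfy a two-term recurrence, which starts from zero and stays zero below \<open>n = l\<close>,
  where its leading factor vanishes. From there on they are a multiple of \<open>funk_hecke n l\<close>, and the
  approximate identity determines the multiple as the value of the harmonic at \<open>y\<close>.\<close>

theorem funk_hecke_power:
  assumes f: "f \<in> spherical_harmonics l" and y: "y \<in> S2"
  shows "(LINT x|sphere_measure. f x * zonal_arg x y ^ n) = funk_hecke n l * f y"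
proof -
  define m where "m n = (LINT x|sphere_measure. f x * zonal_arg x y ^ n)" for n
  have rec: "(real (Suc n) * (real (Suc n) + 1) - eigval l) * m (Suc n) = (real (Suc n))\<^sup>2 * m n" for n
    unfolding m_def by (rule zonal_moment_recurrence(1)[OF f y])
  have eS: "real (Suc n) * (real (Suc n) + 1) = eigval (Suc n)" for n by (simp add: eigval_def)
  have low: "m n = 0" if "n < l" for n
    using that
  proof (induction n)
    case 0
    then have "eigval l \<noteq> 0" by (simp add: eigval_def)
    then show ?case using zonal_moment_recurrence(2)[OF f y] by (simp add: m_def)
  next
    case (Suc n)
    then have "m n = 0" by simp
    moreover have "eigval (Suc n) - eigval l \<noteq> 0" using eigval_strict_mono[OF Suc.prems] by simp
    ultimately show ?case using rec[of n] unfolding eS by simp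
  qed
  define k where "k = m l / funk_hecke l l"
  have up: "m n = k * funk_hecke n l" if "l \<le> n" for n
    using that
  proof (induction n rule: dec_induct)
    case base
    show ?case using funk_hecke_pos[of l l] by (simp add: k_def)
  next
    case (step n)
    have ne: "eigval (Suc n) - eigval l \<noteq> 0" using eigval_strict_mono[of l "Suc n"] step by simp
    have "(eigval (Suc n) - eigval l) * m (Suc n) = (eigval (Suc n) - eigval l) * (k * funk_hecke (Suc n) l)"
      using rec[of n] funk_hecke_recurrence[of n l] step.IH unfolding eS by (simp add: mult_ac)
    then show ?case using ne by simp
  qed
  have all: "m n = k * funk_hecke n l" for n
    by (cases "n < l") (auto simp: low up funk_hecke_eq_0)
  have "(\<lambda>n. (real n + 1) * m n) \<longlonglongrightarrow> f y"
    unfolding m_def lim_sequentially dist_real_def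
    using zonal_approximate_identity[OF spherical_harmonic_continuous[OF f]] y by meson
  moreover have "(\<lambda>n. (real n + 1) * m n) \<longlonglongrightarrow> k * 1"
    using tendsto_mult[OF tendsto_const[of k] funk_hecke_asymptotics[of l]] by (simp add: all mult_ac)
  ultimately have "k = f y" using LIMSEQ_unique by fastforce
  then show ?thesis using all[of n] by (simp add: m_def)
qed

lemma harmonic_degree_0_const:
  "f \<in> spherical_harmonics 0 \<Longrightarrow> y \<in> S2 \<Longrightarrow> f y = (LINT x|sphere_measure. f x)"
  using funk_hecke_power[of f 0 y 0] by (simp add: funk_hecke_def)

lemma spherical_harmonic_mean_zero:
  assumes f: "f \<in> spherical_harmonics l" and l: "l \<ge> 1"
  shows "(LINT x|sphere_measure. f x) = 0"
proof -
  have "axis 3 1 \<in> S2" by simp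
  from funk_hecke_power[OF f this, of 0] show ?thesis using l by (simp add: funk_hecke_eq_0)
qed

lemma funk_hecke_poly:
  assumes f: "f \<in> spherical_harmonics l" and y: "y \<in> S2"
  shows "(LINT x|sphere_measure. f x * poly P (zonal_arg x y)) =
     (\<Sum>j\<le>degree P. coeff P j * funk_hecke j l) * f y"
proof -
  have i: "integrable sphere_measure (\<lambda>x. f x * zonal_arg x y ^ k)" for k
    by (intro continuous_on_S2_integrable continuous_intros spherical_harmonic_continuous[OF f])
  have "(LINT x|sphere_measure. f x * poly P (zonal_arg x y)) =
     (LINT x|sphere_measure. (\<Sum>j\<le>degree P. coeff P j * (f x * zonal_arg x y ^ j)))"
    by (simp add: poly_altdef sum_distrib_left mult_ac)
  also have "\<dots> = (\<Sum>j\<le>degree P. coeff P j * (LINT x|sphere_measure. f x * zonal_arg x y ^ j))"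
    using i by (subst Bochner_Integration.integral_sum) auto
  also have "\<dots> = (\<Sum>j\<le>degree P. coeff P j * funk_hecke j l) * f y"
    by (simp add: funk_hecke_power[OF f y] sum_distrib_right mult.assoc)
  finally show ?thesis .
qed

section \<open>Zonal harmonics\<close>

lemma C2_on_const: "C2_on U (\<lambda>_. c)"
  unfolding C2_on_def
  by (intro exI[of _ "\<lambda>_. 0"]) (auto simp: zero_blinfun.rep_eq intro!: derivative_eq_intros)

lemma C2_on_inner: "C2_on U (\<lambda>x. x \<bullet> y)"
  unfolding C2_on_def
  by (intro exI[of _ "\<lambda>_. blinfun_inner_left y"] exI[of _ "\<lambda>_. 0"])
     (auto simp: zero_blinfun.rep_eq intro!: derivative_eq_intros)

lemma C2_on_add:
  assumes "C2_on U F" "C2_on U G" shows "C2_on U (\<lambda>x. F x + G x)"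
proof -
  obtain F' F'' G' G'' where
    F: "\<And>x. x \<in> U \<Longrightarrow> (F has_derivative blinfun_apply (F' x)) (at x)"
      "\<And>x. x \<in> U \<Longrightarrow> (F' has_derivative blinfun_apply (F'' x)) (at x)" "continuous_on U F''"
    and G: "\<And>x. x \<in> U \<Longrightarrow> (G has_derivative blinfun_apply (G' x)) (at x)"
      "\<And>x. x \<in> U \<Longrightarrow> (G' has_derivative blinfun_apply (G'' x)) (at x)" "continuous_on U G''"
    using assms unfolding C2_on_def by blast
  show ?thesis unfolding C2_on_def
    using F(3) G(3)
    by (intro exI[of _ "\<lambda>x. F' x + G' x"] exI[of _ "\<lambda>x. F'' x + G'' x"] conjI ballI continuous_on_add)
       (auto simp: plus_blinfun.rep_eq intro!: has_derivative_add F G)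
qed

lemma C2_on_mult:
  assumes "C2_on U F" "C2_on U G" shows "C2_on U (\<lambda>x. F x * G x)"
proof -
  obtain F' F'' G' G'' where
    F: "\<And>x. x \<in> U \<Longrightarrow> (F has_derivative blinfun_apply (F' x)) (at x)"
      "\<And>x. x \<in> U \<Longrightarrow> (F' has_derivative blinfun_apply (F'' x)) (at x)" "continuous_on U F''"
    and G: "\<And>x. x \<in> U \<Longrightarrow> (G has_derivative blinfun_apply (G' x)) (at x)"
      "\<And>x. x \<in> U \<Longrightarrow> (G' has_derivative blinfun_apply (G'' x)) (at x)" "continuous_on U G''"
    using assms unfolding C2_on_def by blast
  define H where "H x h = F x *\<^sub>R G'' x h + F' x h *\<^sub>R G' x + (G x *\<^sub>R F'' x h + G' x h *\<^sub>R F' x)" for x h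
  have bl: "bounded_linear (H x)" for x
    unfolding H_def
    by (intro bounded_linear_add bounded_linear_compose[OF bounded_linear_scaleR_right]
        bounded_linear_compose[OF bounded_linear_scaleR_left] blinfun.bounded_linear_right)
  have c: "continuous_on U F" "continuous_on U G" "continuous_on U F'" "continuous_on U G'"
    by (rule continuous_at_imp_continuous_on, use F G has_derivative_continuous in blast)+
  have 1: "((\<lambda>x. F x * G x) has_derivative blinfun_apply (F x *\<^sub>R G' x + G x *\<^sub>R F' x)) (at x)" if "x \<in> U" for x
    by (rule has_derivative_eq_rhs[OF has_derivative_mult[OF F(1)[OF that] G(1)[OF that]]])
       (simp add: fun_eq_iff plus_blinfun.rep_eq scaleR_blinfun.rep_eq)
  have 2: "((\<lambda>x. F x *\<^sub>R G' x + G x *\<^sub>R F' x) has_derivative blinfun_apply (Blinfun (H x))) (at x)"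
    if x: "x \<in> U" for x
    unfolding bounded_linear_Blinfun_apply[OF bl]
    by (rule has_derivative_eq_rhs[OF has_derivative_add[OF has_derivative_scaleR[OF F(1)[OF x] G(2)[OF x]]
            has_derivative_scaleR[OF G(1)[OF x] F(2)[OF x]]]])
       (simp add: fun_eq_iff H_def)
  have 3: "continuous_on U (\<lambda>x. Blinfun (H x))"
    by (rule continuous_on_blinfun_componentwise)
       (unfold bounded_linear_Blinfun_apply[OF bl] H_def, intro continuous_intros c F(3) G(3))
  show ?thesis unfolding C2_on_def
    by (rule exI[of _ "\<lambda>x. F x *\<^sub>R G' x + G x *\<^sub>R F' x"], rule exI[of _ "\<lambda>x. Blinfun (H x)"])
       (intro conjI ballI 1 2 3)
qed

lemma C2_on_inverse_norm: "C2_on (- {0}) (\<lambda>x. inverse (norm x))"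
proof -
  let ?u = "\<lambda>x::'a. inverse (norm x)"
  \<comment> \<open>The gradient is \<open>- x / norm x ^ 3\<close>; the Hessian below differentiates this product.\<close>
  have du: "(?u has_derivative (\<lambda>h. - (?u x ^ 3) * (h \<bullet> x))) (at x)" if "x \<noteq> 0" for x
    using that
    by (intro has_derivative_eq_rhs[OF Deriv.has_derivative_inverse[OF _ has_derivative_norm]])
       (simp_all add: fun_eq_iff sgn_div_norm power3_eq_cube inner_commute)
  define H where "H x h = (- (?u x ^ 3)) *\<^sub>R blinfun_inner_left h + (3 * ?u x ^ 5 * (h \<bullet> x)) *\<^sub>R blinfun_inner_left x" for x h :: 'a
  have bl: "bounded_linear (H x)" for x
    unfolding H_def
    by (intro bounded_linear_add bounded_linear_compose[OF bounded_linear_scaleR_right]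
        bounded_linear_compose[OF bounded_linear_scaleR_left] bounded_linear_blinfun_inner_left
        bounded_linear_compose[OF bounded_linear_mult_right] bounded_linear_inner_left)
  have dl: "(blinfun_inner_left has_derivative blinfun_inner_left) (at x)" for x :: 'a
    by (rule bounded_linear_imp_has_derivative[OF bounded_linear_blinfun_inner_left])
  have d3: "((\<lambda>x. - (?u x ^ 3)) has_derivative (\<lambda>h. 3 * ?u x ^ 5 * (h \<bullet> x))) (at x)" if "x \<noteq> 0" for x
    by (rule has_derivative_eq_rhs[OF has_derivative_minus[OF has_derivative_power[OF du[OF that], of 3]]])
       (simp add: fun_eq_iff eval_nat_numeral)
  have cu: "continuous_on (- {0}) ?u" by (intro continuous_intros) auto
  have cl: "continuous_on (- {0}) (\<lambda>x::'a. blinfun_inner_left x)"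
    by (rule linear_continuous_on[OF bounded_linear_blinfun_inner_left])
  show ?thesis unfolding C2_on_def
  proof (intro exI[of _ "\<lambda>x. (- (?u x ^ 3)) *\<^sub>R blinfun_inner_left x"] exI[of _ "\<lambda>x. Blinfun (H x)"] conjI ballI)
    fix x :: 'a assume "x \<in> - {0}"
    then have x: "x \<noteq> 0" by simp
    show "(?u has_derivative blinfun_apply ((- (?u x ^ 3)) *\<^sub>R blinfun_inner_left x)) (at x)"
      by (rule has_derivative_eq_rhs[OF du[OF x]]) (simp add: fun_eq_iff blinfun.bilinear_simps)
    show "((\<lambda>x. (- (?u x ^ 3)) *\<^sub>R blinfun_inner_left x) has_derivative blinfun_apply (Blinfun (H x))) (at x)"
      unfolding bounded_linear_Blinfun_apply[OF bl]
      by (rule has_derivative_eq_rhs[OF has_derivative_scaleR[OF d3[OF x] dl]])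
         (simp add: fun_eq_iff H_def)
  next
    show "continuous_on (- {0}) (\<lambda>x. Blinfun (H x))"
      by (rule continuous_on_blinfun_componentwise)
         (unfold bounded_linear_Blinfun_apply[OF bl] H_def, intro continuous_intros cu cl)
  qed
qed

lemma C2_on_poly: "C2_on U f \<Longrightarrow> C2_on U (\<lambda>x. poly P (f x))"
  by (induction P) (simp_all add: C2_on_const C2_on_add C2_on_mult)

lemma C2_on_ray_ext_zonal: "C2_on (- {0}) (ray_ext (\<lambda>x. poly P (zonal_arg x y)))"
proof -
  have "C2_on (- {0}) (\<lambda>x::real^3. poly P (1/2 + (1/2) * (inverse (norm x) * (x \<bullet> y))))"
    by (intro C2_on_poly C2_on_add C2_on_mult C2_on_const C2_on_inverse_norm C2_on_inner)
  also have "(\<lambda>x::real^3. poly P (1/2 + (1/2) * (inverse (norm x) * (x \<bullet> y)))) = ray_ext (\<lambda>x. poly P (zonal_arg x y))"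
    by (simp add: fun_eq_iff ray_ext_def zonal_arg_def add_divide_distrib)
  finally show ?thesis .
qed

lemma second_rot_deriv_unique:
  assumes "second_rot_deriv e f B" "second_rot_deriv e f B'" "x \<in> S2"
  shows "B x = B' x"
proof -
  obtain D where D: "\<And>t. ((\<lambda>t. f (rot e t x)) has_real_derivative D (rot e t x)) (at t)"
    "\<And>t. ((\<lambda>t. D (rot e t x)) has_real_derivative B (rot e t x)) (at t)"
    using assms unfolding second_rot_deriv_def by blast
  obtain D' where D': "\<And>t. ((\<lambda>t. f (rot e t x)) has_real_derivative D' (rot e t x)) (at t)"
    "\<And>t. ((\<lambda>t. D' (rot e t x)) has_real_derivative B' (rot e t x)) (at t)"
    using assms unfolding second_rot_deriv_def by blast
  have "D (rot e t x) = D' (rot e t x)" for t using D(1) D'(1) by (rule DERIV_unique)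
  then have "((\<lambda>t. D (rot e t x)) has_real_derivative B' (rot e 0 x)) (at 0)" using D'(2)[of 0] by simp
  from DERIV_unique[OF D(2)[of 0] this] show ?thesis by simp
qed

text \<open>The rotational second derivatives are unique, so they may be computed from the function on the
  sphere, where the zonal formula is available, instead of from its extension along rays.\<close>

lemma laplace_beltrami_zonal:
  assumes "x \<in> S2" "y \<in> S2"
  shows "laplace_beltrami (\<lambda>x. poly P (zonal_arg x y)) x = poly (legendre_op P) (zonal_arg x y)"
proof -
  obtain B where B: "\<And>e. norm e = 1 \<Longrightarrow> second_rot_deriv e (\<lambda>x. poly P (zonal_arg x y)) (B e)"
    "\<And>x. x \<in> S2 \<Longrightarrow> (\<Sum>e\<in>Basis. B e x) = laplace_beltrami (\<lambda>x. poly P (zonal_arg x y)) x"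
    by (rule rot_derivatives_of_C2[OF C2_on_ray_ext_zonal]) blast
  have "laplace_beltrami (\<lambda>x. poly P (zonal_arg x y)) x = (\<Sum>e\<in>Basis. B e x)"
    using B(2) assms by simp
  also have "\<dots> = (\<Sum>e\<in>Basis. poly (pderiv (pderiv P)) (zonal_arg x y) * ((cross3 e x \<bullet> y) / 2)\<^sup>2
       + poly (pderiv P) (zonal_arg x y) * ((cross3 e (cross3 e x) \<bullet> y) / 2))"
    by (rule sum.cong[OF refl], rule second_rot_deriv_unique[OF B(1) rot_derivatives_zonal assms(1)]) auto
  also have "\<dots> = poly (legendre_op P) (zonal_arg x y)"
    by (rule sum_rot_derivatives_zonal[OF assms])
  finally show ?thesis .
qed

text \<open>The coefficients of the shifted Legendre polynomial of degree \<open>l\<close>, with constant term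
  normalized to one. The product vanishes for \<open>j > l\<close>, which ends the polynomial.\<close>

definition zonal_coeff :: "nat \<Rightarrow> nat \<Rightarrow> real" where
  "zonal_coeff l j = (\<Prod>i<j. - (real l - real i) * (real l + real i + 1) / (real i + 1)\<^sup>2)"

definition zonal_poly :: "nat \<Rightarrow> real poly" where
  "zonal_poly l = (\<Sum>j\<le>l. monom (zonal_coeff l j) j)"

lemma zonal_coeff_eq_0: "l < j \<Longrightarrow> zonal_coeff l j = 0"
  by (auto simp: zonal_coeff_def)

lemma zonal_coeff_nonzero: "j \<le> l \<Longrightarrow> zonal_coeff l j \<noteq> 0"
  by (auto simp: zonal_coeff_def)

lemma coeff_zonal_poly: "coeff (zonal_poly l) j = zonal_coeff l j"
  by (auto simp: zonal_poly_def coeff_sum zonal_coeff_eq_0)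

lemma degree_zonal_poly: "degree (zonal_poly l) = l"
proof (rule antisym)
  show "degree (zonal_poly l) \<le> l" by (rule degree_le) (simp add: coeff_zonal_poly zonal_coeff_eq_0)
  show "l \<le> degree (zonal_poly l)" by (rule le_degree) (simp add: coeff_zonal_poly zonal_coeff_nonzero)
qed

lemma coeff_legendre_op:
  "coeff (legendre_op P) j = (real j + 1)\<^sup>2 * coeff P (Suc j) - real j * (real j + 1) * coeff P j"
proof -
  have e: "legendre_op P = pCons 0 (pderiv (pderiv P) - pCons 0 (pderiv (pderiv P))) + (pderiv P - smult 2 (pCons 0 (pderiv P)))"
    by (simp add: legendre_op_def)
  show ?thesis
  proof (cases j)
    case 0 then show ?thesis unfolding e by (simp add: coeff_pderiv)
  next
    case (Suc i) then show ?thesis unfolding e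
      by (cases i) (simp_all add: coeff_pderiv power2_eq_square algebra_simps)
  qed
qed

lemma legendre_op_zonal_poly: "legendre_op (zonal_poly l) = smult (- eigval l) (zonal_poly l)"
proof (rule poly_eqI)
  fix j
  have "(real j + 1)\<^sup>2 * zonal_coeff l (Suc j) = - ((real l - real j) * (real l + real j + 1)) * zonal_coeff l j"
    by (simp add: zonal_coeff_def) (simp add: algebra_simps)
  then show "coeff (legendre_op (zonal_poly l)) j = coeff (smult (- eigval l) (zonal_poly l)) j"
    unfolding coeff_legendre_op coeff_zonal_poly coeff_smult by (simp add: eigval_def algebra_simps)
qed

lemma zonal_poly_harmonic:
  "y \<in> S2 \<Longrightarrow> (\<lambda>x. poly (zonal_poly l) (zonal_arg x y)) \<in> spherical_harmonics l"
  by (simp add: spherical_harmonics_def C2_on_ray_ext_zonal laplace_beltrami_zonal legendre_op_zonal_poly)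

text \<open>The zonal polynomials have exact degrees, so they form a triangular basis.\<close>

lemma zonal_poly_span:
  "degree Q \<le> n \<Longrightarrow> \<exists>q. Q = (\<Sum>l\<le>n. smult (q l) (zonal_poly l))"
proof (induction n arbitrary: Q)
  case 0
  have "zonal_poly 0 = 1" by (simp add: zonal_poly_def zonal_coeff_def)
  moreover obtain c where "Q = [:c:]" using 0 degree_eq_zeroE by blast
  ultimately show ?case by (intro exI[of _ "\<lambda>_. c"]) simp
next
  case (Suc n)
  define c where "c = coeff Q (Suc n) / zonal_coeff (Suc n) (Suc n)"
  define R where "R = Q - smult c (zonal_poly (Suc n))"
  have "coeff R (Suc n) = 0"
    using zonal_coeff_nonzero[of "Suc n" "Suc n"] by (simp add: R_def c_def coeff_zonal_poly)
  moreover have "degree R \<le> Suc n"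
    unfolding R_def using Suc.prems degree_zonal_poly[of "Suc n"]
    by (intro degree_diff_le) (auto intro: order_trans[OF degree_smult_le])
  ultimately have "degree R \<le> n"
    by (metis le_Suc_eq leading_coeff_0_iff degree_0 le0)
  then obtain q where q: "R = (\<Sum>l\<le>n. smult (q l) (zonal_poly l))" using Suc.IH by blast
  have "Q = R + smult c (zonal_poly (Suc n))" by (simp add: R_def)
  also have "\<dots> = (\<Sum>l\<le>Suc n. smult ((q(Suc n := c)) l) (zonal_poly l))"
    by (simp add: q)
  finally show ?case by blast
qed

section \<open>Orthogonality, addition theorem and density\<close>

interpretation sphere_pair: pair_prob_space sphere_measure sphere_measure ..

lemma measurable_sphere_ident [measurable]: "(\<lambda>x. x) \<in> sphere_measure \<rightarrow>\<^sub>M borel"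
  by (rule continuous_on_S2_measurable) (rule continuous_on_id)

lemma measurable_zonal_arg [measurable]:
  assumes [measurable]: "f \<in> M \<rightarrow>\<^sub>M sphere_measure" "g \<in> M \<rightarrow>\<^sub>M sphere_measure"
  shows "(\<lambda>z. zonal_arg (f z) (g z)) \<in> borel_measurable M"
proof -
  have "f \<in> M \<rightarrow>\<^sub>M borel" "g \<in> M \<rightarrow>\<^sub>M borel"
    using measurable_compose[OF assms(1) measurable_sphere_ident]
      measurable_compose[OF assms(2) measurable_sphere_ident] by simp_all
  then show ?thesis unfolding zonal_arg_def by measurable
qed

lemma zonal_double_integral_swap:
  assumes f: "continuous_on S2 f" and g: "continuous_on S2 g"
  shows "(LINT y|sphere_measure. (LINT x|sphere_measure. f x * zonal_arg x y ^ n) * g y) =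
    (LINT x|sphere_measure. f x * (LINT y|sphere_measure. g y * zonal_arg y x ^ n))"
proof -
  have [measurable]: "f \<in> borel_measurable sphere_measure" "g \<in> borel_measurable sphere_measure"
    by (intro continuous_on_S2_measurable f g)+
  obtain A where A: "A > 0" "\<And>x. x \<in> S2 \<Longrightarrow> \<bar>f x\<bar> \<le> A"
    by (rule continuous_on_S2_bounded[OF f]) blast
  obtain B where B: "B > 0" "\<And>x. x \<in> S2 \<Longrightarrow> \<bar>g x\<bar> \<le> B"
    by (rule continuous_on_S2_bounded[OF g]) blast
  have "integrable (sphere_measure \<Otimes>\<^sub>M sphere_measure) (\<lambda>(x, y). f x * zonal_arg x y ^ n * g y)"
  proof (rule sphere_pair.P.integrable_const_bound[where B="A * 1 * B"])
    show "AE z in sphere_measure \<Otimes>\<^sub>M sphere_measure. norm (case z of (x, y) \<Rightarrow> f x * zonal_arg x y ^ n * g y) \<le> A * 1 * B"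
    proof (rule AE_I2)
      fix z assume "z \<in> space (sphere_measure \<Otimes>\<^sub>M sphere_measure)"
      then obtain x y where z: "z = (x, y)" "x \<in> S2" "y \<in> S2" by (auto simp: space_pair_measure)
      have "\<bar>zonal_arg x y ^ n\<bar> \<le> 1"
        using zonal_arg_bounds[OF z(2,3)] by (simp add: power_le_one)
      then show "norm (case z of (x, y) \<Rightarrow> f x * zonal_arg x y ^ n * g y) \<le> A * 1 * B"
      proof -
        assume w: "\<bar>zonal_arg x y ^ n\<bar> \<le> 1"
        have "\<bar>f x\<bar> * \<bar>zonal_arg x y ^ n\<bar> * \<bar>g y\<bar> \<le> A * 1 * B"
          using w A(1) B(1) by (intro mult_mono A(2) B(2) z) auto
        then show ?thesis using z(1) by (simp add: abs_mult)
      qed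
    qed
    show "(\<lambda>(x, y). f x * zonal_arg x y ^ n * g y) \<in> borel_measurable (sphere_measure \<Otimes>\<^sub>M sphere_measure)"
      by measurable
  qed
  from sphere_pair.Fubini_integral[OF this]
  have "(LINT y|sphere_measure. LINT x|sphere_measure. f x * zonal_arg x y ^ n * g y) =
     (LINT x|sphere_measure. LINT y|sphere_measure. f x * zonal_arg x y ^ n * g y)" by simp
  moreover have "(LINT x|sphere_measure. f x * zonal_arg x y ^ n * g y) = (LINT x|sphere_measure. f x * zonal_arg x y ^ n) * g y" for y
    by simp
  moreover have "(LINT y|sphere_measure. f x * zonal_arg x y ^ n * g y) = f x * (LINT y|sphere_measure. g y * zonal_arg y x ^ n)" for x
  proof -
    have "f x * zonal_arg x y ^ n * g y = f x * (g y * zonal_arg y x ^ n)" for y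
      by (simp add: zonal_arg_commute[of x y])
    then show ?thesis by (simp only: integral_mult_right_zero)
  qed
  ultimately show ?thesis by simp
qed

text \<open>Both harmonics are eigenfunctions of the symmetric kernel \<open>zonal_arg x y ^ n\<close>. For \<open>n\<close> the
  smaller degree, one eigenvalue is positive and the other is zero.\<close>

lemma spherical_harmonics_orthogonal:
  assumes f: "f \<in> spherical_harmonics l" and g: "g \<in> spherical_harmonics m" and "l \<noteq> m"
  shows "(LINT x|sphere_measure. f x * g x) = 0"
proof -
  have eq: "funk_hecke n l * (LINT x|sphere_measure. f x * g x) = funk_hecke n m * (LINT x|sphere_measure. f x * g x)" for n
  proof -
    have "(LINT y|sphere_measure. (LINT x|sphere_measure. f x * zonal_arg x y ^ n) * g y) =
       (LINT y|sphere_measure. funk_hecke n l * (f y * g y))"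
      by (rule Bochner_Integration.integral_cong) (simp_all add: funk_hecke_power[OF f])
    moreover have "(LINT x|sphere_measure. f x * (LINT y|sphere_measure. g y * zonal_arg y x ^ n)) =
       (LINT y|sphere_measure. funk_hecke n m * (f y * g y))"
      by (rule Bochner_Integration.integral_cong) (simp_all add: funk_hecke_power[OF g])
    ultimately show ?thesis
      using zonal_double_integral_swap[OF spherical_harmonic_continuous[OF f] spherical_harmonic_continuous[OF g], of n]
      by (simp only: integral_mult_right_zero)
  qed
  have "funk_hecke (min l m) l \<noteq> funk_hecke (min l m) m"
    using \<open>l \<noteq> m\<close> funk_hecke_eq_0[of "min l m" l] funk_hecke_eq_0[of "min l m" m]
      funk_hecke_pos[of l "min l m"] funk_hecke_pos[of m "min l m"]
    by (cases "l < m") auto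
  with eq[of "min l m"] show ?thesis by simp
qed

locale harmonic_bases =
  fixes Y :: "nat \<Rightarrow> nat \<Rightarrow> real^3 \<Rightarrow> real"
  assumes onb: "\<And>l. harmonic_onb l (Y l)"
begin

lemma Y_harmonic: "k \<in> {1..2*l+1} \<Longrightarrow> Y l k \<in> spherical_harmonics l"
  using onb[of l] by (simp add: harmonic_onb_def)

lemma Y_continuous: "k \<in> {1..2*l+1} \<Longrightarrow> continuous_on S2 (Y l k)"
  using Y_harmonic spherical_harmonic_continuous by blast

lemma Y_orthonormal:
  "j \<in> {1..2*l+1} \<Longrightarrow> k \<in> {1..2*l+1} \<Longrightarrow> (LINT x|sphere_measure. Y l j x * Y l k x) = (if j = k then 1 else 0)"
  using onb[of l] by (simp add: harmonic_onb_def)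

lemma Y_orthonormal2:
  "j \<in> {1..2*l+1} \<Longrightarrow> k \<in> {1..2*m+1} \<Longrightarrow>
    (LINT x|sphere_measure. Y l j x * Y m k x) = (if l = m \<and> j = k then 1 else 0)"
  using Y_orthonormal[of j l k] spherical_harmonics_orthogonal[OF Y_harmonic[of j l] Y_harmonic[of k m]]
  by (cases "l = m") auto

definition addition_const :: "nat \<Rightarrow> real" where
  "addition_const l = zonal_coeff l l * funk_hecke l l"

lemma addition_const_nonzero: "addition_const l \<noteq> 0"
  using zonal_coeff_nonzero[of l l] funk_hecke_pos[of l l] by (simp add: addition_const_def)

text \<open>The zonal polynomial is itself a harmonic of degree \<open>l\<close>, hence a combination of the basis, and the
  Funk-Hecke formula gives its coefficients. Only the leading power contributes, since powers below
  \<open>l\<close> are orthogonal to harmonics of degree \<open>l\<close>.\<close>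

theorem addition_theorem:
  assumes x: "x \<in> S2" and y: "y \<in> S2"
  shows "poly (zonal_poly l) (zonal_arg x y) = addition_const l * (\<Sum>k=1..2*l+1. Y l k x * Y l k y)"
proof -
  obtain c where c: "\<And>x. x \<in> S2 \<Longrightarrow> poly (zonal_poly l) (zonal_arg x y) = (\<Sum>k=1..2*l+1. c k * Y l k x)"
  proof -
    have "\<forall>f\<in>spherical_harmonics l. \<exists>c. \<forall>x\<in>S2. f x = (\<Sum>k=1..2*l+1. c k * Y l k x)"
      using onb[of l] unfolding harmonic_onb_def by blast
    from bspec[OF this zonal_poly_harmonic[OF y]] that show ?thesis by blast
  qed
  have "c j = addition_const l * Y l j y" if j: "j \<in> {1..2*l+1}" for j
  proof -
    have "(LINT x|sphere_measure. Y l j x * poly (zonal_poly l) (zonal_arg x y)) =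
        (LINT x|sphere_measure. (\<Sum>k=1..2*l+1. c k * (Y l j x * Y l k x)))"
    proof (rule Bochner_Integration.integral_cong[OF refl])
      fix x assume "x \<in> space sphere_measure"
      then have x: "x \<in> S2" by simp
      show "Y l j x * poly (zonal_poly l) (zonal_arg x y) = (\<Sum>k=1..2*l+1. c k * (Y l j x * Y l k x))"
        unfolding c[OF x] sum_distrib_left by (intro sum.cong refl) (simp only: mult_ac)
    qed
    also have "\<dots> = (\<Sum>k=1..2*l+1. c k * (LINT x|sphere_measure. Y l j x * Y l k x))"
      by (subst Bochner_Integration.integral_sum)
         (auto intro!: continuous_on_S2_integrable continuous_intros Y_continuous simp: j[simplified])
    also have "\<dots> = (\<Sum>k=1..2*l+1. if k = j then c k else 0)"
      by (rule sum.cong[OF refl]) (subst Y_orthonormal[OF j], auto)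
    also have "\<dots> = c j" using j by (subst sum.delta) auto
    finally have "c j = (LINT x|sphere_measure. Y l j x * poly (zonal_poly l) (zonal_arg x y))" by simp
    also have "\<dots> = (\<Sum>i\<le>l. zonal_coeff l i * funk_hecke i l) * Y l j y"
      by (simp add: funk_hecke_poly[OF Y_harmonic[OF j] y] degree_zonal_poly coeff_zonal_poly)
    also have "(\<Sum>i\<le>l. zonal_coeff l i * funk_hecke i l) = addition_const l"
      unfolding addition_const_def lessThan_Suc_atMost[symmetric] sum.lessThan_Suc by (simp add: funk_hecke_eq_0)
    finally show ?thesis .
  qed
  then have "(\<Sum>k=1..2*l+1. c k * Y l k x) = (\<Sum>k=1..2*l+1. addition_const l * (Y l k x * Y l k y))"
    by (intro sum.cong refl) (simp only: mult_ac)
  then show ?thesis unfolding c[OF x] sum_distrib_left .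
qed

text \<open>On the diagonal the addition theorem makes the sum constant, so it equals its mean, which counts
  the basis functions.\<close>

lemma sum_Y_squares:
  assumes x: "x \<in> S2"
  shows "(\<Sum>k=1..2*l+1. (Y l k x)\<^sup>2) = 2 * real l + 1"
proof -
  define K where "K = poly (zonal_poly l) 1 / addition_const l"
  have K: "(\<Sum>k=1..2*l+1. (Y l k z)\<^sup>2) = K" if "z \<in> S2" for z
    using addition_theorem[OF that that, of l] addition_const_nonzero[of l] zonal_arg_eq_1[OF that that]
    by (simp add: K_def power2_eq_square)
  have "K = (LINT z|sphere_measure. K)" using sphere.prob_space by simp
  also have "\<dots> = (LINT z|sphere_measure. (\<Sum>k=1..2*l+1. (Y l k z)\<^sup>2))"
    by (rule Bochner_Integration.integral_cong) (simp_all only: K sphere_measure_space)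
  also have "\<dots> = (\<Sum>k=1..2*l+1. LINT z|sphere_measure. Y l k z * Y l k z)"
    unfolding power2_eq_square
    by (rule Bochner_Integration.integral_sum) (intro continuous_on_S2_integrable continuous_intros Y_continuous)
  also have "\<dots> = (\<Sum>k=1..2*l+1. 1)"
    by (rule sum.cong[OF refl]) (subst Y_orthonormal, auto)
  finally show ?thesis using K[OF x] by simp
qed

text \<open>The powers of the zonal argument are combinations of zonal polynomials, which the addition theorem
  splits into products of harmonics.\<close>

lemma zonal_convolution_expansion:
  assumes f: "continuous_on S2 f"
  shows "\<exists>b. \<forall>y\<in>S2. (real n + 1) * (LINT x|sphere_measure. f x * zonal_arg x y ^ n) =
    (\<Sum>l\<le>n. b l * (\<Sum>k=1..2*l+1. fcoeff Y f l k * Y l k y))"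
proof -
  have "degree (monom (1::real) n) \<le> n" by (rule degree_monom_le)
  from zonal_poly_span[OF this] obtain q where q: "monom 1 n = (\<Sum>l\<le>n. smult (q l) (zonal_poly l))" by blast
  have w: "zonal_arg x y ^ n = (\<Sum>l\<le>n. q l * addition_const l * (\<Sum>k=1..2*l+1. Y l k x * Y l k y))"
    if "x \<in> S2" "y \<in> S2" for x y
  proof -
    have "zonal_arg x y ^ n = poly (monom 1 n) (zonal_arg x y)" by (simp add: poly_monom)
    also have "\<dots> = (\<Sum>l\<le>n. q l * poly (zonal_poly l) (zonal_arg x y))" unfolding q by (simp add: poly_sum)
    finally show ?thesis by (simp add: addition_theorem[OF that] mult.assoc)
  qed
  show ?thesis
  proof (intro exI[of _ "\<lambda>l. (real n + 1) * (q l * addition_const l)"] ballI)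
    fix y assume y: "y \<in> S2"
    have "(LINT x|sphere_measure. f x * zonal_arg x y ^ n) =
       (LINT x|sphere_measure. (\<Sum>l\<le>n. (\<Sum>k=1..2*l+1. (q l * addition_const l * Y l k y) * (f x * Y l k x))))"
    proof (rule Bochner_Integration.integral_cong[OF refl])
      fix x assume "x \<in> space sphere_measure"
      then have x: "x \<in> S2" by simp
      show "f x * zonal_arg x y ^ n = (\<Sum>l\<le>n. (\<Sum>k=1..2*l+1. (q l * addition_const l * Y l k y) * (f x * Y l k x)))"
        unfolding w[OF x y] sum_distrib_left by (intro sum.cong refl) (simp only: mult_ac)
    qed
    also have "\<dots> = (\<Sum>l\<le>n. (LINT x|sphere_measure. (\<Sum>k=1..2*l+1. (q l * addition_const l * Y l k y) * (f x * Y l k x))))"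
      by (rule Bochner_Integration.integral_sum)
         (intro continuous_on_S2_integrable continuous_intros Y_continuous f)
    also have "\<dots> = (\<Sum>l\<le>n. (\<Sum>k=1..2*l+1. (q l * addition_const l * Y l k y) * fcoeff Y f l k))"
      unfolding fcoeff_def
      by (rule sum.cong[OF refl], subst Bochner_Integration.integral_sum)
         (auto intro!: continuous_on_S2_integrable continuous_intros Y_continuous f simp del: sum.cl_ivl_Suc)
    finally have e: "(LINT x|sphere_measure. f x * zonal_arg x y ^ n) =
      (\<Sum>l\<le>n. (\<Sum>k=1..2*l+1. (q l * addition_const l * Y l k y) * fcoeff Y f l k))" .
    show "(real n + 1) * (LINT x|sphere_measure. f x * zonal_arg x y ^ n) =
      (\<Sum>l\<le>n. (real n + 1) * (q l * addition_const l) * (\<Sum>k=1..2*l+1. fcoeff Y f l k * Y l k y))"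
      by (simp only: e sum_distrib_left mult_ac)
  qed
qed

text \<open>The approximants are the expanded convolutions of \<open>f\<close>; their coefficients are multiples of those
  of \<open>f\<close>, which also gives completeness.\<close>

theorem harmonics_dense:
  assumes f: "continuous_on S2 f" and eps: "eps > 0"
  shows "\<exists>n b. \<forall>y\<in>S2. \<bar>(\<Sum>l\<le>n. b l * (\<Sum>k=1..2*l+1. fcoeff Y f l k * Y l k y)) - f y\<bar> < eps"
proof -
  obtain n where n: "\<And>y. y \<in> S2 \<Longrightarrow> \<bar>(real n + 1) * (LINT x|sphere_measure. f x * zonal_arg x y ^ n) - f y\<bar> < eps"
    using zonal_approximate_identity[OF f eps] by blast
  obtain b where b: "\<And>y. y \<in> S2 \<Longrightarrow> (real n + 1) * (LINT x|sphere_measure. f x * zonal_arg x y ^ n) =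
    (\<Sum>l\<le>n. b l * (\<Sum>k=1..2*l+1. fcoeff Y f l k * Y l k y))"
    using zonal_convolution_expansion[OF f, of n] by blast
  show ?thesis
    by (rule exI[of _ n], rule exI[of _ b], rule ballI) (simp only: b[symmetric] n)
qed

corollary harmonics_complete:
  assumes f: "continuous_on S2 f" and 0: "\<And>l k. k \<in> {1..2*l+1} \<Longrightarrow> fcoeff Y f l k = 0" and x: "x \<in> S2"
  shows "f x = 0"
proof (rule ccontr)
  assume "f x \<noteq> 0"
  then have "\<bar>f x\<bar> > 0" by simp
  from harmonics_dense[OF f this] obtain n b where
    "\<bar>(\<Sum>l\<le>n. b l * (\<Sum>k=1..2*l+1. fcoeff Y f l k * Y l k x)) - f x\<bar> < \<bar>f x\<bar>" using x by blast
  moreover have "(\<Sum>l\<le>n. b l * (\<Sum>k=1..2*l+1. fcoeff Y f l k * Y l k x)) = 0"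
    by (intro sum.neutral ballI) (simp add: 0 del: sum.cl_ivl_Suc)
  ultimately show False by simp
qed

end

section \<open>Logarithmic and dilogarithmic zonal kernels\<close>

text \<open>The power with exponent \<open>p m\<close> has mean \<open>1 / (p m + 1)\<close>, so the series of means converges, and the
  series itself is finite almost everywhere.\<close>

lemma zonal_series_summable:
  assumes y: "y \<in> S2" and b: "\<And>m. b m \<ge> 0" and s: "summable (\<lambda>m. b m / (real (p m) + 1))"
  shows "AE x in sphere_measure. summable (\<lambda>m. b m * zonal_arg x y ^ p m)"
proof -
  have [measurable]: "(\<lambda>x. zonal_arg x y) \<in> borel_measurable sphere_measure"
    by (intro continuous_on_S2_measurable continuous_intros)
  have nn: "AE x in sphere_measure. 0 \<le> b m * zonal_arg x y ^ p m" for m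
    by (rule AE_I2) (use b zonal_arg_bounds[OF _ y] in auto)
  have "(\<integral>\<^sup>+x. (\<Sum>m. ennreal (b m * zonal_arg x y ^ p m)) \<partial>sphere_measure) =
      (\<Sum>m. \<integral>\<^sup>+x. ennreal (b m * zonal_arg x y ^ p m) \<partial>sphere_measure)"
    by (rule nn_integral_suminf) measurable
  also have "\<dots> = (\<Sum>m. ennreal (b m / (real (p m) + 1)))"
  proof (rule suminf_cong)
    fix m
    have "integrable sphere_measure (\<lambda>x. b m * zonal_arg x y ^ p m)"
      by (intro continuous_on_S2_integrable continuous_intros)
    then show "(\<integral>\<^sup>+x. ennreal (b m * zonal_arg x y ^ p m) \<partial>sphere_measure) = ennreal (b m / (real (p m) + 1))"
      by (simp add: nn_integral_eq_integral[OF _ nn] zonal_power_integral[OF y])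
  qed
  also have "\<dots> \<noteq> \<top>" using s b by (simp add: suminf_ennreal2)
  finally have "AE x in sphere_measure. (\<Sum>m. ennreal (b m * zonal_arg x y ^ p m)) \<noteq> \<infinity>"
    by (intro nn_integral_PInf_AE) auto
  then show ?thesis
  proof (rule AE_mp, intro AE_I2 impI)
    fix x assume x: "x \<in> space sphere_measure" and f: "(\<Sum>m. ennreal (b m * zonal_arg x y ^ p m)) \<noteq> \<infinity>"
    show "summable (\<lambda>m. b m * zonal_arg x y ^ p m)"
      by (rule summable_suminf_not_top) (use f b x zonal_arg_bounds[OF _ y] in auto)
  qed
qed

text \<open>A convergent series of means is chosen that diverges at \<open>x = y\<close>, where all its terms are one.\<close>

lemma AE_sphere_neq:
  assumes y: "y \<in> S2" shows "AE x in sphere_measure. x \<noteq> y"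
proof -
  have "summable (\<lambda>m. 1 / (real (m\<^sup>2) + 1))"
  proof (rule summable_comparison_test')
    show "summable (\<lambda>n. inverse ((real n)\<^sup>2))" by (rule inverse_power_summable) simp
    show "norm (1 / (real (n\<^sup>2) + 1)) \<le> inverse ((real n)\<^sup>2)" if "1 \<le> n" for n
      using that by (simp add: inverse_eq_divide frac_le)
  qed
  from zonal_series_summable[OF y _ this] have "AE x in sphere_measure. summable (\<lambda>m. 1 * zonal_arg x y ^ m\<^sup>2)"
    by simp
  then show ?thesis
  proof (rule AE_mp, intro AE_I2 impI notI)
    fix x assume "summable (\<lambda>m. 1 * zonal_arg x y ^ m\<^sup>2)" "x = y"
    then show False using zonal_arg_eq_1[OF y y] by (simp add: summable_const_iff)
  qed
qed

text \<open>The Funk-Hecke formula for power series with nonnegative coefficients, integrated term by term.\<close>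

lemma zonal_series_funk_hecke:
  assumes f: "f \<in> spherical_harmonics l" and y: "y \<in> S2"
    and b: "\<And>m. b m \<ge> 0" and s: "summable (\<lambda>m. b m / (real (p m) + 1))"
  shows "integrable sphere_measure (\<lambda>x. f x * (\<Sum>m. b m * zonal_arg x y ^ p m))"
    and "(\<lambda>m. b m * funk_hecke (p m) l * f y) sums (LINT x|sphere_measure. f x * (\<Sum>m. b m * zonal_arg x y ^ p m))"
proof -
  note cf = spherical_harmonic_continuous[OF f]
  obtain A where A: "A > 0" "\<And>x. x \<in> S2 \<Longrightarrow> \<bar>f x\<bar> \<le> A"
    by (rule continuous_on_S2_bounded[OF cf]) blast
  let ?t = "\<lambda>m x. f x * (b m * zonal_arg x y ^ p m)"
  have i: "integrable sphere_measure (?t m)" for m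
    by (intro continuous_on_S2_integrable continuous_intros cf)
  have bd: "norm (?t m x) \<le> A * (b m * zonal_arg x y ^ p m)" if "x \<in> S2" for m x
    using A(2)[OF that] b[of m] zonal_arg_bounds[OF that y] by (simp add: abs_mult mult_right_mono)
  have ae: "AE x in sphere_measure. summable (\<lambda>m. norm (?t m x))"
    using zonal_series_summable[OF y b s]
  proof (rule AE_mp, intro AE_I2 impI)
    fix x assume x: "x \<in> space sphere_measure" and sx: "summable (\<lambda>m. b m * zonal_arg x y ^ p m)"
    show "summable (\<lambda>m. norm (?t m x))"
      by (rule summable_comparison_test'[OF summable_mult[OF sx, of A], of 0]) (use bd[of x] x in simp)
  qed
  have sn: "summable (\<lambda>m. LINT x|sphere_measure. norm (?t m x))"
  proof (rule summable_comparison_test'[OF summable_mult[OF s, of A], of 0])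
    fix m
    have "(LINT x|sphere_measure. norm (?t m x)) \<le> (LINT x|sphere_measure. A * (b m * zonal_arg x y ^ p m))"
    proof (rule integral_mono)
      show "integrable sphere_measure (\<lambda>x. A * (b m * zonal_arg x y ^ p m))"
        by (intro continuous_on_S2_integrable continuous_intros)
    qed (use i bd in auto)
    then show "norm (LINT x|sphere_measure. norm (?t m x)) \<le> A * (b m / (real (p m) + 1))"
      by (simp add: zonal_power_integral[OF y])
  qed
  have eq: "AE x in sphere_measure. (\<Sum>m. ?t m x) = f x * (\<Sum>m. b m * zonal_arg x y ^ p m)"
    using zonal_series_summable[OF y b s] by (rule AE_mp) (intro AE_I2 impI suminf_mult)
  have [measurable]: "f \<in> borel_measurable sphere_measure" "(\<lambda>x. zonal_arg x y) \<in> borel_measurable sphere_measure"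
    by (intro continuous_on_S2_measurable continuous_intros cf)+
  have I: "integrable sphere_measure (\<lambda>x. \<Sum>m. ?t m x)" by (rule integrable_suminf[OF i ae sn])
  show "integrable sphere_measure (\<lambda>x. f x * (\<Sum>m. b m * zonal_arg x y ^ p m))"
    by (rule integrable_cong_AE_imp[OF I _ eq]) measurable
  have "(\<lambda>m. LINT x|sphere_measure. ?t m x) sums (LINT x|sphere_measure. (\<Sum>m. ?t m x))"
    by (rule sums_integral[OF i ae sn])
  also have "(LINT x|sphere_measure. (\<Sum>m. ?t m x)) = (LINT x|sphere_measure. f x * (\<Sum>m. b m * zonal_arg x y ^ p m))"
    by (rule integral_cong_AE[OF _ _ eq]) measurable
  also have "(\<lambda>m. LINT x|sphere_measure. ?t m x) = (\<lambda>m. b m * funk_hecke (p m) l * f y)"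
  proof
    fix m
    have "(LINT x|sphere_measure. ?t m x) = (LINT x|sphere_measure. b m * (f x * zonal_arg x y ^ p m))"
      by (simp only: mult_ac)
    then show "(LINT x|sphere_measure. ?t m x) = b m * funk_hecke (p m) l * f y"
      by (simp add: funk_hecke_power[OF f y])
  qed
  finally show "(\<lambda>m. b m * funk_hecke (p m) l * f y) sums (LINT x|sphere_measure. f x * (\<Sum>m. b m * zonal_arg x y ^ p m))" .
qed

text \<open>The recurrence for \<open>funk_hecke\<close> says that \<open>eigval l\<close> times the term with index \<open>m\<close> is
  \<open>(m + 1) * funk_hecke m l - m * funk_hecke (m - 1) l\<close>, so the series telescopes.\<close>

lemma funk_hecke_harmonic_sums:
  assumes "l \<ge> 1" shows "(\<lambda>m. 1 / real m * funk_hecke m l) sums (1 / eigval l)"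
proof -
  have ev: "eigval l > 0" using assms by (simp add: eigval_def)
  let ?F = "\<lambda>m. (real m + 1) * funk_hecke m l"
  have "(\<lambda>n. ?F (Suc n) - ?F n) sums (1 - ?F 0)"
    by (rule telescope_sums[OF funk_hecke_asymptotics])
  moreover have "?F 0 = 0" using assms by (simp add: funk_hecke_eq_0)
  moreover have "?F (Suc n) - ?F n = eigval l * (1 / real (Suc n) * funk_hecke (Suc n) l)" for n
    using funk_hecke_recurrence[of n l] by (simp add: field_simps power2_eq_square del: of_nat_Suc) (simp add: algebra_simps)?
  ultimately have "(\<lambda>n. eigval l * (1 / real (Suc n) * funk_hecke (Suc n) l)) sums 1" by simp
  from sums_divide[OF this, of "eigval l"] have "(\<lambda>n. 1 / real (Suc n) * funk_hecke (Suc n) l) sums (1 / eigval l)"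
    using ev by simp
  then show ?thesis using sums_Suc_iff[of "\<lambda>m. 1 / real m * funk_hecke m l" "1 / eigval l"] by simp
qed

lemma summable_inverse_consecutive: "summable (\<lambda>m. 1 / real m / (real m + 1))"
proof (rule summable_comparison_test')
  show "summable (\<lambda>n. inverse ((real n)\<^sup>2))" by (rule inverse_power_summable) simp
  show "norm (1 / real n / (real n + 1)) \<le> inverse ((real n)\<^sup>2)" if "1 \<le> n" for n
    using that by (simp add: inverse_eq_divide power2_eq_square frac_le)
qed

lemma ln_one_minus_series:
  assumes "0 \<le> w" "w < (1::real)" shows "(\<Sum>m. 1 / real m * w ^ m) = - ln (1 - w)"
proof -
  have "(\<lambda>n. - ((- (- w)) ^ n) / of_nat n) sums ln (1 + (- w))"
    by (rule ln_series') (use assms in simp)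
  then have "(\<lambda>n. - (- (w ^ n) / real n)) sums (- ln (1 - w))"
    using sums_minus by fastforce
  then show ?thesis by (simp add: sums_iff)
qed

text \<open>Up to additive and multiplicative constants the logarithmic kernel is the Green function of the
  Laplace-Beltrami operator, and its eigenvalues are the inverse eigenvalues of that operator.\<close>

lemma log_kernel:
  assumes f: "f \<in> spherical_harmonics l" and l: "l \<ge> 1" and y: "y \<in> S2"
  shows "integrable sphere_measure (\<lambda>x. f x * ln (1 - zonal_arg x y))"
    and "(LINT x|sphere_measure. f x * ln (1 - zonal_arg x y)) = - f y / eigval l"
proof -
  let ?K = "\<lambda>x. \<Sum>m. 1 / real m * zonal_arg x y ^ m"
  have [measurable]: "f \<in> borel_measurable sphere_measure" "(\<lambda>x. zonal_arg x y) \<in> borel_measurable sphere_measure"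
    by (intro continuous_on_S2_measurable continuous_intros spherical_harmonic_continuous[OF f])+
  note k = zonal_series_funk_hecke[OF f y, where b="\<lambda>m. 1 / real m" and p="\<lambda>m. m", OF _ summable_inverse_consecutive]
  have eq: "AE x in sphere_measure. - (f x * ?K x) = f x * ln (1 - zonal_arg x y)"
    using AE_sphere_neq[OF y]
  proof (rule AE_mp, intro AE_I2 impI)
    fix x assume "x \<in> space sphere_measure" "x \<noteq> y"
    then have "x \<in> S2" "zonal_arg x y < 1"
      using zonal_arg_eq_1[of x y] zonal_arg_bounds[of x y] y by auto
    then show "- (f x * ?K x) = f x * ln (1 - zonal_arg x y)"
      using ln_one_minus_series[of "zonal_arg x y"] zonal_arg_bounds[of x y] y by simp
  qed
  have i: "integrable sphere_measure (\<lambda>x. - (f x * ?K x))" using k(1) by simp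
  show "integrable sphere_measure (\<lambda>x. f x * ln (1 - zonal_arg x y))"
    by (rule integrable_cong_AE_imp[OF i _ eq]) measurable
  have "(LINT x|sphere_measure. f x * ?K x) = 1 / eigval l * f y"
    using k(2) sums_mult2[OF funk_hecke_harmonic_sums[OF l], of "f y"] sums_unique2 by fastforce
  moreover have "(LINT x|sphere_measure. f x * ln (1 - zonal_arg x y)) = (LINT x|sphere_measure. - (f x * ?K x))"
    by (rule integral_cong_AE[symmetric, OF _ _ eq]) measurable
  ultimately show "(LINT x|sphere_measure. f x * ln (1 - zonal_arg x y)) = - f y / eigval l"
    by simp
qed

text \<open>The dilogarithm. The term with index 0 is zero because \<open>1 / 0 = 0\<close>.\<close>

definition dilog :: "real \<Rightarrow> real" where
  "dilog q = (\<Sum>m. 1 / (real m)\<^sup>2 * q ^ m)"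

lemma summable_inverse_square: "summable (\<lambda>m. 1 / (real m)\<^sup>2)"
  using inverse_power_summable[of 2, where 'a=real] by (simp add: inverse_eq_divide)

section \<open>Complex Gaussian vectors\<close>

definition cgauss :: "complex measure" where
  "cgauss = density lborel (\<lambda>z. ennreal (exp (- (cmod z)\<^sup>2) / pi))"

lemma space_cgauss [simp]: "space cgauss = UNIV" by (simp add: cgauss_def)
lemma sets_cgauss [measurable_cong, simp]: "sets cgauss = sets borel" by (simp add: cgauss_def)

lemma nn_integral_gauss_real:
  assumes "k > 0" shows "(\<integral>\<^sup>+x. ennreal (exp (- k * x\<^sup>2)) \<partial>lborel) = ennreal (sqrt (pi / k))"
proof -
  let ?s = "sqrt (1 / (2 * k))"
  have s: "?s > 0" "?s\<^sup>2 = 1 / (2 * k)" using assms by auto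
  have n: "exp (- k * x\<^sup>2) = sqrt (pi / k) * normal_density 0 ?s x" for x
    using assms by (simp add: normal_density_def s(2) real_sqrt_divide field_simps)
  have "(\<integral>\<^sup>+x. ennreal (exp (- k * x\<^sup>2)) \<partial>lborel) = ennreal (LINT x|lborel. sqrt (pi / k) * normal_density 0 ?s x)"
    unfolding n using assms s(1)
    by (intro nn_integral_eq_integral) (auto intro!: integrable_mult_right integrable_normal_density)
  also have "\<dots> = ennreal (sqrt (pi / k))"
    using integral_normal_density[OF s(1), of 0] by simp
  finally show ?thesis .
qed

lemma nn_integral_gauss_complex:
  assumes "k > 0" shows "(\<integral>\<^sup>+z. ennreal (exp (- k * (cmod z)\<^sup>2)) \<partial>lborel) = ennreal (pi / k)"
proof -
  have "(\<integral>\<^sup>+z. (\<Prod>b\<in>Basis. ennreal (exp (- k * (z \<bullet> b)\<^sup>2))) \<partial>(lborel :: complex measure)) =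
      (\<Prod>b\<in>(Basis::complex set). (\<integral>\<^sup>+x. ennreal (exp (- k * x\<^sup>2)) \<partial>lborel))"
    by (rule nn_integral_lborel_prod) auto
  also have "\<dots> = ennreal (sqrt (pi / k)) * ennreal (sqrt (pi / k))"
    unfolding nn_integral_gauss_real[OF assms] by (simp add: Basis_complex_def complex_eq_iff)
  also have "\<dots> = ennreal (pi / k)" using assms by (simp add: ennreal_mult[symmetric])
  also have "(\<lambda>z::complex. \<Prod>b\<in>Basis. ennreal (exp (- k * (z \<bullet> b)\<^sup>2))) = (\<lambda>z. ennreal (exp (- k * (cmod z)\<^sup>2)))"
    by (auto simp: fun_eq_iff Basis_complex_def complex_eq_iff ennreal_mult[symmetric] cmod_power2
        exp_add[symmetric] algebra_simps)
  finally show ?thesis .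
qed

interpretation cgauss: prob_space cgauss
proof
  have "emeasure cgauss (space cgauss) = (\<integral>\<^sup>+z. ennreal (1 / pi) * ennreal (exp (- 1 * (cmod z)\<^sup>2)) \<partial>lborel)"
    by (simp add: cgauss_def emeasure_density ennreal_mult[symmetric])
  also have "\<dots> = 1"
    by (subst nn_integral_cmult, simp, subst nn_integral_gauss_complex) (simp_all add: ennreal_mult[symmetric])
  finally show "emeasure cgauss (space cgauss) = 1" .
qed

lemma nn_integral_cgauss:
  assumes [measurable]: "f \<in> borel_measurable borel"
  shows "(\<integral>\<^sup>+z. f z \<partial>cgauss) = (\<integral>\<^sup>+z. ennreal (exp (- (cmod z)\<^sup>2) / pi) * f z \<partial>lborel)"
  unfolding cgauss_def by (rule nn_integral_density) auto

lemma nn_integral_cgauss_exp: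
  assumes "k > -1" shows "(\<integral>\<^sup>+z. ennreal (exp (- k * (cmod z)\<^sup>2)) \<partial>cgauss) = ennreal (1 / (1 + k))"
proof -
  have "(\<integral>\<^sup>+z. ennreal (exp (- k * (cmod z)\<^sup>2)) \<partial>cgauss) =
      (\<integral>\<^sup>+z. ennreal (1 / pi) * ennreal (exp (- (1 + k) * (cmod z)\<^sup>2)) \<partial>lborel)"
    by (subst nn_integral_cgauss)
       (auto simp: ennreal_mult[symmetric] exp_add[symmetric] algebra_simps intro!: nn_integral_cong)
  also have "\<dots> = ennreal (1 / (1 + k))"
    using assms
    by (subst nn_integral_cmult, simp, subst nn_integral_gauss_complex) (simp_all add: ennreal_mult[symmetric])
  finally show ?thesis .
qed

lemma nn_integral_lborel_shift:
  assumes [measurable]: "f \<in> borel_measurable borel"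
  shows "(\<integral>\<^sup>+x. f (x + c) \<partial>lborel) = (\<integral>\<^sup>+x. f x \<partial>(lborel :: 'a::euclidean_space measure))"
  by (subst (2) lborel_distr_plus[of c, symmetric]) (simp add: nn_integral_distr add.commute)

text \<open>A unitary matrix of determinant one with nonzero off-diagonal entry is a product of three
  shears, and a shear preserves Lebesgue measure by translation invariance in one variable.\<close>

lemma nn_integral_unitary:
  fixes F :: "complex \<Rightarrow> complex \<Rightarrow> ennreal"
  assumes F: "case_prod F \<in> borel_measurable borel" and uv: "(cmod u)\<^sup>2 + (cmod v)\<^sup>2 = 1" "v \<noteq> 0"
  shows "(\<integral>\<^sup>+x. \<integral>\<^sup>+z. F (u * x + v * z) (- cnj v * x + cnj u * z) \<partial>lborel \<partial>lborel) =
         (\<integral>\<^sup>+x. \<integral>\<^sup>+z. F x z \<partial>lborel \<partial>lborel)"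
proof -
  have upper: "(\<integral>\<^sup>+x. \<integral>\<^sup>+z. H (x + p * z) z \<partial>lborel \<partial>lborel) = (\<integral>\<^sup>+x. \<integral>\<^sup>+z. H x z \<partial>lborel \<partial>lborel)"
    if H: "case_prod H \<in> borel_measurable borel" for H :: "complex \<Rightarrow> complex \<Rightarrow> ennreal" and p
  proof -
    have [measurable]: "case_prod H \<in> borel_measurable (borel \<Otimes>\<^sub>M borel)" using H by (simp add: borel_prod)
    have "(\<integral>\<^sup>+x. \<integral>\<^sup>+z. H (x + p * z) z \<partial>lborel \<partial>lborel) = (\<integral>\<^sup>+z. \<integral>\<^sup>+x. H (x + p * z) z \<partial>lborel \<partial>lborel)"
      by (rule lborel_pair.Fubini'[symmetric]) measurable
    also have "\<dots> = (\<integral>\<^sup>+z. \<integral>\<^sup>+x. H x z \<partial>lborel \<partial>lborel)"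
    proof (rule nn_integral_cong)
      fix z :: complex
      have "(\<lambda>x. H x z) \<in> borel_measurable borel" by measurable
      then show "(\<integral>\<^sup>+x. H (x + p * z) z \<partial>lborel) = (\<integral>\<^sup>+x. H x z \<partial>lborel)"
        by (rule nn_integral_lborel_shift)
    qed
    also have "\<dots> = (\<integral>\<^sup>+x. \<integral>\<^sup>+z. H x z \<partial>lborel \<partial>lborel)"
      by (rule lborel_pair.Fubini') measurable
    finally show ?thesis .
  qed
  have lower: "(\<integral>\<^sup>+x. \<integral>\<^sup>+z. H x (z + r * x) \<partial>lborel \<partial>lborel) = (\<integral>\<^sup>+x. \<integral>\<^sup>+z. H x z \<partial>lborel \<partial>lborel)"
    if H: "case_prod H \<in> borel_measurable borel" for H :: "complex \<Rightarrow> complex \<Rightarrow> ennreal" and r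
  proof (rule nn_integral_cong)
    fix x :: complex
    have [measurable]: "case_prod H \<in> borel_measurable (borel \<Otimes>\<^sub>M borel)" using H by (simp add: borel_prod)
    have "(\<lambda>z. H x z) \<in> borel_measurable borel" by measurable
    then show "(\<integral>\<^sup>+z. H x (z + r * x) \<partial>lborel) = (\<integral>\<^sup>+z. H x z \<partial>lborel)"
      by (rule nn_integral_lborel_shift)
  qed
  have [measurable]: "case_prod F \<in> borel_measurable (borel \<Otimes>\<^sub>M borel)" using F by (simp add: borel_prod)
  define r where "r = - cnj v"
  define p where "p = (u - 1) / r"
  define q where "q = (cnj u - 1) / r"
  have r0: "r \<noteq> 0" using uv by (simp add: r_def)
  define F1 where "F1 x z = F (x + p * z) z" for x z
  define F2 where "F2 x z = F1 x (z + r * x)" for x z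
  have m1: "case_prod F1 \<in> borel_measurable borel" unfolding F1_def borel_prod[symmetric] by measurable
  then have [measurable]: "case_prod F1 \<in> borel_measurable (borel \<Otimes>\<^sub>M borel)" by (simp add: borel_prod)
  have m2: "case_prod F2 \<in> borel_measurable borel" unfolding F2_def borel_prod[symmetric] by measurable
  have uv': "u * cnj u + v * cnj v = 1"
    using uv(1) by (simp only: complex_norm_square[symmetric] of_real_add[symmetric]) simp
  have pr: "1 + p * r = u" "1 + r * q = cnj u" using r0 by (simp_all add: p_def q_def)
  have vv: "u * q + p = v"
  proof -
    have "(u * q + p) * r = u * (cnj u - 1) + (u - 1)" using r0 by (simp add: p_def q_def field_simps)
    also have "\<dots> = v * r" using uv' by (simp add: r_def algebra_simps eq_diff_eq)
    finally show ?thesis using r0 by simp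
  qed
  have "F (u * x + v * z) (- cnj v * x + cnj u * z) = F2 (x + q * z) z" for x z
  proof -
    have a: "z + r * (x + q * z) = - cnj v * x + cnj u * z"
      using pr(2) by (simp add: r_def[symmetric] algebra_simps flip: pr(2))
    have "x + q * z + p * (z + r * (x + q * z)) = (1 + p * r) * x + ((1 + p * r) * q + p) * z"
      by (simp add: algebra_simps)
    also have "\<dots> = u * x + v * z" by (simp only: pr(1) vv)
    finally show ?thesis by (simp only: F2_def F1_def a)
  qed
  then have "(\<integral>\<^sup>+x. \<integral>\<^sup>+z. F (u * x + v * z) (- cnj v * x + cnj u * z) \<partial>lborel \<partial>lborel) =
      (\<integral>\<^sup>+x. \<integral>\<^sup>+z. F2 (x + q * z) z \<partial>lborel \<partial>lborel)" by simp
  also have "\<dots> = (\<integral>\<^sup>+x. \<integral>\<^sup>+z. F2 x z \<partial>lborel \<partial>lborel)" by (rule upper[OF m2])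
  also have "\<dots> = (\<integral>\<^sup>+x. \<integral>\<^sup>+z. F1 x z \<partial>lborel \<partial>lborel)" unfolding F2_def by (rule lower[OF m1])
  also have "\<dots> = (\<integral>\<^sup>+x. \<integral>\<^sup>+z. F x z \<partial>lborel \<partial>lborel)" unfolding F1_def by (rule upper[OF F])
  finally show ?thesis .
qed

lemma nn_integral_cgauss_pair:
  assumes "case_prod F \<in> borel_measurable borel"
  shows "(\<integral>\<^sup>+x. \<integral>\<^sup>+z. F x z \<partial>cgauss \<partial>cgauss) =
    (\<integral>\<^sup>+x. \<integral>\<^sup>+z. ennreal (exp (- ((cmod x)\<^sup>2 + (cmod z)\<^sup>2)) / pi\<^sup>2) * F x z \<partial>lborel \<partial>lborel)"
proof -
  have [measurable]: "case_prod F \<in> borel_measurable (borel \<Otimes>\<^sub>M borel)" using assms by (simp add: borel_prod)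
  have e: "ennreal (exp (- (cmod x)\<^sup>2) / pi) * ennreal (exp (- (cmod z)\<^sup>2) / pi) = ennreal (exp (- ((cmod x)\<^sup>2 + (cmod z)\<^sup>2)) / pi\<^sup>2)" for x z
    by (simp add: ennreal_mult[symmetric] exp_add[symmetric] power2_eq_square)
  have "(\<integral>\<^sup>+x. \<integral>\<^sup>+z. F x z \<partial>cgauss \<partial>cgauss) = (\<integral>\<^sup>+x. ennreal (exp (- (cmod x)\<^sup>2) / pi) * (\<integral>\<^sup>+z. F x z \<partial>cgauss) \<partial>lborel)"
    by (rule nn_integral_cgauss) measurable
  also have "\<dots> = (\<integral>\<^sup>+x. \<integral>\<^sup>+z. ennreal (exp (- (cmod x)\<^sup>2) / pi) * (ennreal (exp (- (cmod z)\<^sup>2) / pi) * F x z) \<partial>lborel \<partial>lborel)"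
    by (subst nn_integral_cgauss, measurable, subst nn_integral_cmult[symmetric], measurable)
  finally show ?thesis by (simp only: mult.assoc[symmetric] e)
qed

lemma cmod_unitary:
  "(cmod (p * x + q * z))\<^sup>2 + (cmod (- cnj q * x + cnj p * z))\<^sup>2 =
    ((cmod p)\<^sup>2 + (cmod q)\<^sup>2) * ((cmod x)\<^sup>2 + (cmod z)\<^sup>2)"
  unfolding cmod_power2 by (simp add: power2_eq_square algebra_simps)

lemma nn_integral_cgauss_unitary:
  fixes F :: "complex \<Rightarrow> complex \<Rightarrow> ennreal"
  assumes F: "case_prod F \<in> borel_measurable borel" and uv: "(cmod u)\<^sup>2 + (cmod v)\<^sup>2 = 1" "v \<noteq> 0"
  shows "(\<integral>\<^sup>+x. \<integral>\<^sup>+z. F (u * x + v * z) (- cnj v * x + cnj u * z) \<partial>cgauss \<partial>cgauss) =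
         (\<integral>\<^sup>+x. \<integral>\<^sup>+z. F x z \<partial>cgauss \<partial>cgauss)"
proof -
  have [measurable]: "case_prod F \<in> borel_measurable (borel \<Otimes>\<^sub>M borel)" using F by (simp add: borel_prod)
  have iso: "(cmod (u * x + v * z))\<^sup>2 + (cmod (- cnj v * x + cnj u * z))\<^sup>2 = (cmod x)\<^sup>2 + (cmod z)\<^sup>2" for x z
    using cmod_unitary[of u x v z] uv by simp
  let ?H = "\<lambda>x z. ennreal (exp (- ((cmod x)\<^sup>2 + (cmod z)\<^sup>2)) / pi\<^sup>2) * F x z"
  have m: "case_prod (\<lambda>x z. F (u * x + v * z) (- cnj v * x + cnj u * z)) \<in> borel_measurable borel"
    unfolding borel_prod[symmetric] by measurable
  have mH: "case_prod ?H \<in> borel_measurable borel"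
    unfolding borel_prod[symmetric] by measurable
  show ?thesis
    unfolding nn_integral_cgauss_pair[OF m] nn_integral_cgauss_pair[OF F]
    using nn_integral_unitary[OF mH uv] unfolding iso .
qed

text \<open>The unitary matrix whose first row is proportional to the coefficients of the first form turns that
  form into a multiple of one coordinate. The remaining coefficients are tied to the original ones by
  the Gram matrix of the two forms, which is unchanged.\<close>

lemma cgauss_pair_reduction:
  fixes a c b d :: complex
  shows "\<exists>a' b' e. (cmod a')\<^sup>2 = (cmod a)\<^sup>2 + (cmod c)\<^sup>2 \<and> (cmod b')\<^sup>2 + (cmod e)\<^sup>2 = (cmod b)\<^sup>2 + (cmod d)\<^sup>2 \<and>
     a' * cnj b' = a * cnj b + c * cnj d \<and>
     (\<forall>F :: complex \<Rightarrow> complex \<Rightarrow> ennreal. case_prod F \<in> borel_measurable borel \<longrightarrow>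
       (\<integral>\<^sup>+x. \<integral>\<^sup>+z. F (a * x + c * z) (b * x + d * z) \<partial>cgauss \<partial>cgauss) =
       (\<integral>\<^sup>+x. \<integral>\<^sup>+z. F (a' * x) (b' * x + e * z) \<partial>cgauss \<partial>cgauss))"
proof (cases "c = 0")
  case True
  then show ?thesis by (intro exI[of _ a] exI[of _ b] exI[of _ d]) simp
next
  case False
  define n where "n = sqrt ((cmod a)\<^sup>2 + (cmod c)\<^sup>2)"
  have n2: "n\<^sup>2 = (cmod a)\<^sup>2 + (cmod c)\<^sup>2" by (simp add: n_def)
  have n: "n > 0" using False by (simp add: n_def add_nonneg_pos)
  define u where "u = cnj a / of_real n"
  define v where "v = - c / of_real n"
  have uv: "(cmod u)\<^sup>2 + (cmod v)\<^sup>2 = 1" "v \<noteq> 0"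
    using n False by (simp_all add: u_def v_def norm_divide power_divide add_divide_distrib[symmetric] n2[symmetric])
  define b' where "b' = b * u - d * cnj v"
  define e where "e = b * v + d * cnj u"
  have n2c: "complex_of_real n * complex_of_real n = a * cnj a + c * cnj c"
    using n2 by (simp only: complex_norm_square[symmetric] of_real_add[symmetric] of_real_mult[symmetric] power2_eq_square)
  have nc: "complex_of_real n \<noteq> 0" using n by simp
  have 1: "a * u - c * cnj v = of_real n"
    using nc n2c by (simp add: u_def v_def add_divide_distrib[symmetric] divide_eq_eq)
  have 2: "a * v + c * cnj u = 0" using nc by (simp add: u_def v_def field_simps)
  have nb: "(cmod b')\<^sup>2 + (cmod e)\<^sup>2 = (cmod b)\<^sup>2 + (cmod d)\<^sup>2"
    using cmod_unitary[of u b "- cnj v" d] uv by (simp add: b'_def e_def mult.commute)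
  have ip: "of_real n * cnj b' = a * cnj b + c * cnj d"
    using nc by (simp add: b'_def u_def v_def field_simps)
  have "(\<integral>\<^sup>+x. \<integral>\<^sup>+z. F (a * x + c * z) (b * x + d * z) \<partial>cgauss \<partial>cgauss) =
       (\<integral>\<^sup>+x. \<integral>\<^sup>+z. F (of_real n * x) (b' * x + e * z) \<partial>cgauss \<partial>cgauss)"
    if F: "case_prod F \<in> borel_measurable borel" for F :: "complex \<Rightarrow> complex \<Rightarrow> ennreal"
  proof -
    have [measurable]: "case_prod F \<in> borel_measurable (borel \<Otimes>\<^sub>M borel)" using F by (simp add: borel_prod)
    have m: "case_prod (\<lambda>x z. F (a * x + c * z) (b * x + d * z)) \<in> borel_measurable borel"
      unfolding borel_prod[symmetric] by measurable
    have "a * (u * x + v * z) + c * (- cnj v * x + cnj u * z) = of_real n * x"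
      "b * (u * x + v * z) + d * (- cnj v * x + cnj u * z) = b' * x + e * z" for x z
    proof -
      have "a * (u * x + v * z) + c * (- cnj v * x + cnj u * z) = (a * u - c * cnj v) * x + (a * v + c * cnj u) * z"
        by (simp add: algebra_simps)
      then show "a * (u * x + v * z) + c * (- cnj v * x + cnj u * z) = of_real n * x" by (simp only: 1 2) simp
      show "b * (u * x + v * z) + d * (- cnj v * x + cnj u * z) = b' * x + e * z"
        by (simp add: b'_def e_def algebra_simps)
    qed
    then show ?thesis using nn_integral_cgauss_unitary[OF m uv] by simp
  qed
  then show ?thesis using n2 nb ip n
    by (intro exI[of _ "of_real n"] exI[of _ b'] exI[of _ e]) simp
qed

interpretation cgauss_product: product_prob_space "\<lambda>_::nat. cgauss" UNIV ..

interpretation cgauss_pair: pair_prob_space cgauss cgauss ..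

text \<open>The joint law of two linear forms in independent Gaussians depends only on their Gram matrix.
  Each new variable is absorbed by two unitary rotations: the first rotates it against the variable
  that carries the first form, and the second rotates the leftover against the other variable.\<close>

lemma cgauss_linear_forms_nn:
  fixes c d :: "nat \<Rightarrow> complex"
  assumes "finite I"
  shows "\<exists>a b e. (cmod a)\<^sup>2 = (\<Sum>i\<in>I. (cmod (c i))\<^sup>2) \<and> (cmod b)\<^sup>2 + (cmod e)\<^sup>2 = (\<Sum>i\<in>I. (cmod (d i))\<^sup>2) \<and>
     a * cnj b = (\<Sum>i\<in>I. c i * cnj (d i)) \<and>
     (\<forall>F :: complex \<Rightarrow> complex \<Rightarrow> ennreal. case_prod F \<in> borel_measurable borel \<longrightarrow>
       (\<integral>\<^sup>+w. F (\<Sum>i\<in>I. c i * w i) (\<Sum>i\<in>I. d i * w i) \<partial>PiM I (\<lambda>_. cgauss)) =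
       (\<integral>\<^sup>+x. \<integral>\<^sup>+z. F (a * x) (b * x + e * z) \<partial>cgauss \<partial>cgauss))"
  using assms
proof (induction I)
  case empty
  show ?case
    by (intro exI[of _ 0]) (simp add: PiM_empty nn_integral_count_space_finite cgauss.emeasure_space_1[simplified])
next
  case (insert i I)
  then obtain a b e where abe: "(cmod a)\<^sup>2 = (\<Sum>i\<in>I. (cmod (c i))\<^sup>2)" "(cmod b)\<^sup>2 + (cmod e)\<^sup>2 = (\<Sum>i\<in>I. (cmod (d i))\<^sup>2)"
     "a * cnj b = (\<Sum>i\<in>I. c i * cnj (d i))"
     and law: "\<And>F :: complex \<Rightarrow> complex \<Rightarrow> ennreal. case_prod F \<in> borel_measurable borel \<Longrightarrow>
       (\<integral>\<^sup>+w. F (\<Sum>i\<in>I. c i * w i) (\<Sum>i\<in>I. d i * w i) \<partial>PiM I (\<lambda>_. cgauss)) =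
       (\<integral>\<^sup>+x. \<integral>\<^sup>+z. F (a * x) (b * x + e * z) \<partial>cgauss \<partial>cgauss)" by blast
  obtain a' b' f where r1: "(cmod a')\<^sup>2 = (cmod a)\<^sup>2 + (cmod (c i))\<^sup>2" "(cmod b')\<^sup>2 + (cmod f)\<^sup>2 = (cmod b)\<^sup>2 + (cmod (d i))\<^sup>2"
     "a' * cnj b' = a * cnj b + c i * cnj (d i)"
     and law1: "\<And>F :: complex \<Rightarrow> complex \<Rightarrow> ennreal. case_prod F \<in> borel_measurable borel \<Longrightarrow>
       (\<integral>\<^sup>+x. \<integral>\<^sup>+z. F (a * x + c i * z) (b * x + d i * z) \<partial>cgauss \<partial>cgauss) =
       (\<integral>\<^sup>+x. \<integral>\<^sup>+z. F (a' * x) (b' * x + f * z) \<partial>cgauss \<partial>cgauss)"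
    using cgauss_pair_reduction[of a "c i" b "d i"] by blast
  obtain e' where r2: "(cmod e')\<^sup>2 = (cmod e)\<^sup>2 + (cmod f)\<^sup>2"
     and law2: "\<And>F :: complex \<Rightarrow> complex \<Rightarrow> ennreal. case_prod F \<in> borel_measurable borel \<Longrightarrow>
       (\<integral>\<^sup>+x. \<integral>\<^sup>+z. F (e * x + f * z) 0 \<partial>cgauss \<partial>cgauss) =
       (\<integral>\<^sup>+x. \<integral>\<^sup>+z. F (e' * x) 0 \<partial>cgauss \<partial>cgauss)"
    using cgauss_pair_reduction[of e f 0 0] by fastforce
  have "(\<integral>\<^sup>+w. F (\<Sum>i\<in>insert i I. c i * w i) (\<Sum>i\<in>insert i I. d i * w i) \<partial>PiM (insert i I) (\<lambda>_. cgauss)) =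
       (\<integral>\<^sup>+x. \<integral>\<^sup>+z. F (a' * x) (b' * x + e' * z) \<partial>cgauss \<partial>cgauss)"
    if F: "case_prod F \<in> borel_measurable borel" for F :: "complex \<Rightarrow> complex \<Rightarrow> ennreal"
  proof -
    have [measurable]: "case_prod F \<in> borel_measurable (borel \<Otimes>\<^sub>M borel)" using F by (simp add: borel_prod)
    have upd: "(\<Sum>j\<in>insert i I. k j * (w(i := y)) j) = (\<Sum>j\<in>I. k j * w j) + k i * y" for k w and y :: complex
    proof -
      have "(\<Sum>j\<in>I. k j * (w(i := y)) j) = (\<Sum>j\<in>I. k j * w j)"
        using insert.hyps by (intro sum.cong) auto
      then show ?thesis using insert.hyps by (simp add: add.commute)
    qed
    have "(\<integral>\<^sup>+w. F (\<Sum>i\<in>insert i I. c i * w i) (\<Sum>i\<in>insert i I. d i * w i) \<partial>PiM (insert i I) (\<lambda>_. cgauss)) =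
        (\<integral>\<^sup>+w. \<integral>\<^sup>+y. F ((\<Sum>j\<in>I. c j * w j) + c i * y) ((\<Sum>j\<in>I. d j * w j) + d i * y) \<partial>cgauss \<partial>PiM I (\<lambda>_. cgauss))"
      by (subst cgauss_product.product_nn_integral_insert) (use insert.hyps in \<open>simp_all only: upd, measurable\<close>)
    also have "\<dots> = (\<integral>\<^sup>+x. \<integral>\<^sup>+z. \<integral>\<^sup>+y. F (a * x + c i * y) (b * x + e * z + d i * y) \<partial>cgauss \<partial>cgauss \<partial>cgauss)"
      by (rule law[of "\<lambda>s t. \<integral>\<^sup>+y. F (s + c i * y) (t + d i * y) \<partial>cgauss"])
         (unfold borel_prod[symmetric], measurable)
    also have "\<dots> = (\<integral>\<^sup>+z. \<integral>\<^sup>+x. \<integral>\<^sup>+y. F (a * x + c i * y) (b * x + e * z + d i * y) \<partial>cgauss \<partial>cgauss \<partial>cgauss)"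
      by (rule cgauss_pair.Fubini'[symmetric]) measurable
    also have "\<dots> = (\<integral>\<^sup>+z. \<integral>\<^sup>+x. \<integral>\<^sup>+y. F (a' * x) (b' * x + f * y + e * z) \<partial>cgauss \<partial>cgauss \<partial>cgauss)"
    proof (rule nn_integral_cong)
      fix z
      have "case_prod (\<lambda>s t. F s (t + e * z)) \<in> borel_measurable borel"
        unfolding borel_prod[symmetric] by measurable
      from law1[OF this]
      show "(\<integral>\<^sup>+x. \<integral>\<^sup>+y. F (a * x + c i * y) (b * x + e * z + d i * y) \<partial>cgauss \<partial>cgauss) =
        (\<integral>\<^sup>+x. \<integral>\<^sup>+y. F (a' * x) (b' * x + f * y + e * z) \<partial>cgauss \<partial>cgauss)"
        by (simp add: ac_simps)
    qed
    also have "\<dots> = (\<integral>\<^sup>+x. \<integral>\<^sup>+z. \<integral>\<^sup>+y. F (a' * x) (b' * x + f * y + e * z) \<partial>cgauss \<partial>cgauss \<partial>cgauss)"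
      by (rule cgauss_pair.Fubini') measurable
    also have "\<dots> = (\<integral>\<^sup>+x. \<integral>\<^sup>+z. \<integral>\<^sup>+y. F (a' * x) (b' * x + e' * z) \<partial>cgauss \<partial>cgauss \<partial>cgauss)"
    proof (rule nn_integral_cong)
      fix x
      have "case_prod (\<lambda>s t::complex. F (a' * x) (b' * x + s)) \<in> borel_measurable borel"
        unfolding borel_prod[symmetric] by measurable
      from law2[OF this]
      show "(\<integral>\<^sup>+z. \<integral>\<^sup>+y. F (a' * x) (b' * x + f * y + e * z) \<partial>cgauss \<partial>cgauss) =
        (\<integral>\<^sup>+z. \<integral>\<^sup>+y. F (a' * x) (b' * x + e' * z) \<partial>cgauss \<partial>cgauss)"
        by (simp add: ac_simps)
    qed
    finally show ?thesis by (simp add: cgauss.emeasure_space_1[simplified])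
  qed
  then show ?case
    using insert.hyps abe r1 r2
    by (intro exI[of _ a'] exI[of _ b'] exI[of _ e']) (auto simp: algebra_simps)
qed

section \<open>Covariance of the logarithms of two correlated Gaussians\<close>

text \<open>Completing the square in \<open>y\<close>.\<close>

lemma cgauss_pair_laplace_inner:
  assumes t: "t \<ge> 0"
  shows "(\<integral>\<^sup>+y. ennreal (exp (- t * (cmod (b + e * y))\<^sup>2)) \<partial>cgauss) =
    ennreal (exp (- (t / (1 + t * (cmod e)\<^sup>2)) * (cmod b)\<^sup>2) / (1 + t * (cmod e)\<^sup>2))"
proof -
  define k where "k = 1 + t * (cmod e)\<^sup>2"
  have k: "k > 0" using t by (simp add: k_def add_pos_nonneg)
  define s where "s = of_real (t / k) * (cnj e * b)"
  have sq: "(cmod y)\<^sup>2 + t * (cmod (b + e * y))\<^sup>2 = k * (cmod (y + s))\<^sup>2 + t / k * (cmod b)\<^sup>2" for y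
  proof -
    have "k * ((cmod y)\<^sup>2 + t * (cmod (b + e * y))\<^sup>2) = k * (k * (cmod (y + s))\<^sup>2 + t / k * (cmod b)\<^sup>2)"
    proof -
      have "k * (k * (cmod (y + s))\<^sup>2) = (cmod (of_real k * y + of_real k * s))\<^sup>2"
        using k by (simp add: distrib_left[symmetric] norm_mult power_mult_distrib power2_eq_square)
      also have "of_real k * s = of_real t * (cnj e * b)" using k by (simp add: s_def)
      finally have 1: "k * (k * (cmod (y + s))\<^sup>2) = (cmod (of_real k * y + of_real t * (cnj e * b)))\<^sup>2" .
      have "k * ((cmod y)\<^sup>2 + t * (cmod (b + e * y))\<^sup>2) =
          (cmod (of_real k * y + of_real t * (cnj e * b)))\<^sup>2 + t * (cmod b)\<^sup>2"
        unfolding k_def cmod_power2 by (simp add: power2_eq_square algebra_simps)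
      then show ?thesis using k by (simp add: distrib_left 1)
    qed
    then show ?thesis using k by simp
  qed
  have "(\<integral>\<^sup>+y. ennreal (exp (- t * (cmod (b + e * y))\<^sup>2)) \<partial>cgauss) =
    (\<integral>\<^sup>+y. ennreal (exp (- (t / k) * (cmod b)\<^sup>2) / pi) * ennreal (exp (- k * (cmod (y + s))\<^sup>2)) \<partial>lborel)"
  proof (subst nn_integral_cgauss, measurable, rule nn_integral_cong)
    fix y
    have "exp (- (cmod y)\<^sup>2) * exp (- t * (cmod (b + e * y))\<^sup>2) =
       exp (- (t / k) * (cmod b)\<^sup>2) * exp (- k * (cmod (y + s))\<^sup>2)"
      using sq[of y] by (simp add: exp_add[symmetric])
    then show "ennreal (exp (- (cmod y)\<^sup>2) / pi) * ennreal (exp (- t * (cmod (b + e * y))\<^sup>2)) =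
      ennreal (exp (- (t / k) * (cmod b)\<^sup>2) / pi) * ennreal (exp (- k * (cmod (y + s))\<^sup>2))"
      by (simp add: ennreal_mult[symmetric])
  qed
  also have "\<dots> = ennreal (exp (- (t / k) * (cmod b)\<^sup>2) / pi) * (\<integral>\<^sup>+y. ennreal (exp (- k * (cmod (y + s))\<^sup>2)) \<partial>lborel)"
    by (rule nn_integral_cmult) simp
  also have "(\<integral>\<^sup>+y. ennreal (exp (- k * (cmod (y + s))\<^sup>2)) \<partial>lborel) = (\<integral>\<^sup>+y. ennreal (exp (- k * (cmod y)\<^sup>2)) \<partial>lborel)"
    by (rule nn_integral_lborel_shift[where f="\<lambda>y. ennreal (exp (- k * (cmod y)\<^sup>2))"]) simp
  also have "\<dots> = ennreal (pi / k)" by (rule nn_integral_gauss_complex[OF k])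
  finally show ?thesis using k by (simp add: ennreal_mult[symmetric] k_def)
qed

lemma cgauss_pair_laplace:
  assumes s: "s \<ge> 0" and t: "t \<ge> 0" and a: "cmod a = 1" and be: "(cmod b)\<^sup>2 + (cmod e)\<^sup>2 = 1"
  shows "(\<integral>\<^sup>+x. \<integral>\<^sup>+y. ennreal (exp (- s * (cmod (a * x))\<^sup>2 - t * (cmod (b * x + e * y))\<^sup>2)) \<partial>cgauss \<partial>cgauss) =
    ennreal (1 / ((1 + s) * (1 + t) - (cmod b)\<^sup>2 * (s * t)))"
proof -
  define k where "k = 1 + t * (cmod e)\<^sup>2"
  have k: "k > 0" using t by (simp add: k_def add_pos_nonneg)
  have "(\<integral>\<^sup>+x. \<integral>\<^sup>+y. ennreal (exp (- s * (cmod (a * x))\<^sup>2 - t * (cmod (b * x + e * y))\<^sup>2)) \<partial>cgauss \<partial>cgauss) =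
      (\<integral>\<^sup>+x. ennreal (exp (- s * (cmod x)\<^sup>2)) * (\<integral>\<^sup>+y. ennreal (exp (- t * (cmod (b * x + e * y))\<^sup>2)) \<partial>cgauss) \<partial>cgauss)"
    by (subst nn_integral_cmult[symmetric])
       (simp_all add: ennreal_mult[symmetric] exp_add[symmetric] norm_mult a)
  also have "\<dots> = (\<integral>\<^sup>+x. ennreal (1 / k) * ennreal (exp (- (s + t / k * (cmod b)\<^sup>2) * (cmod x)\<^sup>2)) \<partial>cgauss)"
    unfolding cgauss_pair_laplace_inner[OF t] k_def[symmetric] using k
    by (simp add: ennreal_mult[symmetric] exp_add[symmetric] norm_mult power_mult_distrib algebra_simps)
  also have "\<dots> = ennreal (1 / k) * (\<integral>\<^sup>+x. ennreal (exp (- (s + t / k * (cmod b)\<^sup>2) * (cmod x)\<^sup>2)) \<partial>cgauss)"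
    by (rule nn_integral_cmult) simp
  also have "\<dots> = ennreal (1 / k) * ennreal (1 / (1 + (s + t / k * (cmod b)\<^sup>2)))"
  proof (subst nn_integral_cgauss_exp)
    have "0 \<le> t / k * (cmod b)\<^sup>2" using t k by simp
    then show "- 1 < s + t / k * (cmod b)\<^sup>2" using s by linarith
  qed simp
  also have "\<dots> = ennreal (1 / (k * (1 + (s + t / k * (cmod b)\<^sup>2))))"
    using k by (simp add: ennreal_mult[symmetric] ennreal_mult'[symmetric])
  also have "k * (1 + (s + t / k * (cmod b)\<^sup>2)) = k * (1 + s) + t * (cmod b)\<^sup>2"
    using k by (simp add: field_simps)
  also have "\<dots> = (1 + s) * (1 + t) - (cmod b)\<^sup>2 * (s * t)"
  proof -
    have e2: "(cmod e)\<^sup>2 = 1 - (cmod b)\<^sup>2" using be by simp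
    show ?thesis unfolding k_def e2 by (simp add: algebra_simps)
  qed
  finally show ?thesis .
qed

text \<open>The integrand of Frullani's representation of \<open>ln u\<close>. It expresses logarithms by exponentials,
  whose joint Gaussian expectations are explicit.\<close>

definition frullani :: "real \<Rightarrow> real \<Rightarrow> real" where
  "frullani u s = (exp (- s) - exp (- (s * u))) / s"

text \<open>A density on the whole line, so that its measurable sets are the Borel sets of the line.\<close>

definition halfline :: "real measure" where
  "halfline = density lborel (indicator {0<..})"

lemma space_halfline [simp]: "space halfline = UNIV" by (simp add: halfline_def)
lemma sets_halfline [measurable_cong, simp]: "sets halfline = sets borel" by (simp add: halfline_def)

interpretation halfline: sigma_finite_measure halfline
  unfolding halfline_def
  by (subst sigma_finite_measure.sigma_finite_iff_density_finite[OF sigma_finite_lborel]) (auto simp: indicator_def)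

interpretation halfline_pair: pair_sigma_finite halfline halfline ..

lemma AE_halfline: "AE s in halfline. s > 0"
  unfolding halfline_def by (subst AE_density) (auto simp: indicator_def)

lemma nn_integral_halfline:
  assumes [measurable]: "f \<in> borel_measurable borel"
  shows "(\<integral>\<^sup>+s. f s \<partial>halfline) = (\<integral>\<^sup>+s. f s * indicator {0<..} s \<partial>lborel)"
  unfolding halfline_def by (subst nn_integral_density) (auto simp: mult.commute)

lemma frullani_measurable [measurable]:
  assumes [measurable]: "f \<in> borel_measurable M" "g \<in> borel_measurable M"
  shows "(\<lambda>x. frullani (f x) (g x)) \<in> borel_measurable M"
  unfolding frullani_def by measurable

text \<open>The difference quotient is the integral of \<open>exp (- (s * v))\<close> over \<open>v\<close> between \<open>a\<close> and \<open>b\<close>; the two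
  integrations are exchanged.\<close>

lemma nn_integral_frullani:
  assumes "0 < a" "a \<le> b"
  shows "(\<integral>\<^sup>+s. ennreal ((exp (- (s * a)) - exp (- (s * b))) / s) \<partial>halfline) = ennreal (ln b - ln a)"
proof -
  have inner: "ennreal ((exp (- (s * a)) - exp (- (s * b))) / s) * indicator {0<..} s =
      (\<integral>\<^sup>+v. ennreal (exp (- (s * v))) * indicator {a..b} v * indicator {0<..} s \<partial>lborel)" for s
  proof (cases "s > 0")
    case True
    have "(\<integral>\<^sup>+v. ennreal (exp (- (s * v))) * indicator {a..b} v \<partial>lborel) =
        ennreal (- exp (- (s * b)) / s - (- exp (- (s * a)) / s))"
      by (rule nn_integral_FTC_Icc)
         (use True assms in \<open>auto intro!: derivative_eq_intros simp: has_real_derivative_iff_has_vector_derivative[symmetric]\<close>)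
    then show ?thesis using True by (simp add: diff_divide_distrib)
  qed simp
  have outer: "(\<integral>\<^sup>+s. ennreal (exp (- (s * v))) * indicator {a..b} v * indicator {0<..} s \<partial>lborel) =
      ennreal (1 / v) * indicator {a..b} v" for v
  proof (cases "v \<in> {a..b}")
    case True
    then have v: "v > 0" using assms by auto
    have "(\<integral>\<^sup>+s. ennreal (exp (- (s * v))) * indicator {0..} s \<partial>lborel) = ennreal (0 - (- exp (- (0 * v)) / v))"
    proof (rule nn_integral_FTC_atLeast)
      show "((\<lambda>s. - exp (- (s * v)) / v) \<longlongrightarrow> 0) at_top" using v by real_asymp
    qed (use v in \<open>auto intro!: derivative_eq_intros\<close>)
    moreover have "(\<integral>\<^sup>+s. ennreal (exp (- (s * v))) * indicator {0<..} s \<partial>lborel) =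
        (\<integral>\<^sup>+s. ennreal (exp (- (s * v))) * indicator {0..} s \<partial>lborel)"
      using AE_lborel_singleton[of "0::real"]
      by (intro nn_integral_cong_AE) (auto elim!: eventually_mono split: split_indicator)
    ultimately show ?thesis using True by simp
  qed simp
  have "(\<integral>\<^sup>+s. ennreal ((exp (- (s * a)) - exp (- (s * b))) / s) \<partial>halfline) =
     (\<integral>\<^sup>+s. \<integral>\<^sup>+v. ennreal (exp (- (s * v))) * indicator {a..b} v * indicator {0<..} s \<partial>lborel \<partial>lborel)"
    by (subst nn_integral_halfline) (simp_all only: inner, measurable)
  also have "\<dots> = (\<integral>\<^sup>+v. \<integral>\<^sup>+s. ennreal (exp (- (s * v))) * indicator {a..b} v * indicator {0<..} s \<partial>lborel \<partial>lborel)"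
    by (rule lborel_pair.Fubini') measurable
  also have "\<dots> = (\<integral>\<^sup>+v. ennreal (1 / v) * indicator {a..b} v \<partial>lborel)" by (simp only: outer)
  also have "\<dots> = ennreal (ln b - ln a)"
    by (rule nn_integral_FTC_Icc)
       (use assms in \<open>auto intro!: derivative_eq_intros simp: has_real_derivative_iff_has_vector_derivative[symmetric]\<close>)
  finally show ?thesis .
qed

lemma frullani_sign:
  assumes "s > 0"
  shows "u \<ge> 1 \<Longrightarrow> frullani u s \<ge> 0" "u \<le> 1 \<Longrightarrow> frullani u s \<le> 0"
  using assms by (auto simp: frullani_def divide_nonpos_pos)

lemma frullani_has_integral:
  assumes u: "u > 0"
  shows "integrable halfline (frullani u)" "(LINT s|halfline. frullani u s) = ln u"
    "(LINT s|halfline. \<bar>frullani u s\<bar>) = \<bar>ln u\<bar>"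
proof -
  have "has_bochner_integral halfline (frullani u) (ln u) \<and> has_bochner_integral halfline (\<lambda>s. \<bar>frullani u s\<bar>) \<bar>ln u\<bar>"
  proof (cases "u \<ge> 1")
    case True
    have nn: "AE s in halfline. 0 \<le> frullani u s"
      using AE_halfline frullani_sign(1)[OF _ True] by (auto elim!: eventually_mono)
    have h: "has_bochner_integral halfline (frullani u) (ln u)"
    proof (rule has_bochner_integral_nn_integral)
      show "(\<integral>\<^sup>+s. ennreal (frullani u s) \<partial>halfline) = ennreal (ln u)"
        using nn_integral_frullani[of 1 u] True by (simp add: frullani_def[abs_def])
    qed (use nn True in auto)
    have h2: "has_bochner_integral halfline (\<lambda>s. \<bar>frullani u s\<bar>) (ln u)"
      by (subst has_bochner_integral_cong_AE[of _ _ "frullani u"])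
         (use h nn in \<open>auto elim!: eventually_mono\<close>)
    show ?thesis using h h2 True by simp
  next
    case False
    then have u1: "u \<le> 1" by simp
    have nn: "AE s in halfline. 0 \<le> - frullani u s"
      using AE_halfline frullani_sign(2)[OF _ u1] by (auto elim!: eventually_mono)
    have h: "has_bochner_integral halfline (\<lambda>s. - frullani u s) (- ln u)"
    proof (rule has_bochner_integral_nn_integral)
      show "(\<integral>\<^sup>+s. ennreal (- frullani u s) \<partial>halfline) = ennreal (- ln u)"
        using nn_integral_frullani[OF u u1] by (simp add: frullani_def[abs_def] minus_divide_left)
    qed (use nn u u1 in auto)
    have h2: "has_bochner_integral halfline (\<lambda>s. \<bar>frullani u s\<bar>) (- ln u)"
      by (subst has_bochner_integral_cong_AE[of _ _ "\<lambda>s. - frullani u s"])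
         (use h nn in \<open>auto elim!: eventually_mono\<close>)
    show ?thesis using has_bochner_integral_minus[OF h] h2 u u1 by simp
  qed
  then show "integrable halfline (frullani u)" "(LINT s|halfline. frullani u s) = ln u"
    "(LINT s|halfline. \<bar>frullani u s\<bar>) = \<bar>ln u\<bar>"
    by (auto simp: has_bochner_integral_iff)
qed

text \<open>A primitive is \<open>(s / (1 + s)) ^ m / m\<close>.\<close>

lemma nn_integral_beta_kernel:
  assumes m: "m \<ge> 1"
  shows "(\<integral>\<^sup>+s. ennreal (s ^ (m - 1) / (1 + s) ^ (m + 1)) \<partial>halfline) = ennreal (1 / real m)"
proof -
  let ?F = "\<lambda>s::real. (s / (1 + s)) ^ m / real m"
  have D: "(?F has_real_derivative s ^ (m - 1) / (1 + s) ^ (m + 1)) (at s)" if "s \<ge> 0" for s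
  proof -
    have "((\<lambda>s::real. s / (1 + s)) has_real_derivative 1 / (1 + s)\<^sup>2) (at s)"
      using that by (auto intro!: derivative_eq_intros simp: power2_eq_square field_simps)
    from DERIV_cdivide[OF DERIV_power[OF this, of m], of "real m"]
    have "(?F has_real_derivative real m * (1 / (1 + s)\<^sup>2 * (s / (1 + s)) ^ (m - 1)) / real m) (at s)"
      by simp
    moreover have "real m * (1 / (1 + s)\<^sup>2 * (s / (1 + s)) ^ (m - 1)) / real m = s ^ (m - 1) / (1 + s) ^ (m + 1)"
    proof -
      obtain k where "m = Suc k" using m by (cases m) auto
      then show ?thesis using that by (simp add: power_divide power2_eq_square)
    qed
    ultimately show ?thesis by simp
  qed
  have "(\<integral>\<^sup>+s. ennreal (s ^ (m - 1) / (1 + s) ^ (m + 1)) * indicator {0..} s \<partial>lborel) = ennreal (1 / real m - ?F 0)"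
  proof (rule nn_integral_FTC_atLeast[OF _ D])
    have "((\<lambda>s::real. s / (1 + s)) \<longlongrightarrow> 1) at_top" by real_asymp
    from tendsto_divide[OF tendsto_power[OF this, of m] tendsto_const[of "real m"]]
    show "(?F \<longlongrightarrow> 1 / real m) at_top" using m by simp
  qed auto
  moreover have "(\<integral>\<^sup>+s. ennreal (s ^ (m - 1) / (1 + s) ^ (m + 1)) * indicator {0<..} s \<partial>lborel) =
      (\<integral>\<^sup>+s. ennreal (s ^ (m - 1) / (1 + s) ^ (m + 1)) * indicator {0..} s \<partial>lborel)"
    using AE_lborel_singleton[of "0::real"]
    by (intro nn_integral_cong_AE) (auto elim!: eventually_mono split: split_indicator)
  ultimately show ?thesis using m by (subst nn_integral_halfline) (auto simp: power_0_left)
qed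

lemma (in pair_sigma_finite) integrable_product_functions:
  fixes f g :: "_ \<Rightarrow> real"
  assumes f: "integrable M1 f" and g: "integrable M2 g"
  shows "integrable (M1 \<Otimes>\<^sub>M M2) (\<lambda>z. f (fst z) * g (snd z))"
    "(LINT z|(M1 \<Otimes>\<^sub>M M2). f (fst z) * g (snd z)) = (LINT x|M1. f x) * (LINT y|M2. g y)"
    "(LINT z|(M1 \<Otimes>\<^sub>M M2). \<bar>f (fst z) * g (snd z)\<bar>) = (LINT x|M1. \<bar>f x\<bar>) * (LINT y|M2. \<bar>g y\<bar>)"
proof -
  have [measurable]: "f \<in> borel_measurable M1" "g \<in> borel_measurable M2" using f g by auto
  show i: "integrable (M1 \<Otimes>\<^sub>M M2) (\<lambda>z. f (fst z) * g (snd z))"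
  proof (rule Fubini_integrable)
    show "integrable M1 (\<lambda>x. LINT y|M2. norm (f (fst (x, y)) * g (snd (x, y))))"
      using f by (simp add: abs_mult)
    show "AE x in M1. integrable M2 (\<lambda>y. f (fst (x, y)) * g (snd (x, y)))"
      using g by simp
  qed measurable
  show "(LINT z|(M1 \<Otimes>\<^sub>M M2). f (fst z) * g (snd z)) = (LINT x|M1. f x) * (LINT y|M2. g y)"
    using integral_fst'[OF i] by simp
  have "integrable (M1 \<Otimes>\<^sub>M M2) (\<lambda>z. \<bar>f (fst z) * g (snd z)\<bar>)" using i by simp
  from integral_fst'[OF this]
  show "(LINT z|(M1 \<Otimes>\<^sub>M M2). \<bar>f (fst z) * g (snd z)\<bar>) = (LINT x|M1. \<bar>f x\<bar>) * (LINT y|M2. \<bar>g y\<bar>)"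
    by (simp add: abs_mult)
qed

lemma (in pair_sigma_finite) nn_integral_product_functions:
  fixes f g :: "_ \<Rightarrow> ennreal"
  assumes [measurable]: "f \<in> borel_measurable M1" "g \<in> borel_measurable M2"
  shows "(\<integral>\<^sup>+z. f (fst z) * g (snd z) \<partial>(M1 \<Otimes>\<^sub>M M2)) = (\<integral>\<^sup>+x. f x \<partial>M1) * (\<integral>\<^sup>+y. g y \<partial>M2)"
proof -
  have "(\<lambda>z. f (fst z) * g (snd z)) \<in> borel_measurable (M1 \<Otimes>\<^sub>M M2)" by measurable
  from M2.nn_integral_fst[OF this] show ?thesis by (simp add: nn_integral_cmult nn_integral_multc)
qed

lemma abs_mult_le_sum_squares: "\<bar>x\<bar> * \<bar>y\<bar> \<le> x\<^sup>2 + y\<^sup>2" for x y :: real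
proof -
  have "2 * (\<bar>x\<bar> * \<bar>y\<bar>) \<le> x\<^sup>2 + y\<^sup>2" using sum_squares_bound[of "\<bar>x\<bar>" "\<bar>y\<bar>"] by simp
  moreover have "0 \<le> \<bar>x\<bar> * \<bar>y\<bar>" by simp
  ultimately show ?thesis by linarith
qed

lemma ennreal_le_suminf: "f k \<le> (\<Sum>k. f k :: ennreal)"
  using sum_le_suminf[OF summableI, of "{k}" f] by simp

text \<open>The singularity of the squared logarithm at the origin is dominated by exponentials whose
  Gaussian expectations are known.\<close>

lemma ln_squared_le:
  assumes r: "r > 0"
  shows "ennreal ((ln r)\<^sup>2) \<le> ennreal (8 * exp (r / 2)) + (\<Sum>k. ennreal (3 * (real k + 1)\<^sup>2 * exp (- (2 ^ k * r))))"
proof (cases "r \<ge> 1")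
  case True
  have "ln r = 2 * ln (sqrt r)" using r by (simp add: ln_sqrt)
  also have "ln (sqrt r) \<le> sqrt r - 1" using r by (intro ln_le_minus_one) simp
  finally have "ln r \<le> 2 * sqrt r" by simp
  then have "(ln r)\<^sup>2 \<le> (2 * sqrt r)\<^sup>2" using True by (intro power_mono) auto
  also have "\<dots> = 8 * (r / 2)" using r by (simp add: power_mult_distrib)
  also have "r / 2 \<le> exp (r / 2)" using exp_ge_add_one_self[of "r / 2"] by linarith
  finally have "(ln r)\<^sup>2 \<le> 8 * exp (r / 2)" by simp
  then have "ennreal ((ln r)\<^sup>2) \<le> ennreal (8 * exp (r / 2))" by (rule ennreal_leI)
  then show ?thesis by (rule add_increasing2[OF zero_le])
next
  case False
  define L where "L = - log 2 r"
  have L: "L > 0" using False r by (simp add: L_def log_less_zero_cancel_iff)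
  \<comment> \<open>The index \<open>k\<close> is the dyadic scale of \<open>r\<close>: the exponential with rate \<open>2 ^ k\<close> is still of order one at \<open>r\<close>.\<close>
  define k where "k = nat \<lfloor>L\<rfloor>"
  have k: "real k \<le> L" "L < real k + 1" using L by (simp_all add: k_def)
  have "2 ^ k = 2 powr real k" by (simp add: powr_realpow)
  also have "\<dots> \<le> 2 powr L" using k by simp
  also have "2 powr L = 1 / r" using r by (simp add: L_def powr_minus_divide)
  finally have "2 ^ k * r \<le> 1" using r by (simp add: field_simps)
  then have e: "exp (-1) \<le> exp (- (2 ^ k * r))" by simp
  have "\<bar>ln r\<bar> = L * ln 2" using False r by (simp add: L_def log_def abs_if)
  also have "\<dots> \<le> L * 1" using L ln_2_less_1 by (intro mult_left_mono) auto
  finally have "\<bar>ln r\<bar> \<le> real k + 1" using k by simp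
  then have "(ln r)\<^sup>2 \<le> (real k + 1)\<^sup>2 * 1" by (simp add: abs_le_square_iff[symmetric])
  moreover have "(1::real) \<le> 3 * exp (- (2 ^ k * r))"
  proof -
    have "exp (1::real) \<le> 3" by (rule exp_le)
    then have "1 \<le> 3 * exp (-1::real)" by (simp add: exp_minus field_simps)
    with e show ?thesis by linarith
  qed
  then have "(real k + 1)\<^sup>2 * 1 \<le> (real k + 1)\<^sup>2 * (3 * exp (- (2 ^ k * r)))"
    by (rule mult_left_mono) simp
  ultimately have "(ln r)\<^sup>2 \<le> (real k + 1)\<^sup>2 * (3 * exp (- (2 ^ k * r)))"
    by (rule order_trans)
  then have "(ln r)\<^sup>2 \<le> 3 * (real k + 1)\<^sup>2 * exp (- (2 ^ k * r))"
    by (simp only: mult_ac)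
  then have "ennreal ((ln r)\<^sup>2) \<le> ennreal (3 * (real k + 1)\<^sup>2 * exp (- (2 ^ k * r)))" by (rule ennreal_leI)
  also have "\<dots> \<le> (\<Sum>k. ennreal (3 * (real k + 1)\<^sup>2 * exp (- (2 ^ k * r))))"
    by (rule ennreal_le_suminf)
  finally show ?thesis by (rule add_increasing[OF zero_le])
qed

lemma AE_cgauss_neq: "AE x in cgauss. x \<noteq> c"
  unfolding cgauss_def using AE_lborel_singleton[of c] by (subst AE_density) (auto elim: eventually_mono)

lemma nn_integral_cgauss_ln_squared: "(\<integral>\<^sup>+x. ennreal ((ln ((cmod x)\<^sup>2))\<^sup>2) \<partial>cgauss) < \<infinity>"
proof -
  have s: "summable (\<lambda>k. 3 * (real k + 1)\<^sup>2 / (1 + 2 ^ k))"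
  proof (rule summable_comparison_test')
    show "summable (\<lambda>k. 3 * (real k + 1)\<^sup>2 / 2 ^ k)"
    proof (rule summable_ratio_test[of "3/4" 9])
      fix k :: nat assume k: "9 \<le> k"
      have "2 * (real k + 2)\<^sup>2 \<le> 3 * (real k + 1)\<^sup>2"
      proof -
        have "9 * real k \<le> real k * real k" using k by (intro mult_right_mono) auto
        moreover have "5 + 2 * real k \<le> 9 * real k" using k by simp
        ultimately have "5 + 2 * real k \<le> real k * real k" by linarith
        then show ?thesis by (simp add: power2_eq_square algebra_simps)
      qed
      then show "norm (3 * (real (Suc k) + 1)\<^sup>2 / 2 ^ Suc k) \<le> 3/4 * norm (3 * (real k + 1)\<^sup>2 / 2 ^ k)"
        by (simp add: field_simps add.commute)
    qed simp
    show "norm (3 * (real k + 1)\<^sup>2 / (1 + 2 ^ k)) \<le> 3 * (real k + 1)\<^sup>2 / 2 ^ k" if "0 \<le> k" for k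
    proof -
      have "3 * (real k + 1)\<^sup>2 / (1 + 2 ^ k) \<le> 3 * (real k + 1)\<^sup>2 / 2 ^ k"
        by (intro divide_left_mono mult_pos_pos) (auto intro: add_pos_pos)
      then show ?thesis by simp
    qed
  qed
  have "(\<integral>\<^sup>+x. ennreal ((ln ((cmod x)\<^sup>2))\<^sup>2) \<partial>cgauss) \<le>
    (\<integral>\<^sup>+x. ennreal (8 * exp ((cmod x)\<^sup>2 / 2)) + (\<Sum>k. ennreal (3 * (real k + 1)\<^sup>2 * exp (- (2 ^ k * (cmod x)\<^sup>2)))) \<partial>cgauss)"
    using AE_cgauss_neq[of 0]
    by (intro nn_integral_mono_AE) (auto elim!: eventually_mono intro!: ln_squared_le)
  also have "\<dots> = (\<integral>\<^sup>+x. ennreal (8 * exp ((cmod x)\<^sup>2 / 2)) \<partial>cgauss) +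
      (\<Sum>k. \<integral>\<^sup>+x. ennreal (3 * (real k + 1)\<^sup>2 * exp (- (2 ^ k * (cmod x)\<^sup>2))) \<partial>cgauss)"
    by (subst nn_integral_add, measurable, subst nn_integral_suminf, measurable)
  also have "(\<lambda>k. \<integral>\<^sup>+x. ennreal (3 * (real k + 1)\<^sup>2 * exp (- (2 ^ k * (cmod x)\<^sup>2))) \<partial>cgauss) =
      (\<lambda>k. ennreal (3 * (real k + 1)\<^sup>2 / (1 + 2 ^ k)))"
  proof
    fix k :: nat
    have "(2::real) ^ k > 0" by simp
    then have "(2::real) ^ k > -1" by linarith
    note E = nn_integral_cgauss_exp[OF this]
    show "(\<integral>\<^sup>+x. ennreal (3 * (real k + 1)\<^sup>2 * exp (- (2 ^ k * (cmod x)\<^sup>2))) \<partial>cgauss) =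
        ennreal (3 * (real k + 1)\<^sup>2 / (1 + 2 ^ k))"
    proof -
      have "(\<integral>\<^sup>+x. ennreal (3 * (real k + 1)\<^sup>2 * exp (- (2 ^ k * (cmod x)\<^sup>2))) \<partial>cgauss) =
        (\<integral>\<^sup>+x. ennreal (3 * (real k + 1)\<^sup>2) * ennreal (exp (- (2 ^ k) * (cmod x)\<^sup>2)) \<partial>cgauss)"
        by (intro nn_integral_cong) (simp add: ennreal_mult[symmetric])
      also have "\<dots> = ennreal (3 * (real k + 1)\<^sup>2) * ennreal (1 / (1 + 2 ^ k))"
        by (subst nn_integral_cmult) (simp_all only: E, measurable)
      also have "\<dots> = ennreal (3 * (real k + 1)\<^sup>2 / (1 + 2 ^ k))"
        by (subst ennreal_mult[symmetric]) auto
      finally show ?thesis .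
    qed
  qed
  also have "(\<integral>\<^sup>+x. ennreal (8 * exp ((cmod x)\<^sup>2 / 2)) \<partial>cgauss) = ennreal 16"
  proof -
    have "(\<integral>\<^sup>+x. ennreal (8 * exp ((cmod x)\<^sup>2 / 2)) \<partial>cgauss) =
      (\<integral>\<^sup>+x. ennreal 8 * ennreal (exp (- (-1/2) * (cmod x)\<^sup>2)) \<partial>cgauss)"
      by (intro nn_integral_cong) (subst ennreal_mult[symmetric], auto)
    also have "\<dots> = ennreal 8 * ennreal (1 / (1 + (-1/2)))"
      by (subst nn_integral_cmult, measurable, subst nn_integral_cgauss_exp) auto
    also have "\<dots> = ennreal 16" by (subst ennreal_mult[symmetric]) auto
    finally show ?thesis .
  qed
  also have "ennreal 16 + (\<Sum>k. ennreal (3 * (real k + 1)\<^sup>2 / (1 + 2 ^ k))) < \<infinity>"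
    using s by (simp add: suminf_ennreal2)
  finally show ?thesis .
qed

lemma nn_integral_cgauss_radial:
  fixes h :: "real \<Rightarrow> ennreal"
  assumes [measurable]: "h \<in> borel_measurable borel" and be: "(cmod b)\<^sup>2 + (cmod e)\<^sup>2 = 1"
  shows "(\<integral>\<^sup>+z. h (cmod (b * fst z + e * snd z)) \<partial>(cgauss \<Otimes>\<^sub>M cgauss)) = (\<integral>\<^sup>+x. h (cmod x) \<partial>cgauss)"
proof -
  obtain a' b' f where a: "(cmod a')\<^sup>2 = (cmod b)\<^sup>2 + (cmod e)\<^sup>2"
    and law: "\<And>F :: complex \<Rightarrow> complex \<Rightarrow> ennreal. case_prod F \<in> borel_measurable borel \<Longrightarrow>
       (\<integral>\<^sup>+x. \<integral>\<^sup>+z. F (b * x + e * z) (0 * x + 0 * z) \<partial>cgauss \<partial>cgauss) =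
       (\<integral>\<^sup>+x. \<integral>\<^sup>+z. F (a' * x) (b' * x + f * z) \<partial>cgauss \<partial>cgauss)"
    using cgauss_pair_reduction[of b e 0 0] by blast
  have a1: "cmod a' = 1" using a be by (simp add: power2_eq_1_iff) (use norm_ge_zero[of a'] in linarith)
  have m: "case_prod (\<lambda>x (y::complex). h (cmod x)) \<in> borel_measurable borel"
    unfolding borel_prod[symmetric] by measurable
  have "(\<integral>\<^sup>+z. h (cmod (b * fst z + e * snd z)) \<partial>(cgauss \<Otimes>\<^sub>M cgauss)) =
      (\<integral>\<^sup>+x. \<integral>\<^sup>+z. h (cmod (b * x + e * z)) \<partial>cgauss \<partial>cgauss)"
  proof -
    have "(\<lambda>z. h (cmod (b * fst z + e * snd z))) \<in> borel_measurable (cgauss \<Otimes>\<^sub>M cgauss)" by measurable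
    from cgauss.nn_integral_fst[OF this] show ?thesis by simp
  qed
  also have "\<dots> = (\<integral>\<^sup>+x. h (cmod x) \<partial>cgauss)"
    using law[OF m] by (simp add: norm_mult a1 cgauss.emeasure_space_1[simplified])
  finally show ?thesis .
qed

text \<open>The expectation of \<open>frullani u s\<close> when \<open>u\<close> is a standard exponential variable.\<close>

definition mean_frullani :: "real \<Rightarrow> real" where
  "mean_frullani s = (exp (- s) - 1 / (1 + s)) / s"

text \<open>The covariance of \<open>frullani u s\<close> and \<open>frullani v t\<close> when \<open>u\<close> and \<open>v\<close> are the squared moduli
  of standard complex Gaussians whose correlation has squared modulus \<open>q\<close>.\<close>

definition cov_kernel :: "real \<Rightarrow> real \<Rightarrow> real \<Rightarrow> real" where
  "cov_kernel q s t = (1 / ((1 + s) * (1 + t) - q * (s * t)) - 1 / ((1 + s) * (1 + t))) / (s * t)"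

text \<open>On the product of two standard Gaussians, the forms \<open>a * x\<close> and \<open>b * x + e * y\<close> are standard
  complex Gaussians whose correlation has squared modulus \<open>(cmod b)\<^sup>2\<close>.\<close>

locale correlated_gaussians =
  fixes a b e :: complex
  assumes a: "cmod a = 1" and be: "(cmod b)\<^sup>2 + (cmod e)\<^sup>2 = 1"
begin

abbreviation "GG \<equiv> cgauss \<Otimes>\<^sub>M cgauss"

definition U :: "complex \<times> complex \<Rightarrow> real" where "U z = (cmod (a * fst z))\<^sup>2"
definition V :: "complex \<times> complex \<Rightarrow> real" where "V z = (cmod (b * fst z + e * snd z))\<^sup>2"
definition q :: real where "q = (cmod b)\<^sup>2"

lemma measurable_UV [measurable]: "U \<in> borel_measurable GG" "V \<in> borel_measurable GG"
  unfolding U_def V_def by measurable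

lemma q: "0 \<le> q" "q \<le> 1" using be by (auto simp: q_def) (metis add_increasing2 le_add_same_cancel1 zero_le_power2 order_refl)

lemma UV_nonneg: "U z \<ge> 0" "V z \<ge> 0" by (simp_all add: U_def V_def)

lemma nn_integral_U: "h \<in> borel_measurable borel \<Longrightarrow> (\<integral>\<^sup>+z. h (U z) \<partial>GG) = (\<integral>\<^sup>+x. h ((cmod x)\<^sup>2) \<partial>cgauss)"
  and nn_integral_V: "h \<in> borel_measurable borel \<Longrightarrow> (\<integral>\<^sup>+z. h (V z) \<partial>GG) = (\<integral>\<^sup>+x. h ((cmod x)\<^sup>2) \<partial>cgauss)"
  for h :: "real \<Rightarrow> ennreal"
  using nn_integral_cgauss_radial[of "\<lambda>r. h (r\<^sup>2)" a 0] nn_integral_cgauss_radial[of "\<lambda>r. h (r\<^sup>2)" b e] a be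
  by (simp_all add: U_def V_def)

lemma AE_UV: "AE z in GG. U z > 0 \<and> V z > 0"
proof -
  have 0: "(\<integral>\<^sup>+x. indicator {0} ((cmod x)\<^sup>2) \<partial>cgauss) = 0"
    using AE_cgauss_neq[of 0] by (subst nn_integral_0_iff_AE) (auto elim!: eventually_mono)
  have "AE z in GG. indicator {0} (U z) = (0::ennreal)"
    using nn_integral_U[of "indicator {0}"] 0 by (subst nn_integral_0_iff_AE[symmetric]) auto
  moreover have "AE z in GG. indicator {0} (V z) = (0::ennreal)"
    using nn_integral_V[of "indicator {0}"] 0 by (subst nn_integral_0_iff_AE[symmetric]) auto
  ultimately show ?thesis
  proof eventually_elim
    case (elim z)
    then show ?case using UV_nonneg[of z] by (auto simp: indicator_def split: if_splits)
  qed
qed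

lemma laplace_UV:
  assumes s: "s \<ge> 0" and t: "t \<ge> 0"
  shows "integrable GG (\<lambda>z. exp (- s * U z - t * V z))"
    "(LINT z|GG. exp (- s * U z - t * V z)) = 1 / ((1 + s) * (1 + t) - q * (s * t))"
proof -
  have pos: "(1 + s) * (1 + t) - q * (s * t) > 0"
  proof -
    have "q * (s * t) \<le> 1 * (s * t)" using q s t by (intro mult_right_mono) auto
    then show ?thesis using s t by (simp add: algebra_simps)
  qed
  have "has_bochner_integral GG (\<lambda>z. exp (- s * U z - t * V z)) (1 / ((1 + s) * (1 + t) - q * (s * t)))"
  proof (rule has_bochner_integral_nn_integral)
    show "(\<integral>\<^sup>+z. ennreal (exp (- s * U z - t * V z)) \<partial>GG) = ennreal (1 / ((1 + s) * (1 + t) - q * (s * t)))"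
      unfolding q_def cgauss_pair_laplace[OF s t a be, symmetric]
      by (subst cgauss.nn_integral_fst[symmetric]) (measurable, simp add: U_def V_def)
  qed (use pos in auto)
  then show "integrable GG (\<lambda>z. exp (- s * U z - t * V z))"
    "(LINT z|GG. exp (- s * U z - t * V z)) = 1 / ((1 + s) * (1 + t) - q * (s * t))"
    by (auto simp: has_bochner_integral_iff)
qed

lemma integrable_ln_squared:
  "integrable GG (\<lambda>z. (ln (U z))\<^sup>2)" "integrable GG (\<lambda>z. (ln (V z))\<^sup>2)"
proof -
  have "(\<integral>\<^sup>+z. ennreal ((ln (U z))\<^sup>2) \<partial>GG) < \<infinity>" "(\<integral>\<^sup>+z. ennreal ((ln (V z))\<^sup>2) \<partial>GG) < \<infinity>"
    using nn_integral_U[of "\<lambda>r. ennreal ((ln r)\<^sup>2)"] nn_integral_V[of "\<lambda>r. ennreal ((ln r)\<^sup>2)"]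
      nn_integral_cgauss_ln_squared by simp_all
  then show "integrable GG (\<lambda>z. (ln (U z))\<^sup>2)" "integrable GG (\<lambda>z. (ln (V z))\<^sup>2)"
    by (auto intro!: integrableI_bounded)
qed

lemma integrable_ln_ln: "integrable GG (\<lambda>z. ln (U z) * ln (V z))"
proof (rule Bochner_Integration.integrable_bound)
  show "integrable GG (\<lambda>z. (ln (U z))\<^sup>2 + (ln (V z))\<^sup>2)" using integrable_ln_squared by simp
  show "AE z in GG. norm (ln (U z) * ln (V z)) \<le> norm ((ln (U z))\<^sup>2 + (ln (V z))\<^sup>2)"
    using abs_mult_le_sum_squares by (intro AE_I2) (simp add: abs_mult)
qed measurable

lemma expectation_frullani:
  assumes s: "s > 0" and t: "t > 0"
  shows "(LINT z|GG. frullani (U z) s * frullani (V z) t) = mean_frullani s * mean_frullani t + cov_kernel q s t"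
proof -
  define f where "f = (\<lambda>z. exp (- (t * V z)))"
  define g where "g = (\<lambda>z. exp (- (s * U z)))"
  define h where "h = (\<lambda>z. exp (- (s * U z) - t * V z))"
  have e: "frullani (U z) s * frullani (V z) t =
     (exp (- s) * exp (- t) - exp (- s) * f z - exp (- t) * g z + h z) / (s * t)" for z
    using s t by (simp add: f_def g_def h_def frullani_def exp_diff exp_minus field_simps)
  have i: "integrable GG f" "integrable GG g" "integrable GG h"
    using laplace_UV(1)[of 0 t] laplace_UV(1)[of s 0] laplace_UV(1)[of s t] s t
    by (simp_all add: f_def g_def h_def)
  have v: "(LINT z|GG. f z) = 1 / (1 + t)" "(LINT z|GG. g z) = 1 / (1 + s)"
    "(LINT z|GG. h z) = 1 / ((1 + s) * (1 + t) - q * (s * t))"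
    using laplace_UV(2)[of 0 t] laplace_UV(2)[of s 0] laplace_UV(2)[of s t] s t
    by (simp_all add: f_def g_def h_def)
  have "(LINT z|GG. frullani (U z) s * frullani (V z) t) =
     (exp (- s) * exp (- t) - exp (- s) * (LINT z|GG. f z) - exp (- t) * (LINT z|GG. g z) + (LINT z|GG. h z)) / (s * t)"
    unfolding e using i cgauss_pair.P.prob_space by simp
  also have "\<dots> = mean_frullani s * mean_frullani t + cov_kernel q s t"
    unfolding v using s t by (simp add: mean_frullani_def cov_kernel_def add_divide_distrib[symmetric] diff_divide_distrib[symmetric])
       (simp add: algebra_simps)
  finally show ?thesis .
qed

interpretation GH: pair_sigma_finite GG "halfline \<Otimes>\<^sub>M halfline"
  by (intro pair_sigma_finite.intro cgauss_pair.P.sigma_finite_measure_axioms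
      halfline_pair.P.sigma_finite_measure_axioms)

lemma AE_HH: "AE w in halfline \<Otimes>\<^sub>M halfline. fst w > 0 \<and> snd w > 0"
proof (rule halfline_pair.AE_pair_measure)
  show "AE s in halfline. AE t in halfline. 0 < fst (s, t) \<and> 0 < snd (s, t)"
    using AE_halfline by (auto elim!: eventually_mono)
qed measurable

text \<open>Frullani's formula for both logarithms and Fubini's theorem. The absolute integrals over \<open>s\<close> and
  \<open>t\<close> give back absolute values of logarithms, so integrability follows from square-integrability.\<close>

lemma cov_integral:
  shows "integrable (halfline \<Otimes>\<^sub>M halfline) (\<lambda>w. mean_frullani (fst w) * mean_frullani (snd w) + cov_kernel q (fst w) (snd w))"
    and "(LINT z|GG. ln (U z) * ln (V z)) =
      (LINT w|(halfline \<Otimes>\<^sub>M halfline). mean_frullani (fst w) * mean_frullani (snd w) + cov_kernel q (fst w) (snd w))"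
proof -
  let ?h = "\<lambda>z w. frullani (U z) (fst w) * frullani (V z) (snd w)"
  have [measurable]: "(\<lambda>w. mean_frullani (fst w) * mean_frullani (snd w) + cov_kernel q (fst w) (snd w)) \<in> borel_measurable (halfline \<Otimes>\<^sub>M halfline)"
    unfolding mean_frullani_def cov_kernel_def by measurable
  have prod: "integrable (halfline \<Otimes>\<^sub>M halfline) (?h z)"
    "(LINT w|(halfline \<Otimes>\<^sub>M halfline). ?h z w) = ln (U z) * ln (V z)"
    "(LINT w|(halfline \<Otimes>\<^sub>M halfline). \<bar>?h z w\<bar>) = \<bar>ln (U z) * ln (V z)\<bar>" if "U z > 0 \<and> V z > 0" for z
  proof -
    have u: "U z > 0" and v: "V z > 0" using that by auto
    note F = halfline_pair.integrable_product_functions[OF frullani_has_integral(1)[OF u] frullani_has_integral(1)[OF v]]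
    show "integrable (halfline \<Otimes>\<^sub>M halfline) (?h z)" by (rule F(1))
    show "(LINT w|(halfline \<Otimes>\<^sub>M halfline). ?h z w) = ln (U z) * ln (V z)"
      unfolding F(2) frullani_has_integral(2)[OF u] frullani_has_integral(2)[OF v] ..
    show "(LINT w|(halfline \<Otimes>\<^sub>M halfline). \<bar>?h z w\<bar>) = \<bar>ln (U z) * ln (V z)\<bar>"
      using F(3) unfolding frullani_has_integral(3)[OF u] frullani_has_integral(3)[OF v] by (simp add: abs_mult)
  qed
  have int: "integrable (GG \<Otimes>\<^sub>M (halfline \<Otimes>\<^sub>M halfline)) (\<lambda>(z, w). ?h z w)"
  proof (rule GH.Fubini_integrable)
    show "AE z in GG. integrable (halfline \<Otimes>\<^sub>M halfline) (\<lambda>w. case (z, w) of (z, w) \<Rightarrow> ?h z w)"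
      using AE_UV by eventually_elim (simp add: prod)
    have "integrable GG (\<lambda>z. \<bar>ln (U z) * ln (V z)\<bar>)" using integrable_ln_ln by simp
    then show "integrable GG (\<lambda>z. LINT w|(halfline \<Otimes>\<^sub>M halfline). norm (case (z, w) of (z, w) \<Rightarrow> ?h z w))"
    proof (rule integrable_cong_AE_imp)
      show "AE z in GG. \<bar>ln (U z) * ln (V z)\<bar> = (LINT w|(halfline \<Otimes>\<^sub>M halfline). norm (case (z, w) of (z, w) \<Rightarrow> ?h z w))"
        using AE_UV by eventually_elim (simp add: prod)
    qed measurable
  qed measurable
  have eq: "AE w in halfline \<Otimes>\<^sub>M halfline. (LINT z|GG. ?h z w) =
     mean_frullani (fst w) * mean_frullani (snd w) + cov_kernel q (fst w) (snd w)"
    using AE_HH by eventually_elim (simp add: expectation_frullani)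
  show "integrable (halfline \<Otimes>\<^sub>M halfline) (\<lambda>w. mean_frullani (fst w) * mean_frullani (snd w) + cov_kernel q (fst w) (snd w))"
    by (rule integrable_cong_AE_imp[OF GH.integrable_snd[OF int] _ eq]) measurable
  have "(LINT z|GG. ln (U z) * ln (V z)) = (LINT z|GG. LINT w|(halfline \<Otimes>\<^sub>M halfline). ?h z w)"
    by (rule integral_cong_AE) (measurable, use AE_UV in eventually_elim, simp add: prod)
  also have "\<dots> = (LINT w|(halfline \<Otimes>\<^sub>M halfline). LINT z|GG. ?h z w)"
    using GH.Fubini_integral[OF int] by simp
  also have "\<dots> = (LINT w|(halfline \<Otimes>\<^sub>M halfline). mean_frullani (fst w) * mean_frullani (snd w) + cov_kernel q (fst w) (snd w))"
    by (rule integral_cong_AE[OF _ _ eq]) measurable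
  finally show "(LINT z|GG. ln (U z) * ln (V z)) =
      (LINT w|(halfline \<Otimes>\<^sub>M halfline). mean_frullani (fst w) * mean_frullani (snd w) + cov_kernel q (fst w) (snd w))" .
qed

lemma cov_kernel_series:
  assumes s: "s > 0" and t: "t > 0"
  shows "(\<lambda>m. q ^ Suc m * (s ^ m / (1 + s) ^ (m + 2)) * (t ^ m / (1 + t) ^ (m + 2))) sums cov_kernel q s t"
proof -
  let ?D = "(1 + s) * (1 + t)"
  let ?x = "q * (s * t) / ?D"
  have D: "?D > 0" using s t by (intro mult_pos_pos) auto
  have qst: "q * (s * t) \<le> 1 * (s * t)" using q s t by (intro mult_right_mono) auto
  also have "1 * (s * t) < ?D" using s t by (simp add: algebra_simps)
  finally have lt: "q * (s * t) < ?D" .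
  then have x: "norm ?x < 1" using q s t D by simp
  have "(\<lambda>m. ?x ^ m) sums (1 / (1 - ?x))" by (rule geometric_sums[OF x])
  from sums_mult[OF this, of "q / ?D\<^sup>2"]
  have "(\<lambda>m. q / ?D\<^sup>2 * ?x ^ m) sums (q / ?D\<^sup>2 * (1 / (1 - ?x)))" .
  moreover have "q / ?D\<^sup>2 * ?x ^ m = q ^ Suc m * (s ^ m / (1 + s) ^ (m + 2)) * (t ^ m / (1 + t) ^ (m + 2))" for m
    by (simp add: power_divide power_mult_distrib power_add power2_eq_square mult_ac)
  moreover have "q / ?D\<^sup>2 * (1 / (1 - ?x)) = cov_kernel q s t"
  proof -
    have n: "?D - q * (s * t) \<noteq> 0" "s \<noteq> 0" "t \<noteq> 0" "?D \<noteq> 0" using lt s t D by auto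
    have "1 - ?x = (?D - q * (s * t)) / ?D" using n by (simp add: diff_divide_distrib)
    then have "q / ?D\<^sup>2 * (1 / (1 - ?x)) = q / (?D * (?D - q * (s * t)))"
      using n by (simp add: power2_eq_square)
    also have "\<dots> = (1 / (?D - q * (s * t)) - 1 / ?D) / (s * t)"
    proof -
      have "1 / (?D - q * (s * t)) - 1 / ?D = q * (s * t) / (?D * (?D - q * (s * t)))"
        using n by (simp add: diff_frac_eq mult.commute)
      then show ?thesis using n by simp
    qed
    finally show ?thesis by (simp add: cov_kernel_def)
  qed
  ultimately show ?thesis by simp
qed

text \<open>After the geometric expansion the variables \<open>s\<close> and \<open>t\<close> separate, and each integral contributes a
  factor \<open>1 / m\<close>.\<close>

lemma nn_integral_cov_kernel:
  "(\<integral>\<^sup>+w. ennreal (cov_kernel q (fst w) (snd w)) \<partial>(halfline \<Otimes>\<^sub>M halfline)) = ennreal (dilog q)"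
proof -
  let ?B = "\<lambda>m s::real. s ^ m / (1 + s) ^ (m + 2)"
  let ?T = "\<lambda>m w. ennreal (q ^ Suc m) * (ennreal (?B m (fst w)) * ennreal (?B m (snd w)))"
  have eq: "AE w in halfline \<Otimes>\<^sub>M halfline. ennreal (cov_kernel q (fst w) (snd w)) = (\<Sum>m. ?T m w)"
    using AE_HH
  proof eventually_elim
    case (elim w)
    have nn: "0 \<le> q ^ Suc m * ?B m (fst w) * ?B m (snd w)" for m using elim q by auto
    have "ennreal (cov_kernel q (fst w) (snd w)) = (\<Sum>m. ennreal (q ^ Suc m * ?B m (fst w) * ?B m (snd w)))"
      using cov_kernel_series[of "fst w" "snd w"] elim nn by (subst suminf_ennreal_eq) auto
    also have "\<dots> = (\<Sum>m. ?T m w)"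
      using elim q by (intro suminf_cong) (simp add: ennreal_mult[symmetric] ennreal_mult'[symmetric] mult.assoc)
    finally show ?case .
  qed
  have B: "(\<integral>\<^sup>+s. ennreal (?B m s) \<partial>halfline) = ennreal (1 / real (Suc m))" for m
    using nn_integral_beta_kernel[of "Suc m"] by simp
  have "(\<integral>\<^sup>+w. ennreal (cov_kernel q (fst w) (snd w)) \<partial>(halfline \<Otimes>\<^sub>M halfline)) =
      (\<integral>\<^sup>+w. (\<Sum>m. ?T m w) \<partial>(halfline \<Otimes>\<^sub>M halfline))"
    by (rule nn_integral_cong_AE[OF eq])
  also have "\<dots> = (\<Sum>m. \<integral>\<^sup>+w. ?T m w \<partial>(halfline \<Otimes>\<^sub>M halfline))"
    by (rule nn_integral_suminf) measurable
  also have "\<dots> = (\<Sum>m. ennreal (1 / (real (Suc m))\<^sup>2 * q ^ Suc m))"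
  proof (rule suminf_cong)
    fix m
    have "(\<integral>\<^sup>+w. ?T m w \<partial>(halfline \<Otimes>\<^sub>M halfline)) =
       ennreal (q ^ Suc m) * (\<integral>\<^sup>+w. ennreal (?B m (fst w)) * ennreal (?B m (snd w)) \<partial>(halfline \<Otimes>\<^sub>M halfline))"
      by (rule nn_integral_cmult) measurable
    also have "\<dots> = ennreal (q ^ Suc m) * ((\<integral>\<^sup>+s. ennreal (?B m s) \<partial>halfline) * (\<integral>\<^sup>+s. ennreal (?B m s) \<partial>halfline))"
    proof -
      have "(\<lambda>s::real. ennreal (?B m s)) \<in> borel_measurable halfline" by measurable
      from halfline_pair.nn_integral_product_functions[OF this this] show ?thesis by (simp only:)
    qed
    also have "\<dots> = ennreal (q ^ Suc m) * (ennreal (1 / real (Suc m)) * ennreal (1 / real (Suc m)))"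
      by (simp only: B)
    also have "\<dots> = ennreal (1 / (real (Suc m))\<^sup>2 * q ^ Suc m)"
      using q by (simp add: ennreal_mult[symmetric] power2_eq_square mult.commute del: power_Suc of_nat_Suc)
    finally show "(\<integral>\<^sup>+w. ?T m w \<partial>(halfline \<Otimes>\<^sub>M halfline)) = ennreal (1 / (real (Suc m))\<^sup>2 * q ^ Suc m)" .
  qed
  also have "\<dots> = ennreal (dilog q)"
  proof (rule suminf_ennreal_eq)
    have "summable (\<lambda>m. 1 / (real m)\<^sup>2 * q ^ m)"
      using q by (intro summable_comparison_test'[OF summable_inverse_square, of 0])
        (auto simp: power_le_one mult_left_le divide_right_mono)
    then have "(\<lambda>m. 1 / (real m)\<^sup>2 * q ^ m) sums dilog q" unfolding dilog_def by (rule summable_sums)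
    then show "(\<lambda>m. 1 / (real (Suc m))\<^sup>2 * q ^ Suc m) sums dilog q"
      using sums_Suc_iff[of "\<lambda>m. 1 / (real m)\<^sup>2 * q ^ m" "dilog q"] by simp
  qed (use q in auto)
  finally show ?thesis .
qed

end

definition log_cov_const :: real where
  "log_cov_const = (LINT z|(cgauss \<Otimes>\<^sub>M cgauss). ln ((cmod (fst z))\<^sup>2) * ln ((cmod (snd z))\<^sup>2))"

context correlated_gaussians
begin

text \<open>The means contribute the same amount for every correlation. Comparison with the independent case
  identifies this amount without evaluating it.\<close>

theorem expectation_ln_ln: "(LINT z|GG. ln (U z) * ln (V z)) = log_cov_const + dilog q"
proof -
  interpret ind: correlated_gaussians 1 0 1 by unfold_locales auto
  let ?AA = "\<lambda>w. mean_frullani (fst w) * mean_frullani (snd w)"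
  have c0: "(LINT z|GG. ln (ind.U z) * ln (ind.V z)) = log_cov_const"
    by (simp add: log_cov_const_def ind.U_def ind.V_def)
  have "ind.q = 0" by (simp add: ind.q_def)
  then have k0: "cov_kernel ind.q s t = 0" for s t by (simp add: cov_kernel_def)
  have i0: "integrable (halfline \<Otimes>\<^sub>M halfline) ?AA"
    and v0: "(LINT w|(halfline \<Otimes>\<^sub>M halfline). ?AA w) = log_cov_const"
    using ind.cov_integral by (simp_all add: k0 c0)
  have ik: "integrable (halfline \<Otimes>\<^sub>M halfline) (\<lambda>w. cov_kernel q (fst w) (snd w))"
    using Bochner_Integration.integrable_diff[OF cov_integral(1) i0] by simp
  have nn: "AE w in halfline \<Otimes>\<^sub>M halfline. 0 \<le> cov_kernel q (fst w) (snd w)"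
    using AE_HH
  proof eventually_elim
    case (elim w)
    have nn: "0 \<le> q ^ Suc m * (fst w ^ m / (1 + fst w) ^ (m + 2)) * (snd w ^ m / (1 + snd w) ^ (m + 2))" for m
      using elim q by auto
    show ?case by (rule sums_le[OF nn sums_zero cov_kernel_series]) (use elim in auto)
  qed
  have dl: "0 \<le> dilog q" unfolding dilog_def using q
    by (intro suminf_nonneg summable_comparison_test'[OF summable_inverse_square, of 0])
       (auto simp: power_le_one mult_left_le divide_right_mono)
  have "(LINT w|(halfline \<Otimes>\<^sub>M halfline). cov_kernel q (fst w) (snd w)) = dilog q"
    using nn_integral_cov_kernel dl by (subst integral_eq_nn_integral[OF _ nn]) (use ik in auto)
  then show ?thesis using cov_integral(2) i0 ik v0 by simp
qed

end

section \<open>Stereographic coordinates\<close>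

lemma stereo_norm:
  assumes x: "x \<in> S2" "x$3 \<noteq> 1"
  shows "1 + (cmod (stereo x))\<^sup>2 = 2 / (1 - x$3)" "x$3 < 1"
proof -
  have s: "(x$1)\<^sup>2 + (x$2)\<^sup>2 + (x$3)\<^sup>2 = 1"
    using x(1) by (simp add: norm_vec_def L2_set_def sum_3)
  then have "(x$3)\<^sup>2 \<le> 1\<^sup>2" by (metis add_increasing le_add_same_cancel2 one_power2 sum_power2_ge_zero)
  then have "x$3 \<le> 1" by (rule power2_le_imp_le) simp
  with x(2) show lt: "x$3 < 1" by simp
  have "(cmod (stereo x))\<^sup>2 = ((x$1)\<^sup>2 + (x$2)\<^sup>2) / (1 - x$3)\<^sup>2"
    by (simp add: stereo_def norm_divide power_divide cmod_def add_divide_distrib del: of_real_diff)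
  also have "(x$1)\<^sup>2 + (x$2)\<^sup>2 = (1 - x$3) * (1 + x$3)" using s by (simp add: algebra_simps power2_eq_square)
  finally have sq: "(cmod (stereo x))\<^sup>2 = (1 - x$3) * (1 + x$3) / (1 - x$3)\<^sup>2" .
  define u where "u = 1 - x$3"
  have u: "x$3 = 1 - u" "u \<noteq> 0" using lt by (simp_all add: u_def)
  show "1 + (cmod (stereo x))\<^sup>2 = 2 / (1 - x$3)"
    unfolding sq u(1) using u(2) by (simp add: power2_eq_square field_simps)
qed

text \<open>The second identity is the chordal distance in stereographic coordinates.\<close>

lemma inner_stereo:
  assumes x: "x \<in> S2" "x$3 \<noteq> 1" and y: "y \<in> S2" "y$3 \<noteq> 1"
  shows "zonal_arg x y = (cmod (1 + stereo x * cnj (stereo y)))\<^sup>2 / ((1 + (cmod (stereo x))\<^sup>2) * (1 + (cmod (stereo y))\<^sup>2))"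
    and "1 - zonal_arg x y = (cmod (stereo x - stereo y))\<^sup>2 / ((1 + (cmod (stereo x))\<^sup>2) * (1 + (cmod (stereo y))\<^sup>2))"
proof -
  let ?z = "stereo x" and ?w = "stereo y"
  have n: "1 - x$3 \<noteq> 0" "1 - y$3 \<noteq> 0" using x y by auto
  have z: "Re ?z = x$1 / (1 - x$3)" "Im ?z = x$2 / (1 - x$3)" "Re ?w = y$1 / (1 - y$3)" "Im ?w = y$2 / (1 - y$3)"
    by (simp_all add: stereo_def Re_divide_of_real Im_divide_of_real del: of_real_diff)
  have nz: "1 + (cmod ?z)\<^sup>2 = 2 / (1 - x$3)" "1 + (cmod ?w)\<^sup>2 = 2 / (1 - y$3)"
    using stereo_norm x y by auto
  have sz: "(cmod ?z)\<^sup>2 = 2 / (1 - x$3) - 1" "(cmod ?w)\<^sup>2 = 2 / (1 - y$3) - 1" using nz by simp_all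
  have ip: "x \<bullet> y = x$1 * y$1 + x$2 * y$2 + x$3 * y$3" by (simp add: inner_vec_def sum_3)
  have p: "(cmod (1 + ?z * cnj ?w))\<^sup>2 = 1 + 2 * Re (?z * cnj ?w) + (cmod ?z)\<^sup>2 * (cmod ?w)\<^sup>2"
    unfolding cmod_power2 by (simp add: power2_eq_square algebra_simps)
  have m: "(cmod (?z - ?w))\<^sup>2 = (cmod ?z)\<^sup>2 + (cmod ?w)\<^sup>2 - 2 * Re (?z * cnj ?w)"
    unfolding cmod_power2 by (simp add: power2_eq_square algebra_simps)
  define r where "r = Re (?z * cnj ?w)"
  have r: "r = (x \<bullet> y - x$3 * y$3) / ((1 - x$3) * (1 - y$3))"
    by (simp add: r_def z ip add_divide_distrib)
  define u where "u = 1 - x$3"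
  define v where "v = 1 - y$3"
  have uv: "x$3 = 1 - u" "u \<noteq> 0" "y$3 = 1 - v" "v \<noteq> 0" using n by (simp_all add: u_def v_def)
  show "zonal_arg x y = (cmod (1 + ?z * cnj ?w))\<^sup>2 / ((1 + (cmod ?z)\<^sup>2) * (1 + (cmod ?w)\<^sup>2))"
    unfolding nz p unfolding sz r_def[symmetric] r zonal_arg_def uv(1,3) using uv(2,4) by (simp add: field_simps)
  show "1 - zonal_arg x y = (cmod (?z - ?w))\<^sup>2 / ((1 + (cmod ?z)\<^sup>2) * (1 + (cmod ?w)\<^sup>2))"
    unfolding nz m unfolding sz r_def[symmetric] r zonal_arg_def uv(1,3) using uv(2,4) by (simp add: field_simps)
qed

lemma stereo_inj: "x \<in> S2 \<Longrightarrow> x$3 \<noteq> 1 \<Longrightarrow> y \<in> S2 \<Longrightarrow> y$3 \<noteq> 1 \<Longrightarrow> stereo x = stereo y \<Longrightarrow> x = y"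
  using inner_stereo(2)[of x y] zonal_arg_eq_1[of x y] by simp

lemma stereo_surj: "\<exists>x. x \<in> S2 \<and> x$3 \<noteq> 1 \<and> stereo x = z"
proof -
  define r where "r = 1 + (cmod z)\<^sup>2"
  have r: "r > 0" by (simp add: r_def add_pos_nonneg)
  define x :: "real^3" where "x = vector [2 * Re z / r, 2 * Im z / r, 1 - 2 / r]"
  have c: "x$1 = 2 * Re z / r" "x$2 = 2 * Im z / r" "x$3 = 1 - 2 / r" by (simp_all add: x_def)
  have rr: "(Re z)\<^sup>2 + (Im z)\<^sup>2 = r - 1" by (simp add: r_def cmod_power2)
  have "(x$1)\<^sup>2 + (x$2)\<^sup>2 + (x$3)\<^sup>2 = (4 * ((Re z)\<^sup>2 + (Im z)\<^sup>2) + (r - 2)\<^sup>2) / r\<^sup>2"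
    unfolding c using r by (simp add: power2_eq_square field_simps)
  also have "\<dots> = 1" unfolding rr using r by (simp add: power2_eq_square field_simps)
  finally have "x \<in> S2" by (simp add: norm_vec_def L2_set_def sum_3)
  moreover have "x$3 \<noteq> 1" using r by (simp add: c)
  moreover have "stereo x = z" using r by (simp add: stereo_def c complex_eq_iff Re_divide_of_real Im_divide_of_real)
  ultimately show ?thesis by blast
qed

lemma north_pole: "x \<in> S2 \<Longrightarrow> x$3 = 1 \<Longrightarrow> x = axis 3 1"
proof -
  assume "x \<in> S2" "x$3 = 1"
  then have "(x$1)\<^sup>2 + (x$2)\<^sup>2 = 0" by (simp add: norm_vec_def L2_set_def sum_3)
  then have "x$1 = 0" "x$2 = 0" by (simp_all add: sum_power2_eq_zero_iff)
  then show ?thesis using \<open>x$3 = 1\<close> by (simp add: vec_eq_iff forall_3 axis_def)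
qed

lemma AE_not_north: "AE x in sphere_measure. x$3 \<noteq> 1"
proof -
  have "AE x in sphere_measure. x \<noteq> axis 3 1" by (rule AE_sphere_neq) simp
  then show ?thesis by (rule AE_mp) (intro AE_I2 impI notI, use north_pole in simp)
qed

section \<open>Normalized elliptic polynomials\<close>

text \<open>The evaluation functional at \<open>x\<close> on elliptic polynomials, divided by the Fubini-Study weight so
  that it becomes a unit vector. Consequently \<open>elliptic_value N x c\<close> is a standard complex Gaussian
  for every \<open>x\<close>, which reflects the rotation invariance of the zeros.\<close>

definition elliptic_vector :: "nat \<Rightarrow> real^3 \<Rightarrow> nat \<Rightarrow> complex" where
  "elliptic_vector N x n = of_real (sqrt (real (N choose n))) * stereo x ^ n / of_real (sqrt (1 + (cmod (stereo x))\<^sup>2) ^ N)"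

definition elliptic_value :: "nat \<Rightarrow> real^3 \<Rightarrow> (nat \<Rightarrow> complex) \<Rightarrow> complex" where
  "elliptic_value N x c = (\<Sum>n\<in>{0..N}. elliptic_vector N x n * c n)"

lemma elliptic_vector_inner:
  "(\<Sum>n\<in>{0..N}. elliptic_vector N x n * cnj (elliptic_vector N y n)) =
    (1 + stereo x * cnj (stereo y)) ^ N / of_real ((sqrt (1 + (cmod (stereo x))\<^sup>2) * sqrt (1 + (cmod (stereo y))\<^sup>2)) ^ N)"
proof -
  let ?d = "of_real ((sqrt (1 + (cmod (stereo x))\<^sup>2) * sqrt (1 + (cmod (stereo y))\<^sup>2)) ^ N) :: complex"
  have "elliptic_vector N x n * cnj (elliptic_vector N y n) =
     of_nat (N choose n) * (stereo x * cnj (stereo y)) ^ n / ?d" for n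
  proof -
    have "complex_of_real (sqrt (real (N choose n))) * of_real (sqrt (real (N choose n))) = of_nat (N choose n)"
      by (simp flip: of_real_mult)
    then show ?thesis
      by (simp add: elliptic_vector_def power_mult_distrib mult_ac)
  qed
  then have "(\<Sum>n\<in>{0..N}. elliptic_vector N x n * cnj (elliptic_vector N y n)) =
     (\<Sum>n\<le>N. of_nat (N choose n) * (stereo x * cnj (stereo y)) ^ n * 1 ^ (N - n)) / ?d"
    by (simp add: sum_divide_distrib atLeast0AtMost)
  also have "(\<Sum>n\<le>N. of_nat (N choose n) * (stereo x * cnj (stereo y)) ^ n * 1 ^ (N - n)) = (stereo x * cnj (stereo y) + 1) ^ N"
    by (rule binomial_ring[symmetric])
  finally show ?thesis by (simp add: add.commute)
qed

lemma elliptic_vector_norm: "(\<Sum>n\<in>{0..N}. (cmod (elliptic_vector N x n))\<^sup>2) = 1"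
proof -
  let ?r = "1 + (cmod (stereo x))\<^sup>2"
  have r: "?r > 0" by (simp add: add_pos_nonneg)
  have "complex_of_real (\<Sum>n\<in>{0..N}. (cmod (elliptic_vector N x n))\<^sup>2) =
     (\<Sum>n\<in>{0..N}. elliptic_vector N x n * cnj (elliptic_vector N x n))"
    by (simp only: of_real_sum complex_norm_square)
  also have "\<dots> = of_real (?r ^ N) / of_real (?r ^ N)"
  proof -
    have "1 + stereo x * cnj (stereo x) = of_real ?r"
      by (simp only: complex_norm_square[symmetric]) simp
    moreover have "sqrt ?r * sqrt ?r = ?r" using r by simp
    ultimately show ?thesis unfolding elliptic_vector_inner by (simp only: of_real_power)
  qed
  also have "\<dots> = 1"
  proof (rule divide_self)
    have "?r ^ N \<noteq> 0" using r by simp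
    then show "complex_of_real (?r ^ N) \<noteq> 0" by (simp only: of_real_eq_0_iff) simp
  qed
  finally show ?thesis by (metis of_real_eq_1_iff)
qed

lemma elliptic_vector_correlation:
  assumes x: "x \<in> S2" "x$3 \<noteq> 1" and y: "y \<in> S2" "y$3 \<noteq> 1"
  shows "(cmod (\<Sum>n\<in>{0..N}. elliptic_vector N x n * cnj (elliptic_vector N y n)))\<^sup>2 = zonal_arg x y ^ N"
proof -
  have r: "1 + (cmod (stereo x))\<^sup>2 > 0" "1 + (cmod (stereo y))\<^sup>2 > 0" by (simp_all add: add_pos_nonneg)
  then show ?thesis
    unfolding elliptic_vector_inner inner_stereo(1)[OF x y]
    by (simp add: norm_divide norm_power power_divide power_mult_distrib power_mult[symmetric] mult.commute[of N 2]
        norm_mult del: of_real_add)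
       (simp add: power_mult)
qed

lemma poly_elliptic_poly: "poly (elliptic_poly N c) z = (\<Sum>n\<in>{0..N}. of_real (sqrt (real (N choose n))) * z ^ n * c n)"
  by (simp add: elliptic_poly_def poly_sum poly_monom atLeast0AtMost mult_ac)

lemma elliptic_value_eq:
  "elliptic_value N x c = poly (elliptic_poly N c) (stereo x) / of_real (sqrt (1 + (cmod (stereo x))\<^sup>2) ^ N)"
  by (simp add: elliptic_value_def poly_elliptic_poly elliptic_vector_def sum_divide_distrib)

lemma coeff_elliptic_poly: "coeff (elliptic_poly N c) n = (if n \<le> N then c n * of_real (sqrt (real (N choose n))) else 0)"
  by (auto simp: elliptic_poly_def coeff_sum)

definition simple_elliptic :: "nat \<Rightarrow> (nat \<Rightarrow> complex) \<Rightarrow> bool" where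
  "simple_elliptic N c \<longleftrightarrow> c N \<noteq> 0 \<and>
     (\<forall>z. poly (elliptic_poly N c) z = 0 \<longrightarrow> poly (pderiv (elliptic_poly N c)) z \<noteq> 0)"

lemma degree_elliptic_poly: "c N \<noteq> 0 \<Longrightarrow> degree (elliptic_poly N c) = N"
  by (intro antisym degree_le le_degree) (auto simp: coeff_elliptic_poly)

lemma simple_elliptic_roots:
  assumes s: "simple_elliptic N c"
  defines "p \<equiv> elliptic_poly N c" and "Z \<equiv> {z. poly (elliptic_poly N c) z = 0}"
  shows "finite Z" "card Z = N" "poly p z = lead_coeff p * (\<Prod>w\<in>Z. z - w)" "lead_coeff p \<noteq> 0"
proof -
  have d: "degree p = N" using s degree_elliptic_poly by (simp add: simple_elliptic_def p_def)
  have "coeff p N \<noteq> 0" using s by (simp add: simple_elliptic_def p_def coeff_elliptic_poly)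
  then have p0: "p \<noteq> 0" by auto
  have rs: "rsquarefree p" using s unfolding rsquarefree_roots simple_elliptic_def p_def by blast
  show "finite Z" unfolding Z_def p_def[symmetric] by (rule poly_roots_finite[OF p0])
  have dec: "smult (lead_coeff p) (\<Prod>w\<in>Z. [:- w, 1:]) = p"
    using complex_poly_decompose_rsquarefree[OF rs] by (simp add: Z_def p_def)
  have "degree (\<Prod>w\<in>Z. [:- w, 1:]) = (\<Sum>w\<in>Z. degree [:- w, 1:])"
    by (rule degree_prod_eq_sum_degree) auto
  moreover have "degree (smult (lead_coeff p) (\<Prod>w\<in>Z. [:- w, 1:])) = degree (\<Prod>w\<in>Z. [:- w, 1:])"
    using p0 by (simp only: degree_smult_eq leading_coeff_0_iff if_False)
  ultimately have "degree p = card Z" unfolding dec by simp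
  then show "card Z = N" using d by simp
  show "poly p z = lead_coeff p * (\<Prod>w\<in>Z. z - w)"
    by (subst dec[symmetric]) (simp add: poly_prod)
  show "lead_coeff p \<noteq> 0" using p0 by simp
qed

lemma bij_betw_elliptic_points:
  "bij_betw stereo (elliptic_points N c) {z. poly (elliptic_poly N c) z = 0}"
proof (rule bij_betwI')
  fix x y assume "x \<in> elliptic_points N c" "y \<in> elliptic_points N c"
  then show "(stereo x = stereo y) = (x = y)" using stereo_inj by (auto simp: elliptic_points_def)
next
  fix z assume "z \<in> {z. poly (elliptic_poly N c) z = 0}"
  then show "\<exists>x\<in>elliptic_points N c. z = stereo x"
    using stereo_surj[of z] by (auto simp: elliptic_points_def)
qed (auto simp: elliptic_points_def)

lemma elliptic_points_card:
  assumes "simple_elliptic N c"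
  shows "finite (elliptic_points N c)" "card (elliptic_points N c) = N" "elliptic_points N c \<subseteq> S2"
  using simple_elliptic_roots(1,2)[OF assms] bij_betw_elliptic_points[of N c]
  by (auto simp: bij_betw_finite bij_betw_same_card elliptic_points_def)

text \<open>Factor the polynomial over its zeros and replace each planar distance by a chordal one; the weights
  of \<open>x\<close> cancel because there are exactly \<open>N\<close> zeros.\<close>

lemma elliptic_value_product:
  assumes s: "simple_elliptic N c"
  shows "\<exists>K>0. \<forall>x\<in>S2. x$3 \<noteq> 1 \<longrightarrow>
    (cmod (elliptic_value N x c))\<^sup>2 = K * (\<Prod>y\<in>elliptic_points N c. 1 - zonal_arg x y)"
proof -
  let ?X = "elliptic_points N c" and ?Z = "{z. poly (elliptic_poly N c) z = 0}" and ?p = "elliptic_poly N c"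
  let ?r = "\<lambda>x. 1 + (cmod (stereo x))\<^sup>2"
  have rp: "?r x > 0" for x by (simp add: add_pos_nonneg)
  note R = simple_elliptic_roots[OF s] and E = elliptic_points_card[OF s]
  define K where "K = (cmod (lead_coeff ?p))\<^sup>2 * (\<Prod>y\<in>?X. ?r y)"
  have "K > 0" unfolding K_def using R(4) rp by (intro mult_pos_pos prod_pos) auto
  moreover have "(cmod (elliptic_value N x c))\<^sup>2 = K * (\<Prod>y\<in>?X. 1 - zonal_arg x y)"
    if x: "x \<in> S2" "x$3 \<noteq> 1" for x
  proof -
    have "(cmod (poly ?p (stereo x)))\<^sup>2 = (cmod (lead_coeff ?p))\<^sup>2 * (\<Prod>w\<in>?Z. (cmod (stereo x - w))\<^sup>2)"
      unfolding R(3)[of "stereo x"] norm_mult power_mult_distrib prod_norm[symmetric] prod_power_distrib ..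
    also have "(\<Prod>w\<in>?Z. (cmod (stereo x - w))\<^sup>2) = (\<Prod>y\<in>?X. (cmod (stereo x - stereo y))\<^sup>2)"
      by (rule prod.reindex_bij_betw[OF bij_betw_elliptic_points, symmetric])
    also have "\<dots> = (\<Prod>y\<in>?X. ?r x * (?r y * (1 - zonal_arg x y)))"
    proof (rule prod.cong[OF refl])
      fix y assume "y \<in> ?X"
      then have y: "y \<in> S2" "y$3 \<noteq> 1" by (auto simp: elliptic_points_def)
      show "(cmod (stereo x - stereo y))\<^sup>2 = ?r x * (?r y * (1 - zonal_arg x y))"
        using rp[of x] rp[of y] by (simp add: inner_stereo(2)[OF x y])
    qed
    also have "\<dots> = ?r x ^ N * ((\<Prod>y\<in>?X. ?r y) * (\<Prod>y\<in>?X. 1 - zonal_arg x y))"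
      by (simp add: prod.distrib E(2))
    finally have "(cmod (poly ?p (stereo x)))\<^sup>2 = ?r x ^ N * (K * (\<Prod>y\<in>?X. 1 - zonal_arg x y))"
      by (simp add: K_def mult_ac)
    moreover have "(cmod (elliptic_value N x c))\<^sup>2 = (cmod (poly ?p (stereo x)))\<^sup>2 / ?r x ^ N"
    proof -
      have "(sqrt (?r x) ^ N)\<^sup>2 = ?r x ^ N"
        using rp[of x] by (simp add: power_mult[symmetric] mult.commute[of N 2]) (simp add: power_mult)
      then show ?thesis
        using rp[of x] by (simp add: elliptic_value_eq norm_divide power_divide norm_power del: of_real_power)
    qed
    ultimately show ?thesis using rp[of x] by simp
  qed
  ultimately show ?thesis by blast
qed

section \<open>Random elliptic polynomials\<close>

definition coeff_space :: "nat \<Rightarrow> (nat \<Rightarrow> complex) measure" where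
  "coeff_space N = PiM {0..N} (\<lambda>_. cgauss)"

lemma prob_space_coeff_space: "prob_space (coeff_space N)"
  unfolding coeff_space_def by (rule prob_space_PiM) (rule cgauss.prob_space_axioms)

lemma measurable_coeff [measurable]: "n \<le> N \<Longrightarrow> (\<lambda>c. c n) \<in> borel_measurable (coeff_space N)"
  unfolding coeff_space_def
  using measurable_component_singleton[of n "{0..N}" "\<lambda>_. cgauss"]
  by (simp add: measurable_cong_sets[OF refl sets_cgauss])

lemma poly_pderiv_elliptic_poly:
  "poly (pderiv (elliptic_poly N c)) z = (\<Sum>n\<in>{0..N}. of_nat n * of_real (sqrt (real (N choose n))) * z ^ (n - 1) * c n)"
proof -
  have "pderiv (sum f A) = (\<Sum>n\<in>A. pderiv (f n))" if "finite A" for f :: "nat \<Rightarrow> complex poly" and A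
    using that by (induction A rule: finite_induct) (auto simp: pderiv_add)
  then show ?thesis
    unfolding elliptic_poly_def by (simp add: pderiv_monom poly_sum poly_monom atLeast0AtMost mult_ac)
qed

lemma measurable_poly_elliptic [measurable]:
  "(\<lambda>c. poly (elliptic_poly N c) z) \<in> borel_measurable (coeff_space N)"
  "(\<lambda>c. poly (pderiv (elliptic_poly N c)) z) \<in> borel_measurable (coeff_space N)"
  unfolding poly_elliptic_poly poly_pderiv_elliptic_poly
  by (intro borel_measurable_sum borel_measurable_times borel_measurable_const measurable_coeff; simp)+

lemma dense_sequence: "\<exists>d :: nat \<Rightarrow> complex. \<forall>X. open X \<longrightarrow> X \<noteq> {} \<longrightarrow> (\<exists>i. d i \<in> X)"
proof -
  obtain D :: "complex set" where D: "countable D" "\<And>X. open X \<Longrightarrow> X \<noteq> {} \<Longrightarrow> \<exists>d\<in>D. d \<in> X"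
    using countable_dense_setE by blast
  have "D \<noteq> {}" using D(2)[of UNIV] by auto
  then have "range (from_nat_into D) = D" using D(1) by (rule range_from_nat_into)
  then show ?thesis using D(2) by (intro exI[of _ "from_nat_into D"]) (metis rangeE)
qed

text \<open>A common zero is detected on a countable dense set, by compactness of discs.\<close>

lemma common_root_iff:
  fixes p r :: "complex poly" and d :: "nat \<Rightarrow> complex"
  assumes d: "\<forall>X. open X \<longrightarrow> X \<noteq> {} \<longrightarrow> (\<exists>i. d i \<in> X)"
  shows "(\<exists>z. poly p z = 0 \<and> poly r z = 0) \<longleftrightarrow>
    (\<exists>R::nat. \<forall>k::nat. \<exists>i. cmod (d i) \<le> real R \<and> cmod (poly p (d i)) + cmod (poly r (d i)) < 1 / real (Suc k))"
    (is "?L \<longleftrightarrow> ?R")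
proof -
  let ?f = "\<lambda>z. cmod (poly p z) + cmod (poly r z)"
  have cont: "continuous_on S ?f" for S by (intro continuous_intros)
  have "?R" if ?L
  proof -
    from that obtain z where "poly p z = 0" "poly r z = 0" by blast
    then have z: "?f z = 0" by simp
    obtain R :: nat where R: "cmod z < real R" using reals_Archimedean2 by blast
    show ?R
    proof (rule exI[of _ R], rule allI)
      fix k :: nat
      let ?X = "ball 0 (real R) \<inter> {w. ?f w < 1 / real (Suc k)}"
      have "open ?X" by (intro open_Int open_ball open_Collect_less cont continuous_on_const)
      moreover have "z \<in> ?X" using z R by simp
      ultimately obtain i where "d i \<in> ?X" using d by blast
      then show "\<exists>i. cmod (d i) \<le> real R \<and> ?f (d i) < 1 / real (Suc k)" by (intro exI[of _ i]) auto
    qed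
  qed
  moreover have ?L if ?R
  proof -
    from that obtain R :: nat where R: "\<And>k. \<exists>i. cmod (d i) \<le> real R \<and> ?f (d i) < 1 / real (Suc k)" by blast
    have "\<exists>z\<in>cball 0 (real R). \<forall>w\<in>cball 0 (real R). ?f z \<le> ?f w"
      by (rule continuous_attains_inf[OF compact_cball _ cont]) auto
    then obtain z where z0: "\<forall>w\<in>cball 0 (real R). ?f z \<le> ?f w" by blast
    have z: "?f z \<le> ?f w" if "cmod w \<le> real R" for w using z0 that by simp
    have "?f z \<le> 0"
    proof (rule ccontr)
      assume "\<not> ?f z \<le> 0"
      then have "?f z > 0" by linarith
      then obtain k where k: "inverse (real (Suc k)) < ?f z" using reals_Archimedean by blast
      from R[of k] obtain i where "cmod (d i) \<le> real R" "?f (d i) < 1 / real (Suc k)" by blast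
      with z[of "d i"] k show False by (simp add: inverse_eq_divide)
    qed
    then have "cmod (poly p z) = 0" "cmod (poly r z) = 0"
      using norm_ge_zero[of "poly p z"] norm_ge_zero[of "poly r z"] by linarith+
    then show ?L by auto
  qed
  ultimately show ?thesis by blast
qed

lemma measurable_common_root [measurable]:
  "Measurable.pred (coeff_space N) (\<lambda>c. \<exists>z. poly (elliptic_poly N c) z = 0 \<and> poly (pderiv (elliptic_poly N c)) z = 0)"
proof -
  obtain d :: "nat \<Rightarrow> complex" where d: "\<forall>X. open X \<longrightarrow> X \<noteq> {} \<longrightarrow> (\<exists>i. d i \<in> X)"
    using dense_sequence by blast
  show ?thesis unfolding common_root_iff[OF d] by measurable
qed

lemma AE_cgauss_finite: "finite F \<Longrightarrow> AE x in cgauss. x \<notin> F"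
proof -
  assume "finite F"
  then have "AE x in cgauss. \<forall>c\<in>F. x \<noteq> c" by (rule AE_finite_allI) (rule AE_cgauss_neq)
  then show ?thesis by (auto elim: eventually_mono)
qed

text \<open>With all coefficients but the constant one fixed, the critical points are fixed, and a double
  root can occur only if the constant coefficient takes one of finitely many values.\<close>

lemma AE_simple_elliptic:
  assumes N: "N \<ge> 1" shows "AE c in coeff_space N. simple_elliptic N c"
proof -
  have cN: "AE c in coeff_space N. c N \<noteq> 0"
    unfolding coeff_space_def
    by (rule AE_PiM_component) (auto intro: cgauss.prob_space_axioms AE_cgauss_neq)
  let ?D = "\<lambda>c. c N \<noteq> 0 \<and> (\<exists>z. poly (elliptic_poly N c) z = 0 \<and> poly (pderiv (elliptic_poly N c)) z = 0)"
  let ?g = "\<lambda>c. indicator {c. ?D c} c :: ennreal"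
  have I: "{0..N} = insert 0 {1..N}" by auto
  have gm: "?g \<in> borel_measurable (coeff_space N)"
  proof -
    have [measurable]: "(\<lambda>c. c N) \<in> borel_measurable (coeff_space N)" by (rule measurable_coeff) simp
    have "Measurable.pred (coeff_space N) ?D" by measurable
    then show ?thesis by measurable
  qed
  \<comment> \<open>Only the constant coefficient \<open>y\<close> varies: it shifts the polynomial and leaves its derivative alone.\<close>
  have slice: "(\<integral>\<^sup>+y. ?g (x(0 := y)) \<partial>cgauss) = 0" for x :: "nat \<Rightarrow> complex"
  proof (cases "x N = 0")
    case True
    then show ?thesis using N by simp
  next
    case False
    define r where "r = elliptic_poly N (x(0 := 0))"
    have e: "elliptic_poly N (x(0 := y)) = r + [:y:]" for y
      by (rule poly_eqI) (auto simp: r_def coeff_elliptic_poly coeff_pCons split: nat.splits)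
    have d: "pderiv (r + [:y:]) = pderiv r" for y by (simp add: pderiv_add pderiv_pCons)
    have "coeff (pderiv r) (N - 1) \<noteq> 0"
      using False N by (simp add: coeff_pderiv r_def coeff_elliptic_poly)
    then have "pderiv r \<noteq> 0" by auto
    then have fin: "finite ((\<lambda>z. - poly r z) ` {z. poly (pderiv r) z = 0})"
      by (intro finite_imageI poly_roots_finite)
    have "AE y in cgauss. ?g (x(0 := y)) = 0"
      using AE_cgauss_finite[OF fin]
    proof eventually_elim
      case (elim y)
      have "\<not> (\<exists>z. poly (r + [:y:]) z = 0 \<and> poly (pderiv r) z = 0)"
      proof
        assume "\<exists>z. poly (r + [:y:]) z = 0 \<and> poly (pderiv r) z = 0"
        then obtain z where "poly r z + y = 0" "poly (pderiv r) z = 0" by auto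
        then have "y \<in> (\<lambda>z. - poly r z) ` {z. poly (pderiv r) z = 0}"
          by (intro image_eqI[of _ _ z]) (auto simp: eq_neg_iff_add_eq_0 add.commute)
        with elim show False by blast
      qed
      then show ?case by (simp add: e d)
    qed
    then have "(\<integral>\<^sup>+y. ?g (x(0 := y)) \<partial>cgauss) = (\<integral>\<^sup>+y. 0 \<partial>cgauss)" by (rule nn_integral_cong_AE)
    then show ?thesis by simp
  qed
  have "(\<integral>\<^sup>+c. ?g c \<partial>coeff_space N) = (\<integral>\<^sup>+x. \<integral>\<^sup>+y. ?g (x(0 := y)) \<partial>cgauss \<partial>PiM {1..N} (\<lambda>_. cgauss))"
    unfolding coeff_space_def I
    by (rule cgauss_product.product_nn_integral_insert) (use gm in \<open>auto simp: coeff_space_def I\<close>)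
  then have "(\<integral>\<^sup>+c. ?g c \<partial>coeff_space N) = 0" by (simp add: slice)
  then have "AE c in coeff_space N. ?g c = 0" using gm by (simp add: nn_integral_0_iff_AE)
  with cN show ?thesis
  proof eventually_elim
    case (elim c)
    then show ?case by (auto simp: simple_elliptic_def indicator_def split: if_splits)
  qed
qed

definition log_value :: "nat \<Rightarrow> real^3 \<Rightarrow> (nat \<Rightarrow> complex) \<Rightarrow> real" where
  "log_value N x c = ln ((cmod (elliptic_value N x c))\<^sup>2)"

lemma measurable_elliptic_value [measurable]: "elliptic_value N x \<in> borel_measurable (coeff_space N)"
  unfolding elliptic_value_def[abs_def]
  by (intro borel_measurable_sum borel_measurable_times borel_measurable_const measurable_coeff) simp

text \<open>The correlation of two values of the polynomial is a power of the zonal argument, so their joint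
  law is that of a correlated Gaussian pair.\<close>

lemma elliptic_pair_law:
  assumes x: "x \<in> S2" "x$3 \<noteq> 1" and y: "y \<in> S2" "y$3 \<noteq> 1"
  shows "\<exists>a b e. correlated_gaussians a b e \<and> (cmod b)\<^sup>2 = zonal_arg x y ^ N \<and>
    distr (coeff_space N) (borel \<Otimes>\<^sub>M borel) (\<lambda>c. (elliptic_value N x c, elliptic_value N y c)) =
    distr (cgauss \<Otimes>\<^sub>M cgauss) (borel \<Otimes>\<^sub>M borel) (\<lambda>z. (a * fst z, b * fst z + e * snd z))"
proof -
  obtain a b e where abe: "(cmod a)\<^sup>2 = (\<Sum>i\<in>{0..N}. (cmod (elliptic_vector N x i))\<^sup>2)"
     "(cmod b)\<^sup>2 + (cmod e)\<^sup>2 = (\<Sum>i\<in>{0..N}. (cmod (elliptic_vector N y i))\<^sup>2)"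
     "a * cnj b = (\<Sum>i\<in>{0..N}. elliptic_vector N x i * cnj (elliptic_vector N y i))"
   and law: "\<And>F :: complex \<Rightarrow> complex \<Rightarrow> ennreal. case_prod F \<in> borel_measurable borel \<Longrightarrow>
       (\<integral>\<^sup>+w. F (\<Sum>i\<in>{0..N}. elliptic_vector N x i * w i) (\<Sum>i\<in>{0..N}. elliptic_vector N y i * w i) \<partial>PiM {0..N} (\<lambda>_. cgauss)) =
       (\<integral>\<^sup>+x. \<integral>\<^sup>+z. F (a * x) (b * x + e * z) \<partial>cgauss \<partial>cgauss)"
    using cgauss_linear_forms_nn[of "{0..N}" "elliptic_vector N x" "elliptic_vector N y"] by blast
  have a1: "cmod a = 1" using abe(1) unfolding elliptic_vector_norm
    by (simp add: power2_eq_1_iff) (use norm_ge_zero[of a] in linarith)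
  have be: "(cmod b)\<^sup>2 + (cmod e)\<^sup>2 = 1" using abe(2) unfolding elliptic_vector_norm .
  have "(cmod b)\<^sup>2 = (cmod (a * cnj b))\<^sup>2" by (simp add: norm_mult a1)
  also have "\<dots> = zonal_arg x y ^ N" unfolding abe(3) by (rule elliptic_vector_correlation[OF x y])
  finally have b: "(cmod b)\<^sup>2 = zonal_arg x y ^ N" .
  have "distr (coeff_space N) (borel \<Otimes>\<^sub>M borel) (\<lambda>c. (elliptic_value N x c, elliptic_value N y c)) =
    distr (cgauss \<Otimes>\<^sub>M cgauss) (borel \<Otimes>\<^sub>M borel) (\<lambda>z. (a * fst z, b * fst z + e * snd z))"
  proof (rule measure_eqI)
    fix A assume "A \<in> sets (distr (coeff_space N) (borel \<Otimes>\<^sub>M borel) (\<lambda>c. (elliptic_value N x c, elliptic_value N y c)))"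
    then have A[measurable]: "A \<in> sets (borel \<Otimes>\<^sub>M borel)" by simp
    let ?F = "\<lambda>s t. indicator A (s, t) :: ennreal"
    have m: "case_prod ?F \<in> borel_measurable borel"
      unfolding borel_prod[symmetric] by measurable
    have m2[measurable]: "(\<lambda>z. (a * fst z, b * fst z + e * snd z)) \<in> (cgauss \<Otimes>\<^sub>M cgauss) \<rightarrow>\<^sub>M (borel \<Otimes>\<^sub>M borel)"
      by measurable
    have m1[measurable]: "(\<lambda>c. (elliptic_value N x c, elliptic_value N y c)) \<in> coeff_space N \<rightarrow>\<^sub>M (borel \<Otimes>\<^sub>M borel)"
      by measurable
    have "emeasure (distr (coeff_space N) (borel \<Otimes>\<^sub>M borel) (\<lambda>c. (elliptic_value N x c, elliptic_value N y c))) A =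
       (\<integral>\<^sup>+c. ?F (elliptic_value N x c) (elliptic_value N y c) \<partial>coeff_space N)"
      by (subst nn_integral_indicator[symmetric], simp, subst nn_integral_distr) simp_all
    also have "\<dots> = (\<integral>\<^sup>+x. \<integral>\<^sup>+z. ?F (a * x) (b * x + e * z) \<partial>cgauss \<partial>cgauss)"
      using law[OF m] by (simp add: elliptic_value_def coeff_space_def)
    also have "\<dots> = (\<integral>\<^sup>+z. ?F (a * fst z) (b * fst z + e * snd z) \<partial>(cgauss \<Otimes>\<^sub>M cgauss))"
    proof -
      have "(\<lambda>z. ?F (a * fst z) (b * fst z + e * snd z)) \<in> borel_measurable (cgauss \<Otimes>\<^sub>M cgauss)"
        by measurable
      from cgauss.nn_integral_fst[OF this] show ?thesis by simp
    qed
    also have "\<dots> = emeasure (distr (cgauss \<Otimes>\<^sub>M cgauss) (borel \<Otimes>\<^sub>M borel) (\<lambda>z. (a * fst z, b * fst z + e * snd z))) A"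
      by (subst nn_integral_indicator[symmetric], simp, subst nn_integral_distr) simp_all
    finally show "emeasure (distr (coeff_space N) (borel \<Otimes>\<^sub>M borel) (\<lambda>c. (elliptic_value N x c, elliptic_value N y c))) A =
      emeasure (distr (cgauss \<Otimes>\<^sub>M cgauss) (borel \<Otimes>\<^sub>M borel) (\<lambda>z. (a * fst z, b * fst z + e * snd z))) A" .
  qed simp
  then show ?thesis using a1 be b
    by (intro exI[of _ a] exI[of _ b] exI[of _ e]) (simp add: correlated_gaussians_def)
qed

lemma log_value_moments:
  assumes x: "x \<in> S2" "x$3 \<noteq> 1" and y: "y \<in> S2" "y$3 \<noteq> 1"
  shows "(\<integral>\<^sup>+c. ennreal ((log_value N x c)\<^sup>2) \<partial>coeff_space N) = (\<integral>\<^sup>+z. ennreal ((ln ((cmod z)\<^sup>2))\<^sup>2) \<partial>cgauss)"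
    and "integrable (coeff_space N) (\<lambda>c. log_value N x c * log_value N y c)"
    and "(LINT c|coeff_space N. log_value N x c * log_value N y c) = log_cov_const + dilog (zonal_arg x y ^ N)"
proof -
  obtain a b e where cg: "correlated_gaussians a b e" and b: "(cmod b)\<^sup>2 = zonal_arg x y ^ N"
   and law: "distr (coeff_space N) (borel \<Otimes>\<^sub>M borel) (\<lambda>c. (elliptic_value N x c, elliptic_value N y c)) =
    distr (cgauss \<Otimes>\<^sub>M cgauss) (borel \<Otimes>\<^sub>M borel) (\<lambda>z. (a * fst z, b * fst z + e * snd z))"
    using elliptic_pair_law[OF x y, of N] by blast
  interpret correlated_gaussians a b e by (rule cg)
  have m2[measurable]: "(\<lambda>z. (a * fst z, b * fst z + e * snd z)) \<in> (cgauss \<Otimes>\<^sub>M cgauss) \<rightarrow>\<^sub>M (borel \<Otimes>\<^sub>M borel)"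
    by measurable
  have m1[measurable]: "(\<lambda>c. (elliptic_value N x c, elliptic_value N y c)) \<in> coeff_space N \<rightarrow>\<^sub>M (borel \<Otimes>\<^sub>M borel)"
    by measurable
  let ?f = "\<lambda>p::complex \<times> complex. ln ((cmod (fst p))\<^sup>2) * ln ((cmod (snd p))\<^sup>2)"
  let ?h = "\<lambda>p::complex \<times> complex. ennreal ((ln ((cmod (fst p))\<^sup>2))\<^sup>2)"
  have f[measurable]: "?f \<in> borel_measurable (borel \<Otimes>\<^sub>M borel)" "?h \<in> borel_measurable (borel \<Otimes>\<^sub>M borel)"
    by measurable
  show "(\<integral>\<^sup>+c. ennreal ((log_value N x c)\<^sup>2) \<partial>coeff_space N) = (\<integral>\<^sup>+z. ennreal ((ln ((cmod z)\<^sup>2))\<^sup>2) \<partial>cgauss)"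
  proof -
    have "(\<integral>\<^sup>+c. ?h (elliptic_value N x c, elliptic_value N y c) \<partial>coeff_space N) =
        (\<integral>\<^sup>+z. ?h (a * fst z, b * fst z + e * snd z) \<partial>(cgauss \<Otimes>\<^sub>M cgauss))"
      using arg_cong[OF law, of "\<lambda>M. \<integral>\<^sup>+p. ?h p \<partial>M"] by (simp add: nn_integral_distr)
    then show ?thesis using nn_integral_U[of "\<lambda>r. ennreal ((ln r)\<^sup>2)"]
      by (simp add: log_value_def U_def)
  qed
  have i: "integrable (distr (coeff_space N) (borel \<Otimes>\<^sub>M borel) (\<lambda>c. (elliptic_value N x c, elliptic_value N y c))) ?f"
    unfolding law using integrable_ln_ln by (subst integrable_distr_eq[OF m2 f(1)]) (simp add: U_def V_def)
  then show "integrable (coeff_space N) (\<lambda>c. log_value N x c * log_value N y c)"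
    unfolding integrable_distr_eq[OF m1 f(1)] by (simp add: log_value_def)
  show "(LINT c|coeff_space N. log_value N x c * log_value N y c) = log_cov_const + dilog (zonal_arg x y ^ N)"
    using integral_distr[OF m1 f(1)] integral_distr[OF m2 f(1)] expectation_ln_ln
    unfolding law by (simp add: log_value_def U_def V_def q_def b)
qed

section \<open>Second moments of linear statistics\<close>

lemma borel_measurable_stereo [measurable]: "stereo \<in> borel_measurable borel"
proof -
  have c: "stereo x = (of_real (x$1) + \<i> * of_real (x$2)) / of_real (1 - x$3)" for x
    by (simp add: stereo_def Complex_eq)
  have [measurable]: "(\<lambda>x::real^3. x $ i) \<in> borel_measurable borel" for i
    by (intro borel_measurable_continuous_onI continuous_intros)
  show ?thesis unfolding c[abs_def] by measurable
qed

lemma measurable_log_value_pair [measurable]: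
  assumes f: "f \<in> M \<rightarrow>\<^sub>M sphere_measure" and g: "g \<in> M \<rightarrow>\<^sub>M coeff_space N"
  shows "(\<lambda>z. log_value N (f z) (g z)) \<in> borel_measurable M"
proof -
  have f'[measurable]: "f \<in> borel_measurable M"
    using measurable_compose[OF f measurable_sphere_ident] by simp
  have [measurable]: "(\<lambda>z. elliptic_vector N (f z) n) \<in> borel_measurable M" for n
    unfolding elliptic_vector_def by measurable
  have "(\<lambda>z. elliptic_value N (f z) (g z)) \<in> borel_measurable M"
    unfolding elliptic_value_def
    by (intro borel_measurable_sum borel_measurable_times) 
       (simp_all add: measurable_compose[OF g measurable_coeff])
  then show ?thesis unfolding log_value_def by measurable
qed

text \<open>The eigenvalue of the kernel \<open>dilog (zonal_arg x y ^ N)\<close> on harmonics of degree \<open>l\<close>.\<close>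

definition stat_const :: "nat \<Rightarrow> nat \<Rightarrow> real" where
  "stat_const N l = (\<Sum>m. 1 / (real m)\<^sup>2 * funk_hecke (N * m) l)"

lemma funk_hecke_le_1: "funk_hecke n l \<le> 1"
proof (cases "n < l")
  case False
  have "(\<Prod>j<l. real n - real j) \<le> (\<Prod>j<l. real n + 1 + real j)"
    using False by (intro prod_mono) auto
  also have "\<dots> \<le> (\<Prod>j\<le>l. real n + 1 + real j)"
    unfolding lessThan_Suc_atMost[symmetric] prod.lessThan_Suc
    using prod_nonneg[of "{..<l}" "\<lambda>j. real n + 1 + real j"] by (simp add: mult_le_cancel_left1)
  finally show ?thesis
    using funk_hecke_denominator_pos[where n=n and l=l] by (simp add: funk_hecke_def)
qed (simp add: funk_hecke_eq_0)

lemma summable_stat_const: "summable (\<lambda>m. 1 / (real m)\<^sup>2 * funk_hecke (N * m) l)"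
proof (rule summable_comparison_test'[OF summable_inverse_square, of 0])
  fix m
  show "norm (1 / (real m)\<^sup>2 * funk_hecke (N * m) l) \<le> 1 / (real m)\<^sup>2"
    using funk_hecke_nonneg[of "N * m" l] funk_hecke_le_1[of "N * m" l] by (simp add: divide_right_mono)
qed

lemma dilog_kernel_integral:
  assumes f: "f \<in> spherical_harmonics l" and y: "y \<in> S2"
  shows "integrable sphere_measure (\<lambda>x. f x * dilog (zonal_arg x y ^ N))"
    "(LINT x|sphere_measure. f x * dilog (zonal_arg x y ^ N)) = stat_const N l * f y"
proof -
  have "summable (\<lambda>m. 1 / (real m)\<^sup>2 / (real (N * m) + 1))"
    by (rule summable_comparison_test'[OF summable_inverse_square, of 0])
      (auto simp: divide_simps mult_le_cancel_left1 intro!: mult_left_mono)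
  note Z = zonal_series_funk_hecke[OF f y _ this]
  show "integrable sphere_measure (\<lambda>x. f x * dilog (zonal_arg x y ^ N))"
    using Z(1) by (simp add: dilog_def power_mult)
  have "(\<lambda>m. 1 / (real m)\<^sup>2 * funk_hecke (N * m) l * f y) sums
      (LINT x|sphere_measure. f x * dilog (zonal_arg x y ^ N))"
    using Z(2) by (simp add: dilog_def power_mult)
  then show "(LINT x|sphere_measure. f x * dilog (zonal_arg x y ^ N)) = stat_const N l * f y"
    using sums_mult2[OF summable_sums[OF summable_stat_const], of N l "f y"]
    unfolding stat_const_def by (rule sums_unique2)
qed

definition log_integral :: "nat \<Rightarrow> (real^3 \<Rightarrow> real) \<Rightarrow> (nat \<Rightarrow> complex) \<Rightarrow> real" where
  "log_integral N f c = (LINT x|sphere_measure. f x * log_value N x c)"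

lemma AE_pair_not_north:
  "AE z in sphere_measure \<Otimes>\<^sub>M sphere_measure. fst z $ 3 \<noteq> 1 \<and> snd z $ 3 \<noteq> 1"
proof (rule sphere_pair.AE_pair_measure)
  have [measurable]: "(\<lambda>x. x $ 3) \<in> borel_measurable sphere_measure"
    by (intro continuous_on_S2_measurable continuous_intros)
  show "{z \<in> space (sphere_measure \<Otimes>\<^sub>M sphere_measure). fst z $ 3 \<noteq> 1 \<and> snd z $ 3 \<noteq> 1} \<in> sets (sphere_measure \<Otimes>\<^sub>M sphere_measure)"
    by measurable
  show "AE x in sphere_measure. AE y in sphere_measure. fst (x, y) $ 3 \<noteq> 1 \<and> snd (x, y) $ 3 \<noteq> 1"
    using AE_not_north by (auto elim!: AE_mp intro!: AE_I2)
qed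

text \<open>By Fubini's theorem the second moment is a double integral of \<open>f x * f y\<close> against the covariance of
  the logarithms at \<open>x\<close> and \<open>y\<close>. That covariance is a constant plus a dilogarithmic zonal kernel: the
  constant is annihilated, since \<open>f\<close> has mean zero, and the kernel acts on \<open>f\<close> as a scalar.\<close>

theorem log_integral_second_moment:
  assumes f: "f \<in> spherical_harmonics l" and l: "l \<ge> 1"
  shows "log_integral N f \<in> borel_measurable (coeff_space N)"
    and "integrable (coeff_space N) (\<lambda>c. (log_integral N f c)\<^sup>2)"
    and "(LINT c|coeff_space N. (log_integral N f c)\<^sup>2) = stat_const N l * (LINT x|sphere_measure. (f x)\<^sup>2)"
proof -
  interpret C: prob_space "coeff_space N" by (rule prob_space_coeff_space)
  let ?SS = "sphere_measure \<Otimes>\<^sub>M sphere_measure" and ?C = "coeff_space N"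
  interpret SC: pair_sigma_finite ?SS ?C
    by (intro pair_sigma_finite.intro sphere_pair.P.sigma_finite_measure_axioms C.sigma_finite_measure_axioms)
  note cf = spherical_harmonic_continuous[OF f]
  have [measurable]: "f \<in> borel_measurable sphere_measure" by (rule continuous_on_S2_measurable[OF cf])
  have meas: "(\<lambda>c. log_integral N f c) \<in> borel_measurable ?C"
    unfolding log_integral_def by measurable
  then show "log_integral N f \<in> borel_measurable (coeff_space N)" by simp
  obtain A where A: "A > 0" "\<And>x. x \<in> S2 \<Longrightarrow> \<bar>f x\<bar> \<le> A"
    by (rule continuous_on_S2_bounded[OF cf]) blast
  let ?L = "log_value N"
  let ?F = "\<lambda>z c. f (fst z) * f (snd z) * (?L (fst z) c * ?L (snd z) c)"
  have Fm: "case_prod ?F \<in> borel_measurable (?SS \<Otimes>\<^sub>M ?C)" by measurable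
  let ?K = "\<integral>\<^sup>+z. ennreal ((ln ((cmod z)\<^sup>2))\<^sup>2) \<partial>cgauss"
  have inner: "(\<integral>\<^sup>+c. ennreal (norm (?F z c)) \<partial>?C) \<le> ennreal (A * A) * (?K + ?K)"
    if z: "fst z \<in> S2" "snd z \<in> S2" "fst z $ 3 \<noteq> 1" "snd z $ 3 \<noteq> 1" for z
  proof -
    have [measurable]: "?L (fst z) \<in> borel_measurable ?C" "?L (snd z) \<in> borel_measurable ?C"
      unfolding log_value_def[abs_def] by measurable
    have "(\<integral>\<^sup>+c. ennreal (norm (?F z c)) \<partial>?C) \<le>
        (\<integral>\<^sup>+c. ennreal (A * A) * (ennreal ((?L (fst z) c)\<^sup>2) + ennreal ((?L (snd z) c)\<^sup>2)) \<partial>?C)"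
    proof (rule nn_integral_mono)
      fix c
      have 1: "\<bar>f (fst z)\<bar> * \<bar>f (snd z)\<bar> \<le> A * A" using A z by (intro mult_mono) auto
      have 2: "\<bar>?L (fst z) c\<bar> * \<bar>?L (snd z) c\<bar> \<le> (?L (fst z) c)\<^sup>2 + (?L (snd z) c)\<^sup>2"
        by (rule abs_mult_le_sum_squares)
      have "norm (?F z c) \<le> (A * A) * ((?L (fst z) c)\<^sup>2 + (?L (snd z) c)\<^sup>2)"
        unfolding real_norm_def abs_mult using A by (intro mult_mono 1 2) auto
      then show "ennreal (norm (?F z c)) \<le> ennreal (A * A) * (ennreal ((?L (fst z) c)\<^sup>2) + ennreal ((?L (snd z) c)\<^sup>2))"
        using A by (simp add: ennreal_plus[symmetric] ennreal_mult[symmetric] del: ennreal_plus)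
    qed
    also have "\<dots> = ennreal (A * A) * (?K + ?K)"
      using z by (simp add: nn_integral_cmult nn_integral_add log_value_moments(1))
    finally show ?thesis .
  qed
  have int: "integrable (?SS \<Otimes>\<^sub>M ?C) (case_prod ?F)"
  proof (rule integrableI_bounded[OF Fm])
    have nm: "(\<lambda>p. ennreal (norm (case_prod ?F p))) \<in> borel_measurable (?SS \<Otimes>\<^sub>M ?C)" using Fm by measurable
    have "(\<integral>\<^sup>+p. ennreal (norm (case_prod ?F p)) \<partial>(?SS \<Otimes>\<^sub>M ?C)) = (\<integral>\<^sup>+z. \<integral>\<^sup>+c. ennreal (norm (?F z c)) \<partial>?C \<partial>?SS)"
      using C.nn_integral_fst[OF nm] by simp
    also have "\<dots> \<le> (\<integral>\<^sup>+z. ennreal (A * A) * (?K + ?K) \<partial>?SS)"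
    proof (rule nn_integral_mono_AE, rule AE_mp[OF AE_pair_not_north], intro AE_I2 impI)
      fix z assume "z \<in> space ?SS" "fst z $ 3 \<noteq> 1 \<and> snd z $ 3 \<noteq> 1"
      then show "(\<integral>\<^sup>+c. ennreal (norm (?F z c)) \<partial>?C) \<le> ennreal (A * A) * (?K + ?K)"
        by (intro inner) (auto simp: space_pair_measure)
    qed
    also have "\<dots> = ennreal (A * A) * (?K + ?K)" by (simp add: sphere_pair.P.emeasure_space_1)
    also have "\<dots> < \<infinity>" using nn_integral_cgauss_ln_squared by (simp add: ennreal_mult_less_top)
    finally show "(\<integral>\<^sup>+p. ennreal (norm (case_prod ?F p)) \<partial>(?SS \<Otimes>\<^sub>M ?C)) < \<infinity>" .
  qed
  have sq: "AE c in ?C. (LINT z|?SS. ?F z c) = (log_integral N f c)\<^sup>2"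
    using SC.AE_integrable_snd[OF int]
  proof eventually_elim
    case (elim c)
    have "(LINT z|?SS. ?F z c) = (LINT x|sphere_measure. LINT y|sphere_measure. (f x * ?L x c) * (f y * ?L y c))"
      using sphere_pair.integral_fst'[OF elim] by (simp add: mult_ac)
    also have "\<dots> = (log_integral N f c)\<^sup>2"
      by (simp add: log_integral_def power2_eq_square)
    finally show ?case .
  qed
  show "integrable ?C (\<lambda>c. (log_integral N f c)\<^sup>2)"
    by (rule integrable_cong_AE_imp[OF SC.integrable_snd[OF int] _ sq]) (use meas in measurable)
  let ?G = "\<lambda>z. f (fst z) * f (snd z) * (log_cov_const + dilog (zonal_arg (fst z) (snd z) ^ N))"
  have [measurable]: "dilog \<in> borel_measurable borel" unfolding dilog_def[abs_def] by measurable
  have Gm[measurable]: "?G \<in> borel_measurable ?SS" by measurable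
  have G: "AE z in ?SS. (LINT c|?C. ?F z c) = ?G z"
  proof (rule AE_mp[OF AE_pair_not_north], intro AE_I2 impI)
    fix z assume "z \<in> space ?SS" "fst z $ 3 \<noteq> 1 \<and> snd z $ 3 \<noteq> 1"
    then show "(LINT c|?C. ?F z c) = ?G z"
      using log_value_moments(3)[of "fst z" "snd z" N] by (auto simp: space_pair_measure)
  qed
  have Gi: "integrable ?SS ?G"
    by (rule integrable_cong_AE_imp[OF SC.integrable_fst[OF int] _ G]) measurable
  have "(LINT c|?C. (log_integral N f c)\<^sup>2) = (LINT c|?C. LINT z|?SS. ?F z c)"
    by (rule integral_cong_AE) (use meas sq in \<open>auto elim: eventually_mono\<close>)
  also have "\<dots> = (LINT z|?SS. LINT c|?C. ?F z c)" by (rule SC.Fubini_integral[OF int])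
  also have "\<dots> = (LINT z|?SS. ?G z)" by (rule integral_cong_AE[OF _ Gm G]) measurable
  also have "\<dots> = (LINT x|sphere_measure. LINT y|sphere_measure. ?G (x, y))"
    using sphere_pair.integral_fst'[OF Gi] by simp
  also have "\<dots> = (LINT x|sphere_measure. stat_const N l * (f x)\<^sup>2)"
  proof (rule Bochner_Integration.integral_cong[OF refl])
    fix x assume "x \<in> space sphere_measure"
    then have x: "x \<in> S2" by simp
    note D = dilog_kernel_integral[OF f x, of N]
    have "(LINT y|sphere_measure. ?G (x, y)) =
       (LINT y|sphere_measure. f x * (log_cov_const * f y + f y * dilog (zonal_arg y x ^ N)))"
      by (simp add: zonal_arg_commute[of x] algebra_simps)
    also have "\<dots> = f x * (log_cov_const * (LINT y|sphere_measure. f y) + stat_const N l * f x)"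
      using D continuous_on_S2_integrable[OF cf] by simp
    finally show "(LINT y|sphere_measure. ?G (x, y)) = stat_const N l * (f x)\<^sup>2"
      by (simp add: spherical_harmonic_mean_zero[OF f l] power2_eq_square)
  qed
  finally show "(LINT c|?C. (log_integral N f c)\<^sup>2) = stat_const N l * (LINT x|sphere_measure. (f x)\<^sup>2)" by simp
qed

text \<open>By the product formula the logarithm of the polynomial is, up to a constant, a sum of
  logarithmic kernels centred at the zeros, each of which reproduces a spherical harmonic.\<close>

theorem sum_over_zeros:
  assumes f: "f \<in> spherical_harmonics l" and l: "l \<ge> 1" and s: "simple_elliptic N c"
  shows "(\<Sum>y\<in>elliptic_points N c. f y) = - eigval l * log_integral N f c"
proof -
  let ?X = "elliptic_points N c"
  note E = elliptic_points_card[OF s]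
  note cf = spherical_harmonic_continuous[OF f]
  have ev: "eigval l > 0" using l by (simp add: eigval_def)
  obtain K where K: "K > 0" "\<And>x. x \<in> S2 \<Longrightarrow> x$3 \<noteq> 1 \<Longrightarrow>
    (cmod (elliptic_value N x c))\<^sup>2 = K * (\<Prod>y\<in>?X. 1 - zonal_arg x y)"
    using elliptic_value_product[OF s] by blast
  have ae: "AE x in sphere_measure. \<forall>y\<in>?X. x \<noteq> y"
    using E AE_sphere_neq by (intro AE_finite_allI) auto
  have eq: "AE x in sphere_measure. f x * log_value N x c = f x * ln K + (\<Sum>y\<in>?X. f x * ln (1 - zonal_arg x y))"
  proof (rule AE_mp[OF ae], rule AE_mp[OF AE_not_north], intro AE_I2 impI)
    fix x assume "x \<in> space sphere_measure" "x$3 \<noteq> 1" and ne: "\<forall>y\<in>?X. x \<noteq> y"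
    then have x: "x \<in> S2" "x$3 \<noteq> 1" by simp_all
    have pos: "1 - zonal_arg x y > 0" if "y \<in> ?X" for y
    proof -
      have "y \<in> S2" "x \<noteq> y" using that E ne by auto
      then show ?thesis using zonal_arg_bounds[OF x(1)] zonal_arg_eq_1[OF x(1)] by force
    qed
    have "log_value N x c = ln K + (\<Sum>y\<in>?X. ln (1 - zonal_arg x y))"
    proof -
      have "ln (\<Prod>y\<in>?X. 1 - zonal_arg x y) = (\<Sum>y\<in>?X. ln (1 - zonal_arg x y))"
        by (rule ln_prod[OF E(1)]) (use pos in force)
      moreover have "(\<Prod>y\<in>?X. 1 - zonal_arg x y) > 0" by (rule prod_pos) (rule pos)
      ultimately show ?thesis
        unfolding log_value_def K(2)[OF x] using K(1) by (simp add: ln_mult_pos)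
    qed
    then show "f x * log_value N x c = f x * ln K + (\<Sum>y\<in>?X. f x * ln (1 - zonal_arg x y))"
      by (simp add: distrib_left sum_distrib_left)
  qed
  have fm: "f \<in> borel_measurable sphere_measure" by (rule continuous_on_S2_measurable[OF cf])
  have lk: "integrable sphere_measure (\<lambda>x. f x * ln (1 - zonal_arg x y))"
    "(LINT x|sphere_measure. f x * ln (1 - zonal_arg x y)) = - f y / eigval l" if "y \<in> ?X" for y
    using log_kernel[OF f l, of y] that E by auto
  have cm: "c' \<in> space (coeff_space N) \<Longrightarrow> (\<lambda>x. log_value N x c') \<in> borel_measurable sphere_measure" for c'
    by measurable
  have lm: "(\<lambda>x. log_value N x c) \<in> borel_measurable sphere_measure"
  proof -
    have "log_value N x c = log_value N x (restrict c {0..N})" for x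
      by (simp add: log_value_def elliptic_value_def)
    then show ?thesis using cm[of "restrict c {0..N}"] by (simp add: coeff_space_def space_PiM)
  qed
  have "log_integral N f c = (LINT x|sphere_measure. f x * ln K + (\<Sum>y\<in>?X. f x * ln (1 - zonal_arg x y)))"
    unfolding log_integral_def
  proof (rule integral_cong_AE[OF _ _ eq])
    show "(\<lambda>x. f x * log_value N x c) \<in> borel_measurable sphere_measure"
      by (rule borel_measurable_times[OF fm lm])
    show "(\<lambda>x. f x * ln K + (\<Sum>y\<in>?X. f x * ln (1 - zonal_arg x y))) \<in> borel_measurable sphere_measure"
      by (intro borel_measurable_add borel_measurable_times borel_measurable_const fm borel_measurable_sum
          lk(1)[THEN borel_measurable_integrable])
  qed
  also have "\<dots> = (LINT x|sphere_measure. f x) * ln K + (\<Sum>y\<in>?X. LINT x|sphere_measure. f x * ln (1 - zonal_arg x y))"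
    using lk(1) continuous_on_S2_integrable[OF cf] by simp
  also have "\<dots> = (\<Sum>y\<in>?X. - f y / eigval l)"
    by (simp add: spherical_harmonic_mean_zero[OF f l] lk(2))
  also have "\<dots> = - (\<Sum>y\<in>?X. f y) / eigval l"
    by (simp add: sum_negf sum_divide_distrib)
  finally show ?thesis using ev by (simp add: field_simps)
qed

section \<open>The random point configurations\<close>

text \<open>For sums over the zeros, which agree with measurable expressions only almost surely.\<close>

lemma borel_measurable_completion_AE:
  fixes f g :: "'a \<Rightarrow> real"
  assumes g: "g \<in> borel_measurable M" and eq: "AE x in M. f x = g x"
  shows "f \<in> borel_measurable (completion M)"
proof (rule measurableI)
  fix S :: "real set" assume S: "S \<in> sets borel"
  have gs: "g -` S \<inter> space M \<in> sets (completion M)" using measurable_sets[OF g S] by (rule sets_completionI_sets)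
  have ae: "AE x in completion M. (x \<in> g -` S \<inter> space M) = (x \<in> f -` S \<inter> space M)"
    using AE_completion[OF eq] by eventually_elim auto
  have "f -` S \<inter> space M \<in> sets (completion M)"
    by (rule completion.in_sets_AE[OF ae gs]) simp
  then show "f -` S \<inter> space (completion M) \<in> sets (completion M)" by simp
qed simp

text \<open>The degrees may be arbitrarily dependent on each other: every estimate concerns a single degree.\<close>

locale random_elliptic = prob_space M for M :: "'w measure" +
  fixes A :: "nat \<Rightarrow> nat \<Rightarrow> 'w \<Rightarrow> complex" and X :: "nat \<Rightarrow> 'w \<Rightarrow> (real^3) set"
  assumes indep: "\<And>N. N \<ge> 1 \<Longrightarrow> indep_vars (\<lambda>_. borel) (A N) {0..N}"
    and gauss: "\<And>N n. N \<ge> 1 \<Longrightarrow> n \<le> N \<Longrightarrow> std_complex_gaussian M (A N n)"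
    and X: "\<And>N \<omega>. X N \<omega> = elliptic_points N (\<lambda>n. A N n \<omega>)"
begin

definition coeffs :: "nat \<Rightarrow> 'w \<Rightarrow> nat \<Rightarrow> complex" where
  "coeffs N \<omega> = (\<lambda>n\<in>{0..N}. A N n \<omega>)"

lemma distr_A: "N \<ge> 1 \<Longrightarrow> n \<le> N \<Longrightarrow> distr M borel (A N n) = cgauss"
  using distributed_distr_eq_density[OF gauss[unfolded std_complex_gaussian_def], of N n]
  by (simp add: cgauss_def cong: distr_cong)

lemma A_measurable: "N \<ge> 1 \<Longrightarrow> n \<le> N \<Longrightarrow> A N n \<in> borel_measurable M"
  using distributed_measurable[OF gauss[unfolded std_complex_gaussian_def], of N n] by simp

lemma coeffs_law:
  assumes N: "N \<ge> 1"
  shows "coeffs N \<in> M \<rightarrow>\<^sub>M coeff_space N" "distr M (coeff_space N) (coeffs N) = coeff_space N"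
proof -
  have sets: "sets (PiM {0..N} (\<lambda>_. borel)) = sets (coeff_space N)"
    unfolding coeff_space_def by (rule sets_PiM_cong) auto
  show "coeffs N \<in> M \<rightarrow>\<^sub>M coeff_space N"
    unfolding coeff_space_def coeffs_def[abs_def]
    by (rule measurable_restrict) (use A_measurable[OF N] in \<open>simp add: measurable_cong_sets[OF refl sets_cgauss]\<close>)
  have "distr M (PiM {0..N} (\<lambda>_. borel)) (\<lambda>\<omega>. \<lambda>n\<in>{0..N}. A N n \<omega>) = PiM {0..N} (\<lambda>n. distr M borel (A N n))"
    using indep[OF N] by (subst (asm) indep_vars_iff_distr_eq_PiM') (auto intro: A_measurable[OF N])
  also have "\<dots> = coeff_space N"
    unfolding coeff_space_def by (rule PiM_cong) (auto simp: distr_A[OF N])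
  finally show "distr M (coeff_space N) (coeffs N) = coeff_space N"
    unfolding coeffs_def[abs_def] using sets by (simp cong: distr_cong)
qed

lemma X_coeffs: "X N \<omega> = elliptic_points N (coeffs N \<omega>)"
proof -
  have "elliptic_poly N (\<lambda>n. A N n \<omega>) = elliptic_poly N (coeffs N \<omega>)"
    by (rule poly_eqI) (simp add: coeff_elliptic_poly coeffs_def)
  then show ?thesis by (simp add: X elliptic_points_def)
qed

lemma AE_simple: "N \<ge> 1 \<Longrightarrow> AE \<omega> in M. simple_elliptic N (coeffs N \<omega>)"
proof -
  assume N: "N \<ge> 1"
  have "AE c in distr M (coeff_space N) (coeffs N). simple_elliptic N c"
    unfolding coeffs_law(2)[OF N] by (rule AE_simple_elliptic[OF N])
  then show ?thesis by (rule AE_distrD[OF coeffs_law(1)[OF N]])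
qed

lemma AE_X: "N \<ge> 1 \<Longrightarrow> AE \<omega> in M. X N \<omega> \<subseteq> S2 \<and> finite (X N \<omega>) \<and> card (X N \<omega>) = N"
proof -
  assume "N \<ge> 1"
  from AE_simple[OF this] show ?thesis
  proof eventually_elim
    case (elim \<omega>)
    show ?case unfolding X_coeffs using elliptic_points_card[OF elim] by blast
  qed
qed

lemma harmonic_statistic_AE:
  assumes N: "N \<ge> 1" and f: "f \<in> spherical_harmonics l" and l: "l \<ge> 1"
  shows "AE \<omega> in M. (\<Sum>x\<in>X N \<omega>. f x) = - eigval l * log_integral N f (coeffs N \<omega>)"
  using AE_simple[OF N] by eventually_elim (simp add: X_coeffs sum_over_zeros[OF f l])

lemma harmonic_statistic_second_moment:
  assumes N: "N \<ge> 1" and f: "f \<in> spherical_harmonics l" and l: "l \<ge> 1"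
  shows "(\<integral>\<^sup>+\<omega>. ennreal ((\<Sum>x\<in>X N \<omega>. f x)\<^sup>2) \<partial>M) =
    ennreal ((eigval l)\<^sup>2 * stat_const N l * (LINT x|sphere_measure. (f x)\<^sup>2))"
proof -
  note m = log_integral_second_moment[OF f l, of N]
  have "(\<integral>\<^sup>+\<omega>. ennreal ((\<Sum>x\<in>X N \<omega>. f x)\<^sup>2) \<partial>M) =
      (\<integral>\<^sup>+\<omega>. ennreal ((eigval l)\<^sup>2 * (log_integral N f (coeffs N \<omega>))\<^sup>2) \<partial>M)"
    using harmonic_statistic_AE[OF N f l] by (intro nn_integral_cong_AE) (auto elim!: eventually_mono simp: power_mult_distrib)
  also have "\<dots> = (\<integral>\<^sup>+c. ennreal ((eigval l)\<^sup>2 * (log_integral N f c)\<^sup>2) \<partial>distr M (coeff_space N) (coeffs N))"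
    by (rule nn_integral_distr[symmetric, OF coeffs_law(1)[OF N]]) (use m(1) in simp)
  also have "\<dots> = (\<integral>\<^sup>+c. ennreal ((eigval l)\<^sup>2 * (log_integral N f c)\<^sup>2) \<partial>coeff_space N)"
    by (simp only: coeffs_law(2)[OF N])
  also have "\<dots> = ennreal (LINT c|coeff_space N. (eigval l)\<^sup>2 * (log_integral N f c)\<^sup>2)"
    by (rule nn_integral_eq_integral) (use m(2) in auto)
  finally show ?thesis by (simp add: m(3) mult.assoc)
qed

end

locale random_elliptic_harmonic = random_elliptic M A X + harmonic_bases Y
  for M :: "'w measure" and A X Y
begin

lemma Y_statistic_measurable:
  assumes N: "N \<ge> 1" and k: "k \<in> {1..2*l+1}"
  shows "\<exists>G\<in>borel_measurable M. AE \<omega> in M. (\<Sum>x\<in>X N \<omega>. Y l k x) = G \<omega>"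
proof (cases "l = 0")
  case True
  have "AE \<omega> in M. (\<Sum>x\<in>X N \<omega>. Y l k x) = real N * (LINT x|sphere_measure. Y l k x)"
    using AE_X[OF N]
  proof eventually_elim
    case (elim \<omega>)
    have "(\<Sum>x\<in>X N \<omega>. Y l k x) = (\<Sum>x\<in>X N \<omega>. LINT x|sphere_measure. Y l k x)"
      using elim Y_harmonic[OF k] True by (intro sum.cong refl harmonic_degree_0_const) auto
    then show ?case using elim by simp
  qed
  then show ?thesis by (intro bexI[of _ "\<lambda>_. real N * (LINT x|sphere_measure. Y l k x)"]) auto
next
  case False
  then have l: "l \<ge> 1" by simp
  have "log_integral N (Y l k) \<in> borel_measurable (coeff_space N)"
    by (rule log_integral_second_moment(1)[OF Y_harmonic[OF k] l])
  from measurable_compose[OF coeffs_law(1)[OF N] this]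
  have "(\<lambda>\<omega>. - eigval l * log_integral N (Y l k) (coeffs N \<omega>)) \<in> borel_measurable M" by simp
  from bexI[where P="\<lambda>G. AE \<omega> in M. (\<Sum>x\<in>X N \<omega>. Y l k x) = G \<omega>", OF harmonic_statistic_AE[OF N Y_harmonic[OF k] l] this]
  show ?thesis .
qed

text \<open>For spherical harmonics the sum over the zeros is almost surely a multiple of \<open>log_integral\<close>, which
  is measurable. Uniform approximation by harmonics extends this to all continuous functions.\<close>

lemma statistic_measurable:
  fixes f :: "real^3 \<Rightarrow> real"
  assumes N: "N \<ge> 1" and f: "continuous_on S2 f"
  shows "(\<lambda>\<omega>. \<Sum>x\<in>X N \<omega>. f x) \<in> borel_measurable (completion M)"
proof -
  have "\<forall>j::nat. \<exists>n b. \<forall>y\<in>S2. \<bar>(\<Sum>l\<le>n. b l * (\<Sum>k=1..2*l+1. fcoeff Y f l k * Y l k y)) - f y\<bar> < 1 / real (Suc j)"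
    by (intro allI harmonics_dense[OF f]) simp
  from choice[OF this] obtain n where "\<forall>j::nat. \<exists>b. \<forall>y\<in>S2.
      \<bar>(\<Sum>l\<le>n j. b l * (\<Sum>k=1..2*l+1. fcoeff Y f l k * Y l k y)) - f y\<bar> < 1 / real (Suc j)" by blast
  from choice[OF this] obtain b where nb: "\<And>j y. y \<in> S2 \<Longrightarrow>
      \<bar>(\<Sum>l\<le>n j. b j l * (\<Sum>k=1..2*l+1. fcoeff Y f l k * Y l k y)) - f y\<bar> < 1 / real (Suc j)" by blast
  define G where "G l k = (SOME G. G \<in> borel_measurable M \<and> (AE \<omega> in M. (\<Sum>x\<in>X N \<omega>. Y l k x) = G \<omega>))" for l k
  have G: "G l k \<in> borel_measurable M" "AE \<omega> in M. (\<Sum>x\<in>X N \<omega>. Y l k x) = G l k \<omega>"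
    if "k \<in> {1..2*l+1}" for l k
    using someI_ex[OF Y_statistic_measurable[OF N that, unfolded Bex_def]] unfolding G_def by blast+
  define H where "H j \<omega> = (\<Sum>l\<le>n j. b j l * (\<Sum>k=1..2*l+1. fcoeff Y f l k * G l k \<omega>))" for j \<omega>
  have Hm: "H j \<in> borel_measurable M" for j
    unfolding H_def[abs_def]
    by (intro borel_measurable_sum borel_measurable_times borel_measurable_const G(1))
  have "AE \<omega> in M. \<forall>l. \<forall>k. k \<in> {1..2*l+1} \<longrightarrow> (\<Sum>x\<in>X N \<omega>. Y l k x) = G l k \<omega>"
    unfolding AE_all_countable using G(2) by (auto intro: AE_impI)
  with AE_X[OF N] have lim: "AE \<omega> in M. (\<lambda>j. H j \<omega>) \<longlonglongrightarrow> (\<Sum>x\<in>X N \<omega>. f x)"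
  proof eventually_elim
    case (elim \<omega>)
    have H: "H j \<omega> = (\<Sum>x\<in>X N \<omega>. (\<Sum>l\<le>n j. b j l * (\<Sum>k=1..2*l+1. fcoeff Y f l k * Y l k x)))" for j
    proof -
      have "(\<Sum>x\<in>X N \<omega>. (\<Sum>l\<le>n j. b j l * (\<Sum>k=1..2*l+1. fcoeff Y f l k * Y l k x))) =
         (\<Sum>l\<le>n j. \<Sum>x\<in>X N \<omega>. b j l * (\<Sum>k=1..2*l+1. fcoeff Y f l k * Y l k x))" by (rule sum.swap)
      also have "\<dots> = (\<Sum>l\<le>n j. b j l * (\<Sum>k=1..2*l+1. fcoeff Y f l k * (\<Sum>x\<in>X N \<omega>. Y l k x)))"
      proof (rule sum.cong[OF refl])
        fix l
        have "(\<Sum>x\<in>X N \<omega>. \<Sum>k=1..2*l+1. fcoeff Y f l k * Y l k x) = (\<Sum>k=1..2*l+1. \<Sum>x\<in>X N \<omega>. fcoeff Y f l k * Y l k x)"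
          by (rule sum.swap)
        then show "(\<Sum>x\<in>X N \<omega>. b j l * (\<Sum>k=1..2*l+1. fcoeff Y f l k * Y l k x)) =
            b j l * (\<Sum>k=1..2*l+1. fcoeff Y f l k * (\<Sum>x\<in>X N \<omega>. Y l k x))"
          by (simp only: sum_distrib_left[symmetric])
      qed
      also have "\<dots> = H j \<omega>"
        unfolding H_def using elim(2) by (intro sum.cong refl arg_cong2[where f="(*)"]) auto
      finally show ?thesis by simp
    qed
    have bd: "\<bar>H j \<omega> - (\<Sum>x\<in>X N \<omega>. f x)\<bar> \<le> real N * (1 / real (Suc j))" for j
    proof -
      have "\<bar>H j \<omega> - (\<Sum>x\<in>X N \<omega>. f x)\<bar> \<le>
          (\<Sum>x\<in>X N \<omega>. \<bar>(\<Sum>l\<le>n j. b j l * (\<Sum>k=1..2*l+1. fcoeff Y f l k * Y l k x)) - f x\<bar>)"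
        unfolding H sum_subtractf[symmetric] by (rule sum_abs)
      also have "\<dots> \<le> (\<Sum>x\<in>X N \<omega>. 1 / real (Suc j))"
      proof (rule sum_mono)
        fix x assume "x \<in> X N \<omega>"
        then have "x \<in> S2" using elim(1) by blast
        then show "\<bar>(\<Sum>l\<le>n j. b j l * (\<Sum>k=1..2*l+1. fcoeff Y f l k * Y l k x)) - f x\<bar> \<le> 1 / real (Suc j)"
          by (intro less_imp_le nb)
      qed
      finally show ?thesis using elim(1) by simp
    qed
    have l0: "(\<lambda>j. real N * (1 / real (Suc j))) \<longlonglongrightarrow> real N * 0"
      by (intro tendsto_mult tendsto_const LIMSEQ_Suc[OF lim_1_over_n])
    have "(\<lambda>j. H j \<omega> - (\<Sum>x\<in>X N \<omega>. f x)) \<longlonglongrightarrow> 0"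
    proof (rule Lim_null_comparison)
      show "\<forall>\<^sub>F j in sequentially. norm (H j \<omega> - (\<Sum>x\<in>X N \<omega>. f x)) \<le> real N * (1 / real (Suc j))"
        unfolding real_norm_def by (intro always_eventually allI bd)
      show "(\<lambda>j. real N * (1 / real (Suc j))) \<longlonglongrightarrow> 0"
        using l0 by (simp only: mult_zero_right)
    qed
    then show ?case by (rule LIM_zero_cancel)
  qed
  have "(\<lambda>\<omega>. lim (\<lambda>j. H j \<omega>)) \<in> borel_measurable M"
    by (rule borel_measurable_lim_metric) (rule Hm)
  moreover have "AE \<omega> in M. (\<Sum>x\<in>X N \<omega>. f x) = lim (\<lambda>j. H j \<omega>)"
    using lim by eventually_elim (simp add: limI)
  ultimately show ?thesis by (rule borel_measurable_completion_AE)
qed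

lemma X_random_configuration: "N \<ge> 1 \<Longrightarrow> random_configuration M N (X N)"
  unfolding random_configuration_def using AE_X statistic_measurable by blast

lemma Y_statistic_second_moment:
  assumes N: "N \<ge> 1" and k: "k \<in> {1..2*l+1}" and l: "l \<ge> 1"
  shows "(\<integral>\<^sup>+\<omega>. ennreal ((\<Sum>x\<in>X N \<omega>. Y l k x)\<^sup>2) \<partial>M) = ennreal ((eigval l)\<^sup>2 * stat_const N l)"
  using harmonic_statistic_second_moment[OF N Y_harmonic[OF k] l] Y_orthonormal[OF k k]
  by (simp add: power2_eq_square)

end

section \<open>Harmonic expansion of Sobolev functions and the worst-case error\<close>

lemma sobolev_weights_upper:
  assumes w: "sobolev_weights s a" and s: "s > 0"
  shows "\<exists>c>0. \<forall>l\<ge>1. a l \<le> c * real l powr (- 2 * s)"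
proof -
  obtain c where c: "c > 0" "\<And>l. a l \<le> c * (1 + (real l)\<^sup>2) powr (- s)" and pos: "\<And>l. a l > 0"
    using w unfolding sobolev_weights_def by blast
  have "a l \<le> c * real l powr (- 2 * s)" if l: "l \<ge> 1" for l
  proof -
    have "(1 + (real l)\<^sup>2) powr (- s) \<le> ((real l)\<^sup>2) powr (- s)"
      using l s by (intro powr_mono2') auto
    also have "((real l)\<^sup>2) powr (- s) = real l powr (- 2 * s)"
      using l by (simp add: powr_powr flip: powr_numeral)
    finally show "a l \<le> c * real l powr (- 2 * s)"
      using c(2)[of l] c(1) by (meson mult_left_mono less_imp_le order_trans)
  qed
  with c(1) show ?thesis by blast
qed

lemma sobolev_weights_summable:
  assumes w: "sobolev_weights s a" and s: "s > 1"
  shows "summable (\<lambda>l. a l * (2 * real l + 1))"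
proof -
  have pos: "a l > 0" for l using w by (simp add: sobolev_weights_def)
  obtain c where c: "c > 0" "\<And>l. l \<ge> 1 \<Longrightarrow> a l \<le> c * real l powr (- 2 * s)"
    using sobolev_weights_upper[OF w] s by auto
  have "summable (\<lambda>l. 3 * c * real l powr (1 - 2 * s))"
    using s by (intro summable_mult) (simp add: summable_real_powr_iff)
  then show ?thesis
  proof (rule summable_comparison_test')
    fix l :: nat assume l: "1 \<le> l"
    have "a l * (2 * real l + 1) \<le> c * real l powr (- 2 * s) * (3 * real l)"
      using l pos[of l] c(1) c(2)[OF l] by (intro mult_mono) auto
    also have "\<dots> = 3 * c * (real l powr (- 2 * s) * real l powr 1)" using l by simp
    also have "real l powr (- 2 * s) * real l powr 1 = real l powr (1 - 2 * s)"
      by (subst powr_add[symmetric]) (rule arg_cong[where f="(powr) (real l)"], simp)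
    finally show "norm (a l * (2 * real l + 1)) \<le> 3 * c * real l powr (1 - 2 * s)"
      using pos[of l] by simp
  qed
qed

lemma sobolev_weight_le:
  assumes w: "sobolev_weights s a" and s: "s \<ge> 0"
  shows "\<exists>c>0. \<forall>l. 1 / a l \<le> c * (1 + eigval l) powr s"
proof -
  obtain c where c: "c > 0" "\<And>l. c * (1 + (real l)\<^sup>2) powr (- s) \<le> a l" and pos: "\<And>l. a l > 0"
    using w unfolding sobolev_weights_def by blast
  have "1 / a l \<le> 1 / c * (1 + eigval l) powr s" for l
  proof -
    have "1 + (real l)\<^sup>2 > 0" by (rule add_pos_nonneg) auto
    then have p: "(1 + (real l)\<^sup>2) powr (- s) > 0" by simp
    have "1 / a l \<le> 1 / (c * (1 + (real l)\<^sup>2) powr (- s))"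
      using c pos[of l] p by (intro divide_left_mono mult_pos_pos) auto
    also have "\<dots> = 1 / c * (1 + (real l)\<^sup>2) powr s" by (simp add: powr_minus divide_inverse)
    also have "\<dots> \<le> 1 / c * (1 + eigval l) powr s"
      using c(1) s by (intro mult_left_mono powr_mono2) (auto simp: eigval_def power2_eq_square algebra_simps)
    finally show ?thesis .
  qed
  then show ?thesis using c(1) by (intro exI[of _ "1 / c"]) simp
qed

context harmonic_bases
begin

definition harmonic_part :: "(real^3 \<Rightarrow> real) \<Rightarrow> nat \<Rightarrow> real^3 \<Rightarrow> real" where
  "harmonic_part f l x = (\<Sum>k=1..2*l+1. fcoeff Y f l k * Y l k x)"

lemma harmonic_part_continuous: "continuous_on S2 (harmonic_part f l)"
  unfolding harmonic_part_def by (intro continuous_intros Y_continuous)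

lemma sobolev_summable:
  assumes w: "sobolev_weights s a" and s: "s \<ge> 0" and f: "f \<in> sobolev Y s"
  shows "summable (\<lambda>l. \<Sum>k=1..2*l+1. 1 / a l * \<bar>fcoeff Y f l k\<bar>\<^sup>2)"
proof -
  obtain c where c: "c > 0" "\<And>l. 1 / a l \<le> c * (1 + eigval l) powr s" using sobolev_weight_le[OF w s] by blast
  have pos: "a l > 0" for l using w by (simp add: sobolev_weights_def)
  have "summable (\<lambda>l. \<Sum>k=1..2*l+1. (1 + eigval l) powr s * \<bar>fcoeff Y f l k\<bar>\<^sup>2)"
    using f by (simp add: sobolev_def del: sum.cl_ivl_Suc)
  from summable_mult[OF this, of c] show ?thesis
  proof (rule summable_comparison_test'[where N=0])
    fix l
    have "(\<Sum>k=1..2*l+1. 1 / a l * \<bar>fcoeff Y f l k\<bar>\<^sup>2) \<le> (\<Sum>k=1..2*l+1. c * ((1 + eigval l) powr s * \<bar>fcoeff Y f l k\<bar>\<^sup>2))"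
      unfolding mult.assoc[symmetric] by (intro sum_mono mult_right_mono c(2)) auto
    moreover have "0 \<le> (\<Sum>k=1..2*l+1. 1 / a l * \<bar>fcoeff Y f l k\<bar>\<^sup>2)"
      using pos[of l] by (intro sum_nonneg) auto
    ultimately show "norm (\<Sum>k=1..2*l+1. 1 / a l * \<bar>fcoeff Y f l k\<bar>\<^sup>2) \<le> c * (\<Sum>k=1..2*l+1. (1 + eigval l) powr s * \<bar>fcoeff Y f l k\<bar>\<^sup>2)"
      by (simp only: sum_distrib_left[symmetric] real_norm_def abs_of_nonneg)
  qed
qed

lemma harmonic_part_bound:
  assumes pos: "a l > (0::real)" and x: "x \<in> S2"
  shows "\<bar>harmonic_part f l x\<bar> \<le> (\<Sum>k=1..2*l+1. 1 / a l * \<bar>fcoeff Y f l k\<bar>\<^sup>2) + a l * (2 * real l + 1)"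
proof -
  have "\<bar>harmonic_part f l x\<bar> \<le> (\<Sum>k=1..2*l+1. \<bar>fcoeff Y f l k * Y l k x\<bar>)"
    unfolding harmonic_part_def by (rule sum_abs)
  also have "\<dots> \<le> (\<Sum>k=1..2*l+1. 1 / a l * \<bar>fcoeff Y f l k\<bar>\<^sup>2 + a l * (Y l k x)\<^sup>2)"
  proof (rule sum_mono)
    fix k
    let ?u = "\<bar>fcoeff Y f l k\<bar> / sqrt (a l)" and ?v = "sqrt (a l) * \<bar>Y l k x\<bar>"
    have "\<bar>fcoeff Y f l k * Y l k x\<bar> = ?u * ?v" using pos by (simp add: abs_mult)
    also have "\<dots> \<le> ?u\<^sup>2 + ?v\<^sup>2"
      using abs_mult_le_sum_squares[of ?u ?v] pos by simp
    also have "\<dots> = 1 / a l * \<bar>fcoeff Y f l k\<bar>\<^sup>2 + a l * (Y l k x)\<^sup>2"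
      using pos by (simp add: power_divide power_mult_distrib)
    finally show "\<bar>fcoeff Y f l k * Y l k x\<bar> \<le> 1 / a l * \<bar>fcoeff Y f l k\<bar>\<^sup>2 + a l * (Y l k x)\<^sup>2" .
  qed
  also have "\<dots> = (\<Sum>k=1..2*l+1. 1 / a l * \<bar>fcoeff Y f l k\<bar>\<^sup>2) + a l * (\<Sum>k=1..2*l+1. (Y l k x)\<^sup>2)"
    by (simp only: sum.distrib sum_distrib_left)
  finally show ?thesis by (simp only: sum_Y_squares[OF x])
qed

lemma fcoeff_harmonic_part:
  assumes k: "k \<in> {1..2*m+1}"
  shows "(LINT x|sphere_measure. harmonic_part f l x * Y m k x) = (if l = m then fcoeff Y f m k else 0)"
proof -
  have "(LINT x|sphere_measure. harmonic_part f l x * Y m k x) =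
      (LINT x|sphere_measure. (\<Sum>j=1..2*l+1. fcoeff Y f l j * (Y l j x * Y m k x)))"
    by (simp only: harmonic_part_def sum_distrib_right mult.assoc)
  also have "\<dots> = (\<Sum>j=1..2*l+1. LINT x|sphere_measure. fcoeff Y f l j * (Y l j x * Y m k x))"
    by (rule Bochner_Integration.integral_sum)
       (intro continuous_on_S2_integrable continuous_intros Y_continuous k, assumption)
  also have "\<dots> = (\<Sum>j=1..2*l+1. if j = k \<and> l = m then fcoeff Y f l k else 0)"
    by (rule sum.cong[OF refl]) (subst integral_mult_right_zero, subst Y_orthonormal2[OF _ k], auto)
  also have "\<dots> = (if l = m then fcoeff Y f m k else 0)"
  proof (cases "l = m")
    case True
    then have "(\<Sum>j=1..2*l+1. if j = k \<and> l = m then fcoeff Y f l k else 0) = (\<Sum>j=1..2*l+1. if j = k then fcoeff Y f l k else 0)"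
      by simp
    also have "\<dots> = fcoeff Y f l k" using k True by (subst sum.delta) auto
    finally show ?thesis using True by simp
  qed simp
  finally show ?thesis .
qed

text \<open>The series converges uniformly, because degree \<open>l\<close> is dominated by its Sobolev energy plus
  \<open>a l * (2 * l + 1)\<close>, and both are summable for \<open>s > 1\<close>. Its sum is continuous with the same
  coefficients as \<open>f\<close>, so completeness identifies it.\<close>

theorem harmonic_expansion:
  assumes w: "sobolev_weights s a" and s: "s > 1" and f: "f \<in> sobolev Y s" and cf: "continuous_on S2 f" and x: "x \<in> S2"
  shows "(\<lambda>l. harmonic_part f l x) sums f x"
proof -
  define b where "b l = (\<Sum>k=1..2*l+1. 1 / a l * \<bar>fcoeff Y f l k\<bar>\<^sup>2) + a l * (2 * real l + 1)" for l
  have pos: "a l > 0" for l using w by (simp add: sobolev_weights_def)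
  have sb: "summable b" unfolding b_def
    using sobolev_summable[OF w _ f] sobolev_weights_summable[OF w s] s by (intro summable_add) auto
  have bd: "\<bar>harmonic_part f l x\<bar> \<le> b l" if "x \<in> S2" for l x
    unfolding b_def by (rule harmonic_part_bound[OF pos that])
  define g where "g x = (\<Sum>l. harmonic_part f l x)" for x
  have sm: "summable (\<lambda>l. harmonic_part f l x)" if "x \<in> S2" for x
    by (rule summable_comparison_test'[OF sb, of 0]) (use bd[OF that] in simp)
  have "uniform_limit S2 (\<lambda>n x. \<Sum>l<n. harmonic_part f l x) g sequentially"
    unfolding g_def by (rule Weierstrass_m_test[OF _ sb]) (use bd in simp)
  then have cg: "continuous_on S2 g"
    by (rule uniform_limit_theorem[rotated]) (auto intro!: always_eventually continuous_on_sum harmonic_part_continuous)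
  have "fcoeff Y g m k = fcoeff Y f m k" if k: "k \<in> {1..2*m+1}" for m k
  proof -
    let ?t = "\<lambda>l x. harmonic_part f l x * Y m k x"
    obtain B where B: "B > 0" "\<And>x. x \<in> S2 \<Longrightarrow> \<bar>Y m k x\<bar> \<le> B"
      by (rule continuous_on_S2_bounded[OF Y_continuous[OF k]]) blast
    have i: "integrable sphere_measure (?t l)" for l
      by (intro continuous_on_S2_integrable continuous_intros harmonic_part_continuous Y_continuous k)
    have tb: "norm (?t l x) \<le> b l * B" if "x \<in> S2" for l x
      using mult_mono[OF bd[OF that] B(2)[OF that]] bd[OF that, of l] by (simp add: abs_mult)
    have ae: "AE x in sphere_measure. summable (\<lambda>l. norm (?t l x))"
    proof (rule AE_I2)
      fix x assume "x \<in> space sphere_measure"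
      then show "summable (\<lambda>l. norm (?t l x))"
        by (intro summable_comparison_test'[OF summable_mult2[OF sb, of B], of 0]) (use tb[of x] in simp)
    qed
    have sn: "summable (\<lambda>l. LINT x|sphere_measure. norm (?t l x))"
    proof (rule summable_comparison_test'[OF summable_mult2[OF sb, of B], of 0])
      fix l
      have "(LINT x|sphere_measure. norm (?t l x)) \<le> (LINT x|sphere_measure. b l * B)"
        by (rule integral_mono) (use i tb in auto)
      then show "norm (LINT x|sphere_measure. norm (?t l x)) \<le> b l * B"
        using sphere.prob_space by simp
    qed
    have "(\<lambda>l. LINT x|sphere_measure. ?t l x) sums (LINT x|sphere_measure. (\<Sum>l. ?t l x))"
      by (rule sums_integral[OF i ae sn])
    also have "(\<lambda>l. LINT x|sphere_measure. ?t l x) = (\<lambda>l. if l = m then fcoeff Y f m k else 0)"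
      by (rule ext) (rule fcoeff_harmonic_part[OF k])
    also have "(LINT x|sphere_measure. (\<Sum>l. ?t l x)) = fcoeff Y g m k"
      unfolding fcoeff_def g_def
      by (rule Bochner_Integration.integral_cong[OF refl]) (rule suminf_mult2[symmetric], rule sm, simp)
    finally have "(\<lambda>l. if l = m then fcoeff Y f m k else 0) sums fcoeff Y g m k" .
    moreover have "(\<lambda>l. if l = m then fcoeff Y f m k else 0) sums fcoeff Y f m k"
      using sums_single[of m "\<lambda>_. fcoeff Y f m k"] by simp
    ultimately show ?thesis by (rule sums_unique2)
  qed
  then have "fcoeff Y (\<lambda>x. f x - g x) m k = 0" if "k \<in> {1..2*m+1}" for m k
  proof -
    have "fcoeff Y (\<lambda>x. f x - g x) m k = fcoeff Y f m k - fcoeff Y g m k"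
      unfolding fcoeff_def left_diff_distrib
      by (rule Bochner_Integration.integral_diff)
         (intro continuous_on_S2_integrable continuous_intros cf cg Y_continuous that)+
    then show ?thesis using \<open>\<And>m k. k \<in> {1..2*m+1} \<Longrightarrow> fcoeff Y g m k = fcoeff Y f m k\<close>[OF that] by simp
  qed
  from harmonics_complete[OF _ this x] have "f x = g x" using cf cg by (auto intro: continuous_on_diff)
  then show ?thesis using summable_sums[OF sm[OF x]] by (simp add: g_def)
qed

text \<open>The squared norm, in the dual of the Sobolev space, of the quadrature error for the points \<open>X\<close>.
  Degree zero is absent because constants are integrated exactly.\<close>

definition wce_bound :: "(nat \<Rightarrow> real) \<Rightarrow> (real^3) set \<Rightarrow> ennreal" where
  "wce_bound a X = (\<Sum>i. ennreal (a (Suc i)) * (\<Sum>k=1..2*Suc i+1. ennreal (((\<Sum>x\<in>X. Y (Suc i) k x) / real (card X))\<^sup>2)))"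

text \<open>Cauchy-Schwarz applied to the harmonic expansion of the error.\<close>

lemma quadrature_error_le:
  assumes w: "sobolev_weights s a" and s: "s > 1" and f: "f \<in> sobolev Y s" and cf: "continuous_on S2 f"
    and n: "sobolev_norm Y a f \<le> 1" and X: "finite X" "X \<subseteq> S2" "X \<noteq> {}"
    and W: "wce_bound a X = ennreal W" "W \<ge> 0"
  shows "((\<Sum>x\<in>X. f x) / real (card X) - (LINT x|sphere_measure. f x))\<^sup>2 \<le> W"
proof -
  have pos: "a l > 0" for l using w by (simp add: sobolev_weights_def)
  define S where "S l k = (\<Sum>x\<in>X. Y l k x) / real (card X)" for l k
  define c where "c = fcoeff Y f"
  have cX: "real (card X) > 0" using X by (simp add: card_gt_0_iff)
  have avg: "(\<lambda>l. \<Sum>k=1..2*l+1. c l k * S l k) sums ((\<Sum>x\<in>X. f x) / real (card X))"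
  proof -
    have "(\<lambda>l. \<Sum>x\<in>X. harmonic_part f l x) sums (\<Sum>x\<in>X. f x)"
      by (rule sums_sum) (rule harmonic_expansion[OF w s f cf], use X in blast)
    from sums_divide[OF this, of "real (card X)"]
    have "(\<lambda>l. (\<Sum>x\<in>X. harmonic_part f l x) / real (card X)) sums ((\<Sum>x\<in>X. f x) / real (card X))" .
    moreover have "(\<Sum>x\<in>X. harmonic_part f l x) / real (card X) = (\<Sum>k=1..2*l+1. c l k * S l k)" for l
    proof -
      have "(\<Sum>x\<in>X. harmonic_part f l x) = (\<Sum>k=1..2*l+1. \<Sum>x\<in>X. c l k * Y l k x)"
        unfolding harmonic_part_def c_def by (rule sum.swap)
      also have "\<dots> / real (card X) = (\<Sum>k=1..2*l+1. c l k * S l k)"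
        unfolding S_def sum_divide_distrib by (simp only: sum_distrib_left[symmetric] times_divide_eq_right sum_divide_distrib[symmetric])
      finally show ?thesis .
    qed
    ultimately show ?thesis by (simp only:)
  qed
  \<comment> \<open>Degree zero contributes the integral of \<open>f\<close>, so it cancels in the error.\<close>
  have zero: "(\<Sum>k=1..2*0+1. c 0 k * S 0 k) = (LINT x|sphere_measure. f x)"
  proof -
    have k: "1 \<in> {1..2*0+1::nat}" by simp
    define K where "K = (LINT x|sphere_measure. Y 0 1 x)"
    have Y0: "Y 0 1 x = K" if "x \<in> S2" for x
      using harmonic_degree_0_const[OF Y_harmonic[OF k] that] by (simp add: K_def)
    have "(LINT x|sphere_measure. Y 0 1 x * Y 0 1 x) = (LINT x|sphere_measure. K * K)"
      by (rule Bochner_Integration.integral_cong) (simp_all only: Y0 sphere_measure_space)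
    then have K2: "K * K = 1" using Y_orthonormal[OF k k] sphere.prob_space by simp
    have "c 0 1 = (LINT x|sphere_measure. f x * K)"
      unfolding c_def fcoeff_def by (rule Bochner_Integration.integral_cong) (simp_all only: Y0 sphere_measure_space)
    moreover have "S 0 1 = K"
    proof -
      have "(\<Sum>x\<in>X. Y 0 1 x) = (\<Sum>x\<in>X. K)" by (rule sum.cong) (use X Y0 in blast)+
      then show ?thesis using cX by (simp add: S_def)
    qed
    ultimately show ?thesis using K2 by (simp add: mult.assoc)
  qed
  let ?d = "(\<Sum>x\<in>X. f x) / real (card X) - (LINT x|sphere_measure. f x)"
  have diff: "(\<lambda>i. \<Sum>k=1..2*Suc i+1. c (Suc i) k * S (Suc i) k) sums ?d"
    using avg zero sums_Suc_iff[of "\<lambda>l. \<Sum>k=1..2*l+1. c l k * S l k" ?d]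
    by (simp only: diff_add_cancel)
  have c1: "(\<Sum>l<n. \<Sum>k=1..2*l+1. 1 / a l * (c l k)\<^sup>2) \<le> 1" for n
  proof -
    have sm: "summable (\<lambda>l. \<Sum>k=1..2*l+1. 1 / a l * \<bar>c l k\<bar>\<^sup>2)"
      unfolding c_def by (rule sobolev_summable[OF w _ f]) (use s in simp)
    have "(\<Sum>l. \<Sum>k=1..2*l+1. 1 / a l * \<bar>c l k\<bar>\<^sup>2) \<le> 1"
      using n unfolding sobolev_norm_def c_def by (simp only: real_sqrt_le_1_iff)
    moreover have "(\<Sum>l<n. \<Sum>k=1..2*l+1. 1 / a l * \<bar>c l k\<bar>\<^sup>2) \<le> (\<Sum>l. \<Sum>k=1..2*l+1. 1 / a l * \<bar>c l k\<bar>\<^sup>2)"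
      by (rule sum_le_suminf[OF sm]) (auto intro!: sum_nonneg simp: pos less_imp_le simp del: sum.cl_ivl_Suc)
    ultimately show ?thesis by (simp only: power2_abs)
  qed
  have W1: "(\<Sum>i<n. \<Sum>k=1..2*Suc i+1. a (Suc i) * (S (Suc i) k)\<^sup>2) \<le> W" for n
  proof -
    let ?g = "\<lambda>i. ennreal (a (Suc i)) * (\<Sum>k=1..2*Suc i+1. ennreal ((S (Suc i) k)\<^sup>2))"
    have g: "?g i = ennreal (\<Sum>k=1..2*Suc i+1. a (Suc i) * (S (Suc i) k)\<^sup>2)" for i
      using pos[of "Suc i"] by (simp only: sum_ennreal zero_le_power2 sum_distrib_left[symmetric])
        (rule ennreal_mult[symmetric], auto intro!: sum_nonneg simp del: sum.cl_ivl_Suc)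
    have "ennreal (\<Sum>i<n. \<Sum>k=1..2*Suc i+1. a (Suc i) * (S (Suc i) k)\<^sup>2) = (\<Sum>i<n. ?g i)"
      unfolding g by (rule sum_ennreal[symmetric]) (auto intro!: sum_nonneg simp: pos less_imp_le simp del: sum.cl_ivl_Suc)
    also have "\<dots> \<le> (\<Sum>i. ?g i)" by (rule sum_le_suminf) auto
    also have "\<dots> = ennreal W" using W by (simp only: wce_bound_def S_def)
    finally show ?thesis using W(2) by (simp only: ennreal_le_iff)
  qed
  have part: "(\<Sum>i<n. \<Sum>k=1..2*Suc i+1. c (Suc i) k * S (Suc i) k)\<^sup>2 \<le> W" for n
  proof -
    let ?P = "Sigma {..<n} (\<lambda>i. {1..2*Suc i+1})"
    let ?u = "\<lambda>(i, k). c (Suc i) k / sqrt (a (Suc i))" and ?v = "\<lambda>(i, k). sqrt (a (Suc i)) * S (Suc i) k"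
    have e: "(\<Sum>i<n. \<Sum>k=1..2*Suc i+1. c (Suc i) k * S (Suc i) k) = (\<Sum>p\<in>?P. ?u p * ?v p)"
    proof (subst sum.Sigma)
      show "(\<Sum>(i, k)\<in>?P. c (Suc i) k * S (Suc i) k) = (\<Sum>p\<in>?P. ?u p * ?v p)"
      proof (rule sum.cong[OF refl])
        fix p assume "p \<in> ?P"
        show "(case p of (i, k) \<Rightarrow> c (Suc i) k * S (Suc i) k) = ?u p * ?v p"
          using pos[of "Suc (fst p)"] by (simp add: case_prod_beta)
      qed
    qed auto
    have CS: "(\<Sum>p\<in>?P. ?u p * ?v p)\<^sup>2 \<le> (\<Sum>p\<in>?P. (?u p)\<^sup>2) * (\<Sum>p\<in>?P. (?v p)\<^sup>2)"
      by (rule Cauchy_Schwarz_ineq_sum)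
    have u2: "(\<Sum>p\<in>?P. (?u p)\<^sup>2) = (\<Sum>i<n. \<Sum>k=1..2*Suc i+1. 1 / a (Suc i) * (c (Suc i) k)\<^sup>2)"
    proof (subst sum.Sigma)
      show "(\<Sum>p\<in>?P. (?u p)\<^sup>2) = (\<Sum>(i, k)\<in>?P. 1 / a (Suc i) * (c (Suc i) k)\<^sup>2)"
      proof (rule sum.cong[OF refl])
        fix p assume "p \<in> ?P"
        show "(?u p)\<^sup>2 = (case p of (i, k) \<Rightarrow> 1 / a (Suc i) * (c (Suc i) k)\<^sup>2)"
          using pos[of "Suc (fst p)"] by (simp add: case_prod_beta power_divide)
      qed
    qed auto
    have v2: "(\<Sum>p\<in>?P. (?v p)\<^sup>2) = (\<Sum>i<n. \<Sum>k=1..2*Suc i+1. a (Suc i) * (S (Suc i) k)\<^sup>2)"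
    proof (subst sum.Sigma)
      show "(\<Sum>p\<in>?P. (?v p)\<^sup>2) = (\<Sum>(i, k)\<in>?P. a (Suc i) * (S (Suc i) k)\<^sup>2)"
      proof (rule sum.cong[OF refl])
        fix p assume "p \<in> ?P"
        show "(?v p)\<^sup>2 = (case p of (i, k) \<Rightarrow> a (Suc i) * (S (Suc i) k)\<^sup>2)"
          using pos[of "Suc (fst p)"] by (simp add: case_prod_beta power_mult_distrib)
      qed
    qed auto
    have u1: "(\<Sum>p\<in>?P. (?u p)\<^sup>2) \<le> 1"
    proof -
      have "(\<Sum>i<n. \<Sum>k=1..2*Suc i+1. 1 / a (Suc i) * (c (Suc i) k)\<^sup>2) \<le> (\<Sum>l<Suc n. \<Sum>k=1..2*l+1. 1 / a l * (c l k)\<^sup>2)"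
        unfolding sum.lessThan_Suc_shift
        using sum_nonneg[of "{1..2*0+1}" "\<lambda>k. 1 / a 0 * (c 0 k)\<^sup>2"] pos[of 0] by simp
      with c1[of "Suc n"] show ?thesis unfolding u2 by (rule order_trans[rotated])
    qed
    have "(\<Sum>p\<in>?P. (?u p)\<^sup>2) * (\<Sum>p\<in>?P. (?v p)\<^sup>2) \<le> 1 * W"
      by (rule mult_mono[OF u1]) (use W1[of n] in \<open>simp_all only: v2 zero_le_one\<close>, intro sum_nonneg mult_nonneg_nonneg zero_le_power2 less_imp_le[OF pos])
    with CS show ?thesis unfolding e by (simp only: mult_1)
  qed
  have "(\<lambda>n. (\<Sum>i<n. \<Sum>k=1..2*Suc i+1. c (Suc i) k * S (Suc i) k)\<^sup>2) \<longlonglongrightarrow> ?d\<^sup>2"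
    using diff unfolding sums_def by (rule tendsto_power)
  then show ?thesis by (rule LIMSEQ_le_const2) (use part in blast)
qed

lemma wce_sq_le:
  assumes w: "sobolev_weights s (a s)" and s: "s > 1" and X: "finite X" "X \<subseteq> S2" "X \<noteq> {}"
  shows "(wce Y a s X)\<^sup>2 \<le> wce_bound (a s) X"
proof (cases "wce_bound (a s) X = \<top>")
  case False
  then obtain W where W: "wce_bound (a s) X = ennreal W" "W \<ge> 0" by (cases "wce_bound (a s) X") auto
  have "wce Y a s X \<le> ennreal (sqrt W)"
    unfolding wce_def
  proof (rule SUP_least)
    fix f assume "f \<in> {f \<in> sobolev Y s. continuous_on S2 f \<and> sobolev_norm Y (a s) f \<le> 1}"
    then have f: "f \<in> sobolev Y s" "continuous_on S2 f" "sobolev_norm Y (a s) f \<le> 1" by auto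
    show "ennreal \<bar>(\<Sum>x\<in>X. f x) / real (card X) - (LINT x|sphere_measure. f x)\<bar> \<le> ennreal (sqrt W)"
      using quadrature_error_le[OF w s f X W] by (intro ennreal_leI) (rule real_le_rsqrt, simp)
  qed
  then have "(wce Y a s X)\<^sup>2 \<le> (ennreal (sqrt W))\<^sup>2" by (rule power_mono) simp
  also have "\<dots> = ennreal W" using W(2) by (simp add: ennreal_power)
  finally show ?thesis using W(1) by simp
qed simp

end

section \<open>Summing the variances\<close>

lemma sum_odd_real: "(\<Sum>j<l. 2 * real j + 1) = (real l)\<^sup>2"
  by (induction l) (simp_all add: power2_eq_square algebra_simps)

text \<open>Each factor is \<open>1 - (2 * j + 1) / (n + 1 + j)\<close>, and the odd numbers below \<open>2 * l\<close> add up to the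
  square of \<open>l\<close>.\<close>

lemma funk_hecke_gaussian_bound:
  assumes n: "n \<ge> 1" shows "funk_hecke n l \<le> exp (- (real l)\<^sup>2 / (2 * real n)) / real n"
proof (cases "n < l")
  case False
  have "(\<Prod>j<l. (real n - real j) / (real n + 1 + real j)) \<le> (\<Prod>j<l. exp (- (2 * real j + 1) / (2 * real n)))"
  proof (intro prod_mono conjI)
    fix j assume "j \<in> {..<l}"
    then have j: "real j + 1 \<le> real n" using False by simp
    then show "0 \<le> (real n - real j) / (real n + 1 + real j)" by simp
    have "(real n - real j) / (real n + 1 + real j) = 1 + (- (2 * real j + 1) / (real n + 1 + real j))"
      by (simp add: field_simps)
    also have "\<dots> \<le> exp (- (2 * real j + 1) / (real n + 1 + real j))" by (rule exp_ge_add_one_self)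
    also have "\<dots> \<le> exp (- (2 * real j + 1) / (2 * real n))"
    proof -
      have "(2 * real j + 1) / (2 * real n) \<le> (2 * real j + 1) / (real n + 1 + real j)"
        using j n by (intro frac_le) auto
      then show ?thesis by (simp only: exp_le_cancel_iff minus_divide_left[symmetric] neg_le_iff_le)
    qed
    finally show "(real n - real j) / (real n + 1 + real j) \<le> exp (- (2 * real j + 1) / (2 * real n))" .
  qed
  also have "\<dots> = exp (\<Sum>j<l. - (2 * real j + 1) / (2 * real n))" by (simp add: exp_sum)
  also have "(\<Sum>j<l. - (2 * real j + 1) / (2 * real n)) = - (real l)\<^sup>2 / (2 * real n)"
    by (simp only: sum_divide_distrib[symmetric] sum_negf sum_odd_real)
  finally have P: "(\<Prod>j<l. (real n - real j) / (real n + 1 + real j)) \<le> exp (- (real l)\<^sup>2 / (2 * real n))" .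
  have "funk_hecke n l = (\<Prod>j<l. (real n - real j) / (real n + 1 + real j)) / (real n + 1 + real l)"
    unfolding funk_hecke_def lessThan_Suc_atMost[symmetric] by (simp add: prod_dividef)
  also have "\<dots> \<le> exp (- (real l)\<^sup>2 / (2 * real n)) / real n"
    using P n by (intro frac_le) auto
  finally show ?thesis .
qed (simp add: funk_hecke_eq_0)

text \<open>The constant comes from the maximum of \<open>k * ln x - x\<close>, attained at \<open>x = k\<close>.\<close>

lemma powr_le_exp:
  assumes k: "k \<ge> 0"
  shows "\<exists>C>0. \<forall>x>0. x powr k \<le> C * exp (x::real)"
proof (cases "k = 0")
  case True
  then show ?thesis by (intro exI[of _ 1]) auto
next
  case False
  with k have k: "k > 0" by simp
  have "x powr k \<le> exp (k * ln k) * exp x" if x: "x > 0" for x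
  proof -
    have "ln (x / k) \<le> x / k - 1" using x k by (intro ln_le_minus_one) simp
    then have "ln x \<le> x / k - 1 + ln k" using x k by (simp add: ln_div)
    then have "k * ln x \<le> k * (x / k - 1 + ln k)" using k by (intro mult_left_mono) auto
    also have "\<dots> \<le> k * ln k + x" using k by (simp add: algebra_simps)
    finally show ?thesis using x by (simp add: powr_def exp_add[symmetric])
  qed
  then show ?thesis by (intro exI[of _ "exp (k * ln k)"]) auto
qed

lemma powr_gaussian_bounded:
  assumes k: "k \<ge> 0"
  shows "\<exists>C>0. \<forall>t>0. t powr k * exp (- t\<^sup>2 / 2) \<le> (C::real)"
proof -
  obtain C where C: "C > 0" "\<And>x. x > 0 \<Longrightarrow> x powr (k / 2) \<le> C * exp x" using powr_le_exp[of "k / 2"] k by auto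
  have "t powr k * exp (- t\<^sup>2 / 2) \<le> 2 powr (k / 2) * C" if t: "t > 0" for t
  proof -
    have "t powr k = (t\<^sup>2) powr (k / 2)" using t by (simp add: powr_powr flip: powr_numeral)
    also have "\<dots> = 2 powr (k / 2) * (t\<^sup>2 / 2) powr (k / 2)" using t by (simp add: powr_divide)
    also have "\<dots> \<le> 2 powr (k / 2) * (C * exp (t\<^sup>2 / 2))" using t by (intro mult_left_mono C(2)) auto
    finally have "t powr k * exp (- t\<^sup>2 / 2) \<le> 2 powr (k / 2) * (C * exp (t\<^sup>2 / 2)) * exp (- t\<^sup>2 / 2)"
      by (intro mult_right_mono) auto
    then show ?thesis by (simp add: mult.assoc exp_add[symmetric])
  qed
  then show ?thesis using C(1) by (intro exI[of _ "2 powr (k / 2) * C"]) auto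
qed

text \<open>The sum is compared with the increments of the bounded function \<open>H t = t powr e / (1 + t powr e)\<close>
  on the scale \<open>sqrt n\<close>. The exponent \<open>e\<close> is small enough for the derivative of \<open>H\<close> to be decreasing
  and to dominate the summand near zero; near infinity the Gaussian factor wins.\<close>

lemma gaussian_sum_bound:
  assumes p: "p > -1"
  shows "\<exists>C>0. \<forall>n\<ge>1. \<forall>L. (\<Sum>i<L. real (Suc i) powr p * exp (- (real (Suc i))\<^sup>2 / (2 * real n))) \<le> C * real n powr ((p + 1) / 2)"
proof -
  define e where "e = min (p + 1) (1/2)"
  have e: "0 < e" "e \<le> p + 1" "e < 1" using p by (auto simp: e_def)
  define g where "g t = t powr (e - 1) / (1 + t powr e)\<^sup>2" for t :: real
  define H where "H t = t powr e / (1 + t powr e)" for t :: real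
  obtain C1 where C1: "C1 > 0" "\<And>t. t > 0 \<Longrightarrow> t powr (p + 1 - e) * exp (- t\<^sup>2 / 2) \<le> C1"
    using powr_gaussian_bounded[of "p + 1 - e"] e by auto
  obtain C2 where C2: "C2 > 0" "\<And>t. t > 0 \<Longrightarrow> t powr (p + 1) * exp (- t\<^sup>2 / 2) \<le> C2"
    using powr_gaussian_bounded[of "p + 1"] p by auto
  obtain C3 where C3: "C3 > 0" "\<And>t. t > 0 \<Longrightarrow> t powr (p + 1 + e) * exp (- t\<^sup>2 / 2) \<le> C3"
    using powr_gaussian_bounded[of "p + 1 + e"] p e by auto
  define C where "C = C1 + 2 * C2 + C3"
  have C: "C > 0" using C1 C2 C3 by (simp add: C_def)
  have dom: "t powr p * exp (- t\<^sup>2 / 2) \<le> C * g t" if t: "t > 0" for t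
  proof -
    have pw: "t powr p = t powr (e - 1) * t powr (p + 1 - e)" "t powr (p + 1) = t powr (p + 1 - e) * t powr e"
      "t powr (p + 1 + e) = t powr (p + 1 - e) * (t powr e * t powr e)"
      by (simp_all add: powr_add[symmetric] add_ac)
    have "t powr (p + 1 - e) * exp (- t\<^sup>2 / 2) * (1 + t powr e)\<^sup>2 =
      t powr (p + 1 - e) * exp (- t\<^sup>2 / 2) + 2 * (t powr (p + 1) * exp (- t\<^sup>2 / 2)) + t powr (p + 1 + e) * exp (- t\<^sup>2 / 2)"
      unfolding pw by (simp add: power2_eq_square algebra_simps)
    also have "\<dots> \<le> C" using C1(2)[OF t] C2(2)[OF t] C3(2)[OF t] by (simp add: C_def)
    finally have "t powr (p + 1 - e) * exp (- t\<^sup>2 / 2) \<le> C / (1 + t powr e)\<^sup>2"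
    proof (subst pos_le_divide_eq)
      have "1 + t powr e > 0" by (rule add_pos_nonneg) auto
      then show "(1 + t powr e)\<^sup>2 > 0" by (rule zero_less_power)
    qed
    then have "t powr (e - 1) * (t powr (p + 1 - e) * exp (- t\<^sup>2 / 2)) \<le> t powr (e - 1) * (C / (1 + t powr e)\<^sup>2)"
      by (rule mult_left_mono) simp
    then show ?thesis by (simp only: pw(1) g_def) (simp add: mult_ac)
  qed
  have gmono: "g t \<le> g u" if "0 < u" "u \<le> t" for u t
    unfolding g_def using that e
    by (intro frac_le powr_mono2' power_mono add_left_mono powr_mono2 zero_less_power add_pos_nonneg) auto
  have step: "e * g t * d \<le> H t - H (t - d)" if d: "0 < d" "d \<le> t" for t d
  proof -
    have t: "t > 0" using d by simp
    have "\<exists>z. t - d < z \<and> z < t \<and> H t - H (t - d) = (t - (t - d)) * (e * g z)"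
    proof -
      have "continuous_on {t - d..t} H"
        unfolding H_def using d e
        by (intro continuous_intros continuous_on_powr') (auto simp: add_nonneg_eq_0_iff)
      moreover have dH: "(H has_real_derivative e * g z) (at z)" if "t - d < z" "z < t" for z
      proof -
      have z: "z > 0" using d that by linarith
      have pos: "1 + z powr e \<noteq> 0" using powr_ge_zero[of z e] by linarith
      have "((\<lambda>z. z powr e) has_real_derivative e * z powr (e - 1)) (at z)"
        using z by (auto intro!: derivative_eq_intros)
      from DERIV_divide[OF this DERIV_add[OF DERIV_const[of 1] this] pos]
      show "(H has_real_derivative e * g z) (at z)"
        unfolding H_def[abs_def] g_def
        by (rule DERIV_cong) (use pos in \<open>simp add: power2_eq_square field_simps\<close>)
      qed
      ultimately obtain l z where "t - d < z" "z < t" "(H has_real_derivative l) (at z)" "H t - H (t - d) = (t - (t - d)) * l"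
        using MVT[of "t - d" t H] d(1) real_differentiable_def by (metis diff_less_eq less_add_same_cancel1)
      then show ?thesis using DERIV_unique[OF dH] by blast
    qed
    then obtain z where z: "t - d < z" "z < t" "H t - H (t - d) = d * (e * g z)" by auto
    have "g t \<le> g z" using z d by (intro gmono) auto
    then have "d * (e * g t) \<le> d * (e * g z)" using d e by (intro mult_left_mono) auto
    then show ?thesis using z(3) by (simp add: mult_ac)
  qed
  have main: "(\<Sum>i<L. real (Suc i) powr p * exp (- (real (Suc i))\<^sup>2 / (2 * real n))) \<le> C / e * real n powr ((p + 1) / 2)"
    if n: "n \<ge> 1" for n L :: nat
  proof -
    define r where "r = sqrt (real n)"
    have r: "r > 0" "r\<^sup>2 = real n" using n by (simp_all add: r_def)
    have "(\<Sum>i<L. real (Suc i) powr p * exp (- (real (Suc i))\<^sup>2 / (2 * real n)))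
        \<le> (\<Sum>i<L. C * r powr (p + 1) / e * (H (real (Suc i) / r) - H (real i / r)))"
    proof (rule sum_mono)
      fix i
      let ?t = "real (Suc i) / r"
      have t: "?t > 0" using r by simp
      have "real (Suc i) powr p * exp (- (real (Suc i))\<^sup>2 / (2 * real n)) = r powr p * (?t powr p * exp (- ?t\<^sup>2 / 2))"
        using r by (simp add: powr_divide power_divide r(2)[symmetric] mult.commute)
      also have "\<dots> \<le> r powr p * (C * g ?t)" by (intro mult_left_mono dom t) auto
      also have "\<dots> = C * r powr (p + 1) / e * (e * g ?t * (1 / r))"
        using r e by (simp add: powr_add)
      also have "\<dots> \<le> C * r powr (p + 1) / e * (H ?t - H (?t - 1 / r))"
        using r e C by (intro mult_left_mono step) (auto simp: divide_right_mono)
      also have "?t - 1 / r = real i / r" by (simp add: diff_divide_distrib[symmetric])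
      finally show "real (Suc i) powr p * exp (- (real (Suc i))\<^sup>2 / (2 * real n)) \<le>
          C * r powr (p + 1) / e * (H ?t - H (real i / r))" .
    qed
    also have "\<dots> = C * r powr (p + 1) / e * (H (real L / r) - H (real 0 / r))"
      by (simp only: sum_distrib_left[symmetric] sum_lessThan_telescope[of "\<lambda>i. H (real i / r)" L])
    also have "\<dots> \<le> C * r powr (p + 1) / e * 1"
    proof (rule mult_left_mono)
      have "H u \<le> 1" for u unfolding H_def
        by (subst pos_divide_le_eq) (auto intro: add_pos_nonneg)
      moreover have "H (real 0 / r) = 0" by (simp add: H_def)
      ultimately show "H (real L / r) - H (real 0 / r) \<le> 1" by (simp only: diff_zero)
    qed (use C e in auto)
    also have "r powr (p + 1) = real n powr ((p + 1) / 2)"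
      using n by (simp add: r_def powr_half_sqrt[symmetric] powr_powr)
    finally show ?thesis by simp
  qed
  show ?thesis using main C e by (intro exI[of _ "C / e"]) auto
qed

text \<open>For fixed \<open>m\<close> the sum over the degrees, with \<open>n = N * m\<close>, is a Gaussian sum of order
  \<open>n powr (2 - s)\<close>. It is here that \<open>s < 3\<close> enters, as the condition \<open>5 - 2 * s > -1\<close>. The remaining
  series over \<open>m\<close> is that of \<open>m powr (- s)\<close>, which converges since \<open>s > 1\<close>.\<close>

theorem weighted_variance_sum:
  assumes w: "sobolev_weights s a" and s: "1 < s" "s < 3"
  shows "\<exists>C>0. \<forall>N\<ge>1. \<forall>L. (\<Sum>i<L. a (Suc i) * (2 * real (Suc i) + 1) * ((eigval (Suc i))\<^sup>2 * stat_const N (Suc i))) \<le> C * real N powr (2 - s)"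
proof -
  have pos: "a l > 0" for l using w by (simp add: sobolev_weights_def)
  obtain c where c: "c > 0" "\<And>l. l \<ge> 1 \<Longrightarrow> a l \<le> c * real l powr (- 2 * s)"
    using sobolev_weights_upper[OF w] s by auto
  have coeff: "a l * (2 * real l + 1) * (eigval l)\<^sup>2 \<le> 12 * c * real l powr (5 - 2 * s)" if l: "l \<ge> 1" for l
  proof -
    have "a l \<le> c * real l powr (- 2 * s)" by (rule c(2)[OF l])
    moreover have "2 * real l + 1 \<le> 3 * real l" using l by simp
    moreover have "(eigval l)\<^sup>2 \<le> (2 * (real l)\<^sup>2)\<^sup>2"
      using l by (intro power_mono) (auto simp: eigval_def power2_eq_square)
    ultimately have "a l * (2 * real l + 1) * (eigval l)\<^sup>2 \<le> c * real l powr (- 2 * s) * (3 * real l) * (2 * (real l)\<^sup>2)\<^sup>2"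
      using l pos[of l] c by (intro mult_mono) auto
    also have "\<dots> = 12 * c * (real l powr (- 2 * s) * real l ^ 5)"
      by (simp add: power2_eq_square eval_nat_numeral)
    also have "real l powr (- 2 * s) * real l ^ 5 = real l powr (5 - 2 * s)"
    proof -
      have "real l ^ 5 = real l powr 5" using l by (simp add: powr_numeral)
      moreover have "- 2 * s + 5 = 5 - 2 * s" by simp
      ultimately show ?thesis by (simp only: powr_add[symmetric])
    qed
    finally show ?thesis .
  qed
  obtain D where D: "D > 0" "\<And>n L. n \<ge> 1 \<Longrightarrow>
     (\<Sum>i<L. real (Suc i) powr (5 - 2 * s) * exp (- (real (Suc i))\<^sup>2 / (2 * real n))) \<le> D * real n powr ((5 - 2 * s + 1) / 2)"
    using gaussian_sum_bound[of "5 - 2 * s"] s by auto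
  have sz: "summable (\<lambda>m. real m powr (- s))" using s by (simp add: summable_real_powr_iff)
  define Z where "Z = (\<Sum>m. real m powr (- s))"
  have Z: "Z \<ge> 0" unfolding Z_def by (rule suminf_nonneg[OF sz]) simp
  define K where "K = 12 * c * D"
  have K: "K > 0" using c D by (simp add: K_def)
  have main: "(\<Sum>i<L. a (Suc i) * (2 * real (Suc i) + 1) * ((eigval (Suc i))\<^sup>2 * stat_const N (Suc i))) \<le> K * Z * real N powr (2 - s)"
    if N: "N \<ge> 1" for N L :: nat
  proof -
    define u where "u i = a (Suc i) * (2 * real (Suc i) + 1) * (eigval (Suc i))\<^sup>2" for i
    have u: "0 \<le> u i" "u i \<le> 12 * c * real (Suc i) powr (5 - 2 * s)" for i
      unfolding u_def using coeff[of "Suc i"] pos[of "Suc i"] by (auto intro!: mult_nonneg_nonneg)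
    have inner: "(\<Sum>i<L. u i * funk_hecke n (Suc i)) \<le> K * real n powr (2 - s)" if n: "n \<ge> 1" for n
    proof -
      have "(\<Sum>i<L. u i * funk_hecke n (Suc i)) \<le>
         (\<Sum>i<L. 12 * c * real (Suc i) powr (5 - 2 * s) * (exp (- (real (Suc i))\<^sup>2 / (2 * real n)) / real n))"
        by (intro sum_mono mult_mono u funk_hecke_gaussian_bound n funk_hecke_nonneg) (use c in auto)
      also have "\<dots> = 12 * c / real n * (\<Sum>i<L. real (Suc i) powr (5 - 2 * s) * exp (- (real (Suc i))\<^sup>2 / (2 * real n)))"
        by (simp add: sum_distrib_left mult_ac)
      also have "\<dots> \<le> 12 * c / real n * (D * real n powr ((5 - 2 * s + 1) / 2))"
        using c n by (intro mult_left_mono D(2)) auto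
      also have "\<dots> = K * (real n powr (3 - s) / real n powr 1)"
        using n by (simp add: K_def diff_divide_distrib field_simps)
      also have "real n powr (3 - s) / real n powr 1 = real n powr (2 - s)"
        by (simp only: powr_diff[symmetric]) simp
      finally show ?thesis .
    qed
    have S1: "(\<lambda>m. \<Sum>i<L. u i * (1 / (real m)\<^sup>2 * funk_hecke (N * m) (Suc i))) sums (\<Sum>i<L. u i * stat_const N (Suc i))"
      unfolding stat_const_def by (intro sums_sum sums_mult summable_sums summable_stat_const)
    have S2: "(\<lambda>m. K * real N powr (2 - s) * real m powr (- s)) sums (K * real N powr (2 - s) * Z)"
      unfolding Z_def by (intro sums_mult summable_sums sz)
    have le: "(\<Sum>i<L. u i * (1 / (real m)\<^sup>2 * funk_hecke (N * m) (Suc i))) \<le> K * real N powr (2 - s) * real m powr (- s)" for m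
    proof (cases "m = 0")
      case False
      have "(\<Sum>i<L. u i * (1 / (real m)\<^sup>2 * funk_hecke (N * m) (Suc i))) = 1 / (real m)\<^sup>2 * (\<Sum>i<L. u i * funk_hecke (N * m) (Suc i))"
        by (simp add: sum_distrib_left)
      also have "\<dots> \<le> 1 / (real m)\<^sup>2 * (K * real (N * m) powr (2 - s))"
        using N False by (intro mult_left_mono inner) auto
      also have "\<dots> = K * real N powr (2 - s) * (real m powr (2 - s) / real m powr 2)"
        using False by (simp add: powr_mult)
      also have "real m powr (2 - s) / real m powr 2 = real m powr (- s)"
        by (simp only: powr_diff[symmetric]) simp
      finally show ?thesis .
    qed simp
    have "(\<Sum>i<L. u i * stat_const N (Suc i)) \<le> K * real N powr (2 - s) * Z"
      by (rule sums_le[OF le S1 S2])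
    then show ?thesis by (simp add: u_def mult_ac)
  qed
  show ?thesis
  proof (intro exI[of _ "K * (Z + 1)"] conjI allI impI)
    show "K * (Z + 1) > 0" using K Z by simp
    fix N L :: nat assume N: "N \<ge> 1"
    have "K * Z * real N powr (2 - s) \<le> K * (Z + 1) * real N powr (2 - s)"
      using K by (intro mult_right_mono) auto
    with main[OF N, of L] show "(\<Sum>i<L. a (Suc i) * (2 * real (Suc i) + 1) * ((eigval (Suc i))\<^sup>2 * stat_const N (Suc i))) \<le> K * (Z + 1) * real N powr (2 - s)"
      by linarith
  qed
qed

text \<open>All terms of the series are nonnegative, and the one with index 1 already has the right order.\<close>

lemma stat_const_1_lower:
  assumes N: "N \<ge> 1" shows "stat_const N 1 \<ge> 1 / (6 * real N)"
proof -
  have "(\<Sum>m\<in>{1}. 1 / (real m)\<^sup>2 * funk_hecke (N * m) 1) \<le> stat_const N 1"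
    unfolding stat_const_def
    by (rule sum_le_suminf[OF summable_stat_const]) (auto intro!: divide_nonneg_nonneg funk_hecke_nonneg)
  moreover have "funk_hecke N 1 = real N / ((real N + 1) * (real N + 2))"
    by (simp add: funk_hecke_def atMost_Suc)
  moreover have "real N / ((real N + 1) * (real N + 2)) \<ge> real N / ((2 * real N) * (3 * real N))"
    using N by (intro divide_left_mono mult_mono mult_pos_pos) auto
  moreover have "real N / ((2 * real N) * (3 * real N)) = 1 / (6 * real N)" using N by simp
  ultimately show ?thesis by simp
qed

section \<open>Upper and lower bounds for the expected squared error\<close>

text \<open>A harmonic of degree one, scaled to Sobolev norm one, is an admissible test function. The square
  of its mean over the zeros has expectation of order \<open>N powr (- 3)\<close>, whatever the smoothness \<open>s\<close>; this
  is the obstruction beyond \<open>s = 3\<close>.\<close>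

lemma (in harmonic_bases) first_harmonic_test_function:
  assumes w: "sobolev_weights s a"
  defines "f \<equiv> \<lambda>x. sqrt (a 1) * Y 1 1 x"
  shows "f \<in> sobolev Y s" "continuous_on S2 f" "sobolev_norm Y a f \<le> 1" "(LINT x|sphere_measure. f x) = 0"
proof -
  have k: "1 \<in> {1..2*1+1::nat}" by simp
  have a: "a 1 > 0" using w by (simp add: sobolev_weights_def)
  show cf: "continuous_on S2 f" unfolding f_def by (intro continuous_intros Y_continuous k)
  have fc: "fcoeff Y f l j = (if l = 1 \<and> j = 1 then sqrt (a 1) else 0)" if "j \<in> {1..2*l+1}" for l j
  proof -
    have "fcoeff Y f l j = sqrt (a 1) * (LINT x|sphere_measure. Y 1 1 x * Y l j x)"
      unfolding fcoeff_def f_def mult.assoc by (rule integral_mult_right_zero)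
    then show ?thesis by (subst (asm) Y_orthonormal2[OF k that]) auto
  qed
  have sum: "(\<Sum>j=1..2*l+1. u l * \<bar>fcoeff Y f l j\<bar>\<^sup>2) = (if l = 1 then u 1 * a 1 else 0)" for u :: "nat \<Rightarrow> real" and l
  proof -
    have "(\<Sum>j=1..2*l+1. u l * \<bar>fcoeff Y f l j\<bar>\<^sup>2) = (\<Sum>j=1..2*l+1. if j = 1 then (if l = 1 then u 1 * a 1 else 0) else 0)"
    proof (rule sum.cong[OF refl])
      fix j assume j: "j \<in> {1..2*l+1}"
      show "u l * \<bar>fcoeff Y f l j\<bar>\<^sup>2 = (if j = 1 then (if l = 1 then u 1 * a 1 else 0) else 0)"
        unfolding fc[OF j] using a by simp
    qed
    also have "\<dots> = (if l = 1 then u 1 * a 1 else 0)" by (subst sum.delta) auto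
    finally show ?thesis .
  qed
  have "integrable sphere_measure (\<lambda>x. (f x)\<^sup>2)"
    by (intro continuous_on_S2_integrable continuous_intros cf)
  then have "f \<in> L2_sphere" unfolding L2_sphere_def using continuous_on_S2_measurable[OF cf] by simp
  moreover have "summable (\<lambda>l. \<Sum>j=1..2*l+1. (1 + eigval l) powr s * \<bar>fcoeff Y f l j\<bar>\<^sup>2)"
    unfolding sum[of "\<lambda>l. (1 + eigval l) powr s"] using sums_single[of 1 "\<lambda>_. (1 + eigval 1) powr s * a 1"]
    by (auto simp: sums_iff)
  ultimately show "f \<in> sobolev Y s" unfolding sobolev_def by blast
  have "(\<Sum>l. \<Sum>j=1..2*l+1. 1 / a l * \<bar>fcoeff Y f l j\<bar>\<^sup>2) = 1"
    unfolding sum[of "\<lambda>l. 1 / a l"] using sums_single[of 1 "\<lambda>_. 1 / a 1 * a 1"] a by (simp add: sums_iff)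
  then show "sobolev_norm Y a f \<le> 1" unfolding sobolev_norm_def by simp
  show "(LINT x|sphere_measure. f x) = 0"
    unfolding f_def using spherical_harmonic_mean_zero[OF Y_harmonic[OF k]] by simp
qed

lemma (in harmonic_bases) wce_lower:
  assumes w: "sobolev_weights s (a s)"
  shows "ennreal (a s 1 * ((\<Sum>x\<in>X. Y 1 1 x) / real (card X))\<^sup>2) \<le> (wce Y a s X)\<^sup>2"
proof -
  let ?f = "\<lambda>x. sqrt (a s 1) * Y 1 1 x" and ?S = "(\<Sum>x\<in>X. Y 1 1 x) / real (card X)"
  note t = first_harmonic_test_function[OF w]
  have a: "a s 1 > 0" using w by (simp add: sobolev_weights_def)
  have "ennreal \<bar>(\<Sum>x\<in>X. ?f x) / real (card X) - (LINT x|sphere_measure. ?f x)\<bar> \<le> wce Y a s X"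
    unfolding wce_def by (rule SUP_upper) (use t in simp)
  also have "(\<Sum>x\<in>X. ?f x) / real (card X) - (LINT x|sphere_measure. ?f x) = sqrt (a s 1) * ?S"
    unfolding t(4) by (simp add: sum_distrib_left[symmetric])
  finally have "(ennreal \<bar>sqrt (a s 1) * ?S\<bar>)\<^sup>2 \<le> (wce Y a s X)\<^sup>2" by (rule power_mono) simp
  moreover have "(ennreal \<bar>sqrt (a s 1) * ?S\<bar>)\<^sup>2 = ennreal (a s 1 * ?S\<^sup>2)"
  proof -
    have "(ennreal \<bar>z\<bar>)\<^sup>2 = ennreal (z\<^sup>2)" for z by (simp add: ennreal_power)
    then show ?thesis using a by (simp only: power_mult_distrib real_sqrt_pow2 less_imp_le)
  qed
  ultimately show ?thesis by simp
qed

context random_elliptic_harmonic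
begin

lemma normalized_statistic_second_moment:
  assumes N: "N \<ge> 1" and k: "k \<in> {1..2*l+1}" and l: "l \<ge> 1"
  shows "(\<integral>\<^sup>+\<omega>. ennreal (((\<Sum>x\<in>X N \<omega>. Y l k x) / real N)\<^sup>2) \<partial>completion M) =
    ennreal ((eigval l)\<^sup>2 * stat_const N l / (real N)\<^sup>2)"
proof -
  have m: "(\<lambda>\<omega>. \<Sum>x\<in>X N \<omega>. Y l k x) \<in> borel_measurable (completion M)"
    by (rule statistic_measurable[OF N Y_continuous[OF k]])
  have "(\<integral>\<^sup>+\<omega>. ennreal (((\<Sum>x\<in>X N \<omega>. Y l k x) / real N)\<^sup>2) \<partial>completion M) =
      (\<integral>\<^sup>+\<omega>. ennreal (1 / (real N)\<^sup>2) * ennreal ((\<Sum>x\<in>X N \<omega>. Y l k x)\<^sup>2) \<partial>completion M)"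
    by (intro nn_integral_cong) (simp add: ennreal_mult[symmetric] power_divide)
  also have "\<dots> = ennreal (1 / (real N)\<^sup>2) * (\<integral>\<^sup>+\<omega>. ennreal ((\<Sum>x\<in>X N \<omega>. Y l k x)\<^sup>2) \<partial>completion M)"
    by (rule nn_integral_cmult) (use m in measurable)
  also have "\<dots> = ennreal (1 / (real N)\<^sup>2 * ((eigval l)\<^sup>2 * stat_const N l))"
    unfolding nn_integral_completion Y_statistic_second_moment[OF N k l] by (rule ennreal_mult'[symmetric]) simp
  finally show ?thesis by simp
qed

text \<open>The dual norm is averaged degree by degree: each of the \<open>2 * l + 1\<close> harmonics of degree \<open>l\<close> has the
  same second moment.\<close>

theorem expected_sq_wce_upper:
  assumes w: "sobolev_weights s (a s)" and s: "1 < s" "s < 3"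
  shows "\<exists>C>0. \<forall>N\<ge>1. expected_sq_wce M Y a s (X N) \<le> ennreal (C * real N powr (- s))"
proof -
  have pos: "a s l > 0" for l using w by (simp add: sobolev_weights_def)
  obtain C where C: "C > 0" "\<And>N L. N \<ge> 1 \<Longrightarrow> (\<Sum>i<L. a s (Suc i) * (2 * real (Suc i) + 1) * ((eigval (Suc i))\<^sup>2 * stat_const N (Suc i))) \<le> C * real N powr (2 - s)"
    using weighted_variance_sum[OF w s] by blast
  have sc: "stat_const N l \<ge> 0" for N l unfolding stat_const_def
    by (rule suminf_nonneg[OF summable_stat_const]) (intro mult_nonneg_nonneg funk_hecke_nonneg, simp)
  have "expected_sq_wce M Y a s (X N) \<le> ennreal (C * real N powr (- s))" if N: "N \<ge> 1" for N
  proof -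
    let ?T = "\<lambda>i k \<omega>. ennreal (((\<Sum>x\<in>X N \<omega>. Y (Suc i) k x) / real N)\<^sup>2)"
    have m: "?T i k \<in> borel_measurable (completion M)" if "k \<in> {1..2*Suc i+1}" for i k
    proof -
      have [measurable]: "(\<lambda>\<omega>. \<Sum>x\<in>X N \<omega>. Y (Suc i) k x) \<in> borel_measurable (completion M)"
        by (rule statistic_measurable[OF N Y_continuous[OF that]])
      show ?thesis by measurable
    qed
    have "expected_sq_wce M Y a s (X N) \<le> (\<integral>\<^sup>+\<omega>. (\<Sum>i. ennreal (a s (Suc i)) * (\<Sum>k=1..2*Suc i+1. ?T i k \<omega>)) \<partial>M)"
      unfolding expected_sq_wce_def
    proof (rule nn_integral_mono_AE, rule AE_mp[OF AE_X[OF N]], intro AE_I2 impI)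
      fix \<omega> assume X: "X N \<omega> \<subseteq> S2 \<and> finite (X N \<omega>) \<and> card (X N \<omega>) = N"
      then have "X N \<omega> \<noteq> {}" using N by auto
      with X have "(wce Y a s (X N \<omega>))\<^sup>2 \<le> wce_bound (a s) (X N \<omega>)"
        by (intro wce_sq_le[where a=a and s=s, OF w s(1)]) auto
      then show "(wce Y a s (X N \<omega>))\<^sup>2 \<le> (\<Sum>i. ennreal (a s (Suc i)) * (\<Sum>k=1..2*Suc i+1. ?T i k \<omega>))"
        unfolding wce_bound_def using X by (simp only: conj_assoc)
    qed
    also have "\<dots> = (\<integral>\<^sup>+\<omega>. (\<Sum>i. ennreal (a s (Suc i)) * (\<Sum>k=1..2*Suc i+1. ?T i k \<omega>)) \<partial>completion M)"
      by (rule nn_integral_completion[symmetric])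
    also have "\<dots> = (\<Sum>i. \<integral>\<^sup>+\<omega>. ennreal (a s (Suc i)) * (\<Sum>k=1..2*Suc i+1. ?T i k \<omega>) \<partial>completion M)"
      by (rule nn_integral_suminf) (intro borel_measurable_times_ennreal borel_measurable_const borel_measurable_sum m)
    also have "\<dots> = (\<Sum>i. ennreal (a s (Suc i) * (2 * real (Suc i) + 1) * ((eigval (Suc i))\<^sup>2 * stat_const N (Suc i)) / (real N)\<^sup>2))"
    proof (rule suminf_cong)
      fix i
      let ?v = "(eigval (Suc i))\<^sup>2 * stat_const N (Suc i) / (real N)\<^sup>2"
      have v: "?v \<ge> 0" using sc by simp
      have "(\<integral>\<^sup>+\<omega>. ennreal (a s (Suc i)) * (\<Sum>k=1..2*Suc i+1. ?T i k \<omega>) \<partial>completion M) =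
         ennreal (a s (Suc i)) * (\<integral>\<^sup>+\<omega>. (\<Sum>k=1..2*Suc i+1. ?T i k \<omega>) \<partial>completion M)"
        by (rule nn_integral_cmult) (intro borel_measurable_sum m)
      also have "(\<integral>\<^sup>+\<omega>. (\<Sum>k=1..2*Suc i+1. ?T i k \<omega>) \<partial>completion M) = (\<Sum>k=1..2*Suc i+1. \<integral>\<^sup>+\<omega>. ?T i k \<omega> \<partial>completion M)"
        by (rule nn_integral_sum) (rule m)
      also have "\<dots> = (\<Sum>k=1..2*Suc i+1. ennreal ?v)"
        by (rule sum.cong[OF refl]) (rule normalized_statistic_second_moment[OF N], assumption, simp)
      also have "\<dots> = ennreal ((2 * real (Suc i) + 1) * ?v)"
        using v by (subst sum_ennreal) auto
      also have "ennreal (a s (Suc i)) * \<dots> = ennreal (a s (Suc i) * ((2 * real (Suc i) + 1) * ?v))"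
        using pos[of "Suc i"] by (intro ennreal_mult[symmetric] mult_nonneg_nonneg v) auto
      finally show "(\<integral>\<^sup>+\<omega>. ennreal (a s (Suc i)) * (\<Sum>k=1..2*Suc i+1. ?T i k \<omega>) \<partial>completion M) =
        ennreal (a s (Suc i) * (2 * real (Suc i) + 1) * ((eigval (Suc i))\<^sup>2 * stat_const N (Suc i)) / (real N)\<^sup>2)"
        by (simp only: mult.assoc times_divide_eq_right)
    qed
    also have "\<dots> \<le> ennreal (C * real N powr (- s))"
    proof (subst suminf_eq_SUP, rule SUP_least)
      fix L
      have "(\<Sum>i<L. ennreal (a s (Suc i) * (2 * real (Suc i) + 1) * ((eigval (Suc i))\<^sup>2 * stat_const N (Suc i)) / (real N)\<^sup>2)) =
        ennreal (\<Sum>i<L. a s (Suc i) * (2 * real (Suc i) + 1) * ((eigval (Suc i))\<^sup>2 * stat_const N (Suc i)) / (real N)\<^sup>2)"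
        using sc pos by (intro sum_ennreal divide_nonneg_nonneg mult_nonneg_nonneg) (auto intro: less_imp_le)
      also have "\<dots> \<le> ennreal (C * real N powr (2 - s) / (real N)\<^sup>2)"
        unfolding sum_divide_distrib[symmetric] by (intro ennreal_leI divide_right_mono C(2) N) simp
      also have "C * real N powr (2 - s) / (real N)\<^sup>2 = C * (real N powr (2 - s) / real N powr 2)"
        using N by (simp add: powr_numeral)
      also have "real N powr (2 - s) / real N powr 2 = real N powr (- s)"
        by (simp only: powr_diff[symmetric]) simp
      finally show "(\<Sum>i<L. ennreal (a s (Suc i) * (2 * real (Suc i) + 1) * ((eigval (Suc i))\<^sup>2 * stat_const N (Suc i)) / (real N)\<^sup>2)) \<le> ennreal (C * real N powr (- s))" .
    qed
    finally show ?thesis .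
  qed
  then show ?thesis using C(1) by blast
qed

theorem expected_sq_wce_lower:
  assumes w: "sobolev_weights s (a s)"
  shows "\<exists>C>0. \<forall>N\<ge>1. ennreal (C / real N ^ 3) \<le> expected_sq_wce M Y a s (X N)"
proof (intro exI[of _ "2 / 3 * a s 1"] conjI allI impI)
  have a: "a s 1 > 0" using w by (simp add: sobolev_weights_def)
  then show "2 / 3 * a s 1 > 0" by simp
  fix N :: nat assume N: "N \<ge> 1"
  have k: "1 \<in> {1..2*1+1::nat}" by simp
  have m: "(\<lambda>\<omega>. \<Sum>x\<in>X N \<omega>. Y 1 1 x) \<in> borel_measurable (completion M)"
    by (rule statistic_measurable[OF N Y_continuous[OF k]])
  have sc: "stat_const N 1 \<ge> 1 / (6 * real N)" by (rule stat_const_1_lower[OF N])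
  then have sc0: "stat_const N 1 \<ge> 0" by (rule order_trans[rotated]) simp
  have "2 / 3 * a s 1 / real N ^ 3 = a s 1 * ((eigval 1)\<^sup>2 * (1 / (6 * real N)) / (real N)\<^sup>2)"
    using N by (simp add: eigval_def power3_eq_cube power2_eq_square field_simps)
  also have "\<dots> \<le> a s 1 * ((eigval 1)\<^sup>2 * stat_const N 1 / (real N)\<^sup>2)"
    using sc a by (intro mult_left_mono divide_right_mono) auto
  finally have "ennreal (2 / 3 * a s 1 / real N ^ 3) \<le> ennreal (a s 1 * ((eigval 1)\<^sup>2 * stat_const N 1 / (real N)\<^sup>2))"
    by (rule ennreal_leI)
  also have "\<dots> = ennreal (a s 1) * (\<integral>\<^sup>+\<omega>. ennreal (((\<Sum>x\<in>X N \<omega>. Y 1 1 x) / real N)\<^sup>2) \<partial>completion M)"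
    unfolding normalized_statistic_second_moment[OF N k order_refl] using a sc0 by (subst ennreal_mult) auto
  also have "\<dots> = (\<integral>\<^sup>+\<omega>. ennreal (a s 1) * ennreal (((\<Sum>x\<in>X N \<omega>. Y 1 1 x) / real N)\<^sup>2) \<partial>completion M)"
    by (rule nn_integral_cmult[symmetric]) (use m in measurable)
  also have "\<dots> = (\<integral>\<^sup>+\<omega>. ennreal (a s 1 * ((\<Sum>x\<in>X N \<omega>. Y 1 1 x) / real N)\<^sup>2) \<partial>M)"
    unfolding nn_integral_completion using a by (intro nn_integral_cong) (simp add: ennreal_mult)
  also have "\<dots> \<le> expected_sq_wce M Y a s (X N)"
    unfolding expected_sq_wce_def
  proof (rule nn_integral_mono_AE, rule AE_mp[OF AE_X[OF N]], intro AE_I2 impI)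
    fix \<omega> assume "X N \<omega> \<subseteq> S2 \<and> finite (X N \<omega>) \<and> card (X N \<omega>) = N"
    then show "ennreal (a s 1 * ((\<Sum>x\<in>X N \<omega>. Y 1 1 x) / real N)\<^sup>2) \<le> (wce Y a s (X N \<omega>))\<^sup>2"
      using wce_lower[where a=a and s=s and X="X N \<omega>", OF w] by simp
  qed
  finally show "ennreal (2 / 3 * a s 1 / real N ^ 3) \<le> expected_sq_wce M Y a s (X N)" .
qed

corollary qmc_on_average_below_3:
  assumes w: "sobolev_weights s (a s)" and s: "1 < s" "s < 3"
  shows "qmc_on_average M Y a s X"
proof -
  obtain C where C: "C > 0" "\<And>N. N \<ge> 1 \<Longrightarrow> expected_sq_wce M Y a s (X N) \<le> ennreal (C * real N powr (- s))"
    using expected_sq_wce_upper[where a=a and s=s, OF w s] by blast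
  have "expected_sq_wce M Y a s (X N) < \<infinity> \<and>
     sqrt (enn2real (expected_sq_wce M Y a s (X N))) \<le> sqrt C * real N powr (- s / 2)" if N: "N \<ge> 1" for N
  proof
    show "expected_sq_wce M Y a s (X N) < \<infinity>" using C(2)[OF N] by (rule le_less_trans) simp
    have "enn2real (expected_sq_wce M Y a s (X N)) \<le> C * real N powr (- s)"
      using C N by (intro enn2real_leI) auto
    then have "sqrt (enn2real (expected_sq_wce M Y a s (X N))) \<le> sqrt C * sqrt (real N powr (- s))"
      by (simp add: real_sqrt_mult[symmetric])
    also have "sqrt (real N powr (- s)) = real N powr (- s / 2)"
      using N by (simp add: powr_half_sqrt[symmetric] powr_powr)
    finally show "sqrt (enn2real (expected_sq_wce M Y a s (X N))) \<le> sqrt C * real N powr (- s / 2)" .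
  qed
  then show ?thesis unfolding qmc_on_average_def
    using X_random_configuration C(1) by (intro conjI allI impI exI[of _ "sqrt C"]) auto
qed

text \<open>An upper bound of order \<open>N powr (- s)\<close> with \<open>s > 3\<close> would fall below the lower bound of order
  \<open>N powr (- 3)\<close> for large \<open>N\<close>.\<close>

corollary not_qmc_on_average_above_3:
  assumes w: "sobolev_weights s (a s)" and s: "3 < s"
  shows "\<not> qmc_on_average M Y a s X"
proof
  assume "qmc_on_average M Y a s X"
  then obtain D where D: "D > 0" "\<And>N. N \<ge> 1 \<Longrightarrow> expected_sq_wce M Y a s (X N) < \<infinity>"
    "\<And>N. N \<ge> 1 \<Longrightarrow> sqrt (enn2real (expected_sq_wce M Y a s (X N))) \<le> D * real N powr (- s / 2)"
    unfolding qmc_on_average_def by blast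
  obtain C where C: "C > 0" "\<And>N. N \<ge> 1 \<Longrightarrow> ennreal (C / real N ^ 3) \<le> expected_sq_wce M Y a s (X N)"
    using expected_sq_wce_lower[where a=a and s=s, OF w] by blast
  have le: "C * real N powr (s - 3) \<le> D\<^sup>2" if N: "N \<ge> 1" for N
  proof -
    let ?E = "enn2real (expected_sq_wce M Y a s (X N))"
    have "C / real N ^ 3 \<le> ?E"
      using C(2)[OF N] D(2)[OF N] C(1) by (simp add: enn2real_mono[of "ennreal _", simplified] flip: enn2real_ennreal)
        (metis C(1) enn2real_ennreal enn2real_mono divide_nonneg_nonneg less_imp_le of_nat_0_le_iff zero_le_power top.not_eq_extremum)?
    also have "?E = (sqrt ?E)\<^sup>2" by simp
    also have "\<dots> \<le> (D * real N powr (- s / 2))\<^sup>2" by (rule power_mono[OF D(3)[OF N]]) simp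
    also have "\<dots> = D\<^sup>2 * real N powr (- s)"
      using N by (simp add: power_mult_distrib powr_powr flip: powr_numeral)
    finally have "C / real N ^ 3 * real N powr s \<le> D\<^sup>2 * real N powr (- s) * real N powr s"
      by (rule mult_right_mono) simp
    also have "\<dots> = D\<^sup>2" using N by (simp add: mult.assoc powr_add[symmetric])
    also have "C / real N ^ 3 * real N powr s = C * (real N powr s / real N powr 3)"
      using N by (simp add: powr_numeral)
    also have "real N powr s / real N powr 3 = real N powr (s - 3)" by (rule powr_diff[symmetric])
    finally show ?thesis .
  qed
  have "filterlim (\<lambda>N. C * real N powr (s - 3)) at_top sequentially"
    using C(1) s by real_asymp
  then have "\<forall>\<^sub>F N in sequentially. C * real N powr (s - 3) > D\<^sup>2" by (simp add: filterlim_at_top_dense)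
  then have "\<forall>\<^sub>F N in sequentially. False"
    using eventually_ge_at_top[of 1]
  proof eventually_elim
    case (elim N)
    then show ?case using le[of N] by simp
  qed
  then show False by simp
qed

end

section \<open>The average QMC strength\<close>

theorem theorem3:
  fixes M :: "'w measure"
    and Y :: "nat \<Rightarrow> nat \<Rightarrow> real^3 \<Rightarrow> real"
    and a :: "real \<Rightarrow> nat \<Rightarrow> real"
    and A :: "nat \<Rightarrow> nat \<Rightarrow> 'w \<Rightarrow> complex"
    and X :: "nat \<Rightarrow> 'w \<Rightarrow> (real^3) set"
  assumes "prob_space M"
    and "\<And>l. harmonic_onb l (Y l)"
    and "\<And>s. s \<ge> 0 \<Longrightarrow> sobolev_weights s (a s)"
    and "\<And>N. N \<ge> 1 \<Longrightarrow> prob_space.indep_vars M (\<lambda>_. borel) (A N) {0..N}"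
    and "\<And>N n. N \<ge> 1 \<Longrightarrow> n \<le> N \<Longrightarrow> std_complex_gaussian M (A N n)"
    and "\<And>N \<omega>. X N \<omega> = elliptic_points N (\<lambda>n. A N n \<omega>)"
  shows "(\<forall>s. 1 < s \<and> s < 3 \<longrightarrow> qmc_on_average M Y a s X) \<and>
         (\<forall>s. 3 < s \<and> s < 4 \<longrightarrow>
            (\<exists>C>0. \<forall>N\<ge>1. of_nat (N ^ 3) * expected_sq_wce M Y a s (X N) \<ge> ennreal C)) \<and>
         average_qmc_strength M Y a X 3"
proof -
  interpret random_elliptic_harmonic M A X Y
    using assms(1,2,4,5,6)
    by (intro random_elliptic_harmonic.intro random_elliptic.intro random_elliptic_axioms.intro
        harmonic_bases.intro) auto
  have w: "sobolev_weights s (a s)" if "s > 1" for s using assms(3) that by simp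
  have below: "qmc_on_average M Y a s X" if "1 < s" "s < 3" for s
    by (rule qmc_on_average_below_3[where a=a and s=s, OF w that]) (use that in simp)
  have lower: "\<exists>C>0. \<forall>N\<ge>1. of_nat (N ^ 3) * expected_sq_wce M Y a s (X N) \<ge> ennreal C" if s: "3 < s" for s
  proof -
    obtain C where C: "C > 0" "\<And>N. N \<ge> 1 \<Longrightarrow> ennreal (C / real N ^ 3) \<le> expected_sq_wce M Y a s (X N)"
      using expected_sq_wce_lower[where a=a and s=s, OF w] s by auto
    have "ennreal C \<le> of_nat (N ^ 3) * expected_sq_wce M Y a s (X N)" if N: "N \<ge> 1" for N
    proof -
      have "ennreal C = ennreal (real (N ^ 3) * (C / real N ^ 3))" using N by simp
      also have "\<dots> = of_nat (N ^ 3) * ennreal (C / real N ^ 3)"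
        using C(1) by (subst ennreal_mult) (auto simp: ennreal_of_nat_eq_real_of_nat)
      also have "\<dots> \<le> of_nat (N ^ 3) * expected_sq_wce M Y a s (X N)"
        by (rule mult_left_mono[OF C(2)[OF N]]) simp
      finally show ?thesis .
    qed
    with C(1) show ?thesis by blast
  qed
  have "average_qmc_strength M Y a X 3"
    unfolding average_qmc_strength_def
  proof (intro conjI allI impI)
    fix t :: real assume t: "1 < t" "\<forall>s. 1 < s \<and> s < t \<longrightarrow> qmc_on_average M Y a s X"
    show "t \<le> 3"
    proof (rule ccontr)
      assume "\<not> t \<le> 3"
      then have "3 < (3 + t) / 2" "(3 + t) / 2 < t" by auto
      then show False
        using t(2) not_qmc_on_average_above_3[where a=a and s="(3 + t) / 2", OF w] by auto
    qed
  qed (use below in auto)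
  with below lower show ?thesis by blast
qed

end
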